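(* The concurrent linked-list map implementation described in the context (operations insert, remove, contains and rangeQuery, with auxiliary methods find and trim, ignoring memory reclamation and any external index) is linearizable with respect to the sequential specification of a map from keys to values with range queries. That is, in every execution, each completed operation can be assigned a linearization point between its invocation and its response such that the responses agree with the sequential map semantics: insert(k,v) returns NO\_VAL and adds $(k,v)$ if $k$ is absent, otherwise returns the present value; remove(k) removes $k$ and returns its value if present, otherwise returns NO\_VAL; contains(k) returns the value of $k$ if present, otherwise NO\_VAL; rangeQuery(low, high) returns exactly the key-value pairs with $low \le key \le high$ present in the map.
   Context: Model: asynchronous shared memory with threads communicating via atomic read, write, and compare-and-swap (CAS(addr, expected, new) atomically replaces the content of addr by new iff it equals expected, and returns whether it did). A shared integer clock globalTS, initially 2, is read atomically by getTS() and atomically fetched-and-incremented by fetchAddTS() (which returns the old value). A special constant $\bot = 1$ denotes an uninitialized timestamp. Pointers carry two low-order bits: a mark bit and a flag bit; a pointer is never both marked and flagged; getRef(p) strips the bits. mark(node) reads $p$ = node.next, returns false if $p$ is marked or flagged, else returns CAS(\&node.next, $p$, $p$ with mark bit set); flag(node) is the same with the flag bit. Node fields: ts (timestamp), key, value (immutable), next (pointer), prior (pointer, written once at initialization). alloc(k,v,$\bot$) creates a node with ts $=\bot$. Initialization: head = node with key $-\infty$, ts 2, prior NULL; tail = node with key $+\infty$, ts 2, next NULL, prior NULL; head.next = tail. The map's content is represented by non-sentinel nodes. find(key): retry: pred := head; predNext := pred.next; curr := getRef(predNext). Loop: while curr.next is marked or flagged { if getRef(curr.next) is NULL break; curr :=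 getRef(curr.next) }; if curr.key $\ge$ key break; pred := curr; predNext := pred.next; if predNext is marked or flagged goto retry; curr := getRef(predNext). After the loop: CAS(\&pred.ts, $\bot$, getTS()). If predNext $\ne$ curr: if not trim(pred, getRef(predNext)) goto retry; predNext := pred.next; if predNext marked or flagged goto retry; curr := predNext; if curr.next is marked or flagged or curr.key < key goto retry. Then CAS(\&curr.ts, $\bot$, getTS()); return (pred, curr). trim(pred, victim): curr := victim; while curr.next is marked: curr := getRef(curr.next). CAS(\&curr.ts, $\bot$, getTS()). If flag(curr) fails and curr.next is not flagged, return false. succ := getRef(curr.next); if succ $\ne$ NULL then CAS(\&succ.ts, $\bot$, getTS()). newCurr := alloc(curr.key, curr.value, $\bot$); newCurr.next := succ; newCurr.prior := victim. If CAS(\&pred.next, victim, newCurr) succeeds: CAS(\&newCurr.ts, $\bot$, getTS()); return true. Otherwise return false. insert(key, val): repeat: (pred, curr) := find(key); if curr.key = key return curr.value; newNode := alloc(key, val, $\bot$); newNode.next := curr; newNode.prior := curr; if CAS(\&pred.next, curr, newNode) succeeds: CAS(\&newNode.ts, $\bot$, getTS()); return NO\_VAL. remove(key): repeat: (pred, curr) := find(key); if curr.key $\ne$ key return NO\_VAL; if not mark(curr) continue; find(key); return curr.value. contains(key): (pred, curr) := find(key); if curr.key $\ne$ key return NO\_VAL else return curr.value. rangeQuery(low, high, arr): ts := fetchAddTS(); currKey := low. Loop: (pred, curr) := find(currKey); currKey := pred.key; while pred.ts > ts: pred := pred.prior; if pred.key $\le$ low { curr := pred; break }; ts := getTS() $-1$.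 Then while curr.key < low: succ := getRef(curr.next); CAS(\&succ.ts, $\bot$, getTS()); while succ.ts > ts: succ := succ.prior; curr := succ. Then count := 0; while curr.key $\le$ high: arr[count] := (curr.key, curr.value); count := count+1; succ := getRef(curr.next); CAS(\&succ.ts, $\bot$, getTS()); while succ.ts > ts: succ := succ.prior; curr := succ. Return count (arr[0..count-1] holds the result). Linearizability: every execution's completed operations can be ordered consistently with real time (each operation takes effect at a single point between its invocation and response) so that the results match a sequential execution of the map specification. *)

theory Defs
  imports Main
begin

datatype 'k ekey = NInf | K 'k | PInf

fun ek_le :: "'k::linorder ekey \<Rightarrow> 'k ekey \<Rightarrow> bool" where
  "ek_le NInf _ = True"
| "ek_le (K a) NInf = False"
| "ek_le (K a) (K b) = (a \<le> b)"
| "ek_le (K a) PInf = True"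
| "ek_le PInf b = (b = PInf)"

definition ek_lt :: "'k::linorder ekey \<Rightarrow> 'k ekey \<Rightarrow> bool" where
  "ek_lt a b = (\<not> ek_le b a)"

type_synonym addr = nat

datatype ptr = Ptr (pref: "addr option") (pmark: bool) (pflag: bool)

definition NULL :: ptr where "NULL = Ptr None False False"

definition unm :: "addr \<Rightarrow> ptr" where "unm a = Ptr (Some a) False False"

definition mf :: "ptr \<Rightarrow> bool" where "mf p = (pmark p \<or> pflag p)"

text \<open>The uninitialised timestamp \<bottom> = 1.\<close>
definition BOT :: nat where "BOT = 1"

record ('k, 'v) node =
  nts :: nat
  nkey :: "'k ekey"
  nval :: 'v
  nnext :: ptr
  nprior :: "addr option"

datatype ('k, 'v) mop = Insert 'k 'v | Remove 'k | Contains 'k | RangeQuery 'k 'k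

text \<open>Responses: a value or NO_VAL (None), or the result array of a range query.\<close>
datatype ('k, 'v) resp = RV "'v option" | RR "('k \<times> 'v) list"

datatype ('k, 'v) event = Inv nat "('k, 'v) mop" | Res nat "('k, 'v) resp"

fun ev_thr :: "('k, 'v) event \<Rightarrow> nat" where
  "ev_thr (Inv t _) = t"
| "ev_thr (Res t _) = t"

fun seq_spec :: "('k::linorder \<Rightarrow> 'v option) \<Rightarrow> ('k, 'v) mop \<Rightarrow> ('k, 'v) resp \<Rightarrow> ('k \<Rightarrow> 'v option) \<Rightarrow> bool"
  where
  "seq_spec m (Insert k v) r m' =
     (if m k = None then r = RV None \<and> m' = m(k \<mapsto> v) else r = RV (m k) \<and> m' = m)"
| "seq_spec m (Remove k) r m' = (r = RV (m k) \<and> m' = m(k := None))"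
| "seq_spec m (Contains k) r m' = (r = RV (m k) \<and> m' = m)"
| "seq_spec m (RangeQuery lo hi) r m' =
     (m' = m \<and> (\<exists>xs. r = RR xs \<and> distinct xs \<and>
        set xs = {(k, v). lo \<le> k \<and> k \<le> hi \<and> m k = Some v}))"

type_synonym ('k, 'v) hist = "('k, 'v) event list"

definition is_inv :: "('k, 'v) hist \<Rightarrow> nat \<Rightarrow> bool" where
  "is_inv h i = (i < length h \<and> (\<exists>t op. h ! i = Inv t op))"

definition op_of :: "('k, 'v) hist \<Rightarrow> nat \<Rightarrow> ('k, 'v) mop" where
  "op_of h i = (case h ! i of Inv t op \<Rightarrow> op | Res t r \<Rightarrow> undefined)"

definition matches :: "('k, 'v) hist \<Rightarrow> nat \<Rightarrow> nat \<Rightarrow> ('k, 'v) resp \<Rightarrow> bool" where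
  "matches h i j r = (i < j \<and> j < length h \<and>
     (\<exists>t op. h ! i = Inv t op \<and> h ! j = Res t r \<and> (\<forall>k. i < k \<and> k < j \<longrightarrow> ev_thr (h ! k) \<noteq> t)))"

definition completed :: "('k, 'v) hist \<Rightarrow> nat \<Rightarrow> bool" where
  "completed h i = (\<exists>j r. matches h i j r)"

text \<open>Linearizability (Herlihy--Wing): the operations (identified by the positions of their
  invocation events) can be arranged in a sequence L containing every completed operation and
  possibly some pending ones, respecting real-time order, such that the sequential map
  specification, run from the empty map along L, produces the observed responses of the
  completed operations (pending operations in L get some legal response).\<close>
definition linearizable :: "('k::linorder, 'v) hist \<Rightarrow> bool" where
  "linearizable h = (\<exists>(L :: nat list) (ms :: nat \<Rightarrow> 'k \<Rightarrow> 'v option) (rs :: nat \<Rightarrow> ('k, 'v) resp).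
     distinct L \<and>
     (\<forall>i \<in> set L. is_inv h i) \<and>
     (\<forall>i. is_inv h i \<and> completed h i \<longrightarrow> i \<in> set L) \<and>
     (\<forall>p q. p < length L \<and> q < length L \<and> (\<exists>j r. matches h (L ! p) j r \<and> j < L ! q) \<longrightarrow> p < q) \<and>
     ms 0 = Map.empty \<and>
     (\<forall>p < length L. seq_spec (ms p) (op_of h (L ! p)) (rs p) (ms (Suc p)) \<and>
        (\<forall>j r. matches h (L ! p) j r \<longrightarrow> rs p = r)))"

text \<open>Program counters. Each transition performs at most one access to a mutable shared
  location (next, ts fields, globalTS); reads of immutable fields (key, value, prior)
  and initialisation of freshly allocated (unpublished) nodes are folded into steps.\<close>
datatype pcl =
    Idle | Ret
  | F_retry | F_loop1 | F_loop2 | F_loop3 | F_cmp | F_adv | F_ts1 | F_ts2 | F_chk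
  | F_aftertrim | F_recheck | F_cts1 | F_cts2
  | T_loop | T_loop2 | T_ts1 | T_ts2 | T_flag1 | T_flag2 | T_chkflag | T_succ
  | T_sts1 | T_sts2 | T_alloc | T_cas | T_nts1 | T_nts2
  | I_after | I_cas | I_ts1 | I_ts2
  | R_after | R_mark1 | R_mark2 | R_done
  | C_after
  | Q_start | Q_after | Q_w1 | Q_chk | Q_rts | Q_s1 | Q_sts1 | Q_sts2 | Q_s3
  | Q_c1 | Q_cts1 | Q_cts2 | Q_c3

datatype callr = CIns | CRem1 | CRem2 | CCon | CRQ

fun find_ret :: "callr \<Rightarrow> pcl" where
  "find_ret CIns = I_after"
| "find_ret CRem1 = R_after"
| "find_ret CRem2 = R_done"
| "find_ret CCon = C_after"
| "find_ret CRQ = Q_after"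

record ('k, 'v) lst =
  pc :: pcl
  caller :: callr
  kk :: 'k
  vv :: 'v
  lo :: 'k
  hi :: 'k
  fkey :: "'k ekey"
  pred :: addr
  curr :: addr
  predNext :: ptr
  tsv :: nat
  tvictim :: addr
  tcurr :: addr
  tp :: ptr
  tsucc :: "addr option"
  tnew :: addr
  newN :: addr
  rcurr :: addr
  rts :: nat
  currKey :: "'k ekey"
  arr :: "('k \<times> 'v) list"
  succ :: addr
  retv :: "('k, 'v) resp"

record ('k, 'v) gstate =
  mem :: "addr \<Rightarrow> ('k, 'v) node option"
  gts :: nat
  loc :: "nat \<Rightarrow> ('k, 'v) lst"
  hist :: "('k, 'v) hist"

definition setl :: "nat \<Rightarrow> ('k, 'v) lst \<Rightarrow> ('k, 'v) gstate \<Rightarrow> ('k, 'v) gstate" where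
  "setl t l s = s\<lparr>loc := (loc s)(t := l)\<rparr>"

definition setn :: "addr \<Rightarrow> ('k, 'v) node \<Rightarrow> ('k, 'v) gstate \<Rightarrow> ('k, 'v) gstate" where
  "setn a n s = s\<lparr>mem := (mem s)(a \<mapsto> n)\<rparr>"

definition cas_ts :: "addr \<Rightarrow> ('k, 'v) node \<Rightarrow> nat \<Rightarrow> ('k, 'v) gstate \<Rightarrow> ('k, 'v) gstate" where
  "cas_ts a n v s = (if nts n = BOT then setn a (n\<lparr>nts := v\<rparr>) s else s)"

definition head :: addr where "head = 0"
definition tail :: addr where "tail = 1"

definition init_state :: "('k, 'v) gstate" where
  "init_state = \<lparr> mem = Map.empty
      (head \<mapsto> \<lparr>nts = 2, nkey = NInf, nval = undefined, nnext = unm tail, nprior = None\<rparr>,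
       tail \<mapsto> \<lparr>nts = 2, nkey = PInf, nval = undefined, nnext = NULL, nprior = None\<rparr>),
     gts = 2,
     loc = (\<lambda>t. (undefined :: ('k, 'v) lst)\<lparr>pc := Idle\<rparr>),
     hist = [] \<rparr>"

text \<open>One atomic step of thread t.  A thread that would dereference NULL / an
  unallocated address has no step (it crashes).\<close>
inductive tstep :: "nat \<Rightarrow> ('k::linorder, 'v) gstate \<Rightarrow> ('k, 'v) gstate \<Rightarrow> bool" where
  inv_ins: "loc s t = l \<Longrightarrow> pc l = Idle \<Longrightarrow>
     tstep t s (setl t (l\<lparr>pc := F_retry, caller := CIns, kk := k, vv := v, fkey := K k\<rparr>)
                 (s\<lparr>hist := hist s @ [Inv t (Insert k v)]\<rparr>))"
| inv_rem: "loc s t = l \<Longrightarrow> pc l = Idle \<Longrightarrow>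
     tstep t s (setl t (l\<lparr>pc := F_retry, caller := CRem1, kk := k, fkey := K k\<rparr>)
                 (s\<lparr>hist := hist s @ [Inv t (Remove k)]\<rparr>))"
| inv_con: "loc s t = l \<Longrightarrow> pc l = Idle \<Longrightarrow>
     tstep t s (setl t (l\<lparr>pc := F_retry, caller := CCon, kk := k, fkey := K k\<rparr>)
                 (s\<lparr>hist := hist s @ [Inv t (Contains k)]\<rparr>))"
| inv_rq: "loc s t = l \<Longrightarrow> pc l = Idle \<Longrightarrow>
     tstep t s (setl t (l\<lparr>pc := Q_start, lo := a, hi := b, arr := []\<rparr>)
                 (s\<lparr>hist := hist s @ [Inv t (RangeQuery a b)]\<rparr>))"
| ret: "loc s t = l \<Longrightarrow> pc l = Ret \<Longrightarrow>
     tstep t s (setl t (l\<lparr>pc := Idle\<rparr>) (s\<lparr>hist := hist s @ [Res t (retv l)]\<rparr>))"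

| f_retry: "loc s t = l \<Longrightarrow> pc l = F_retry \<Longrightarrow> mem s head = Some n \<Longrightarrow> pref (nnext n) = Some c \<Longrightarrow>
     tstep t s (setl t (l\<lparr>pc := F_loop1, pred := head, predNext := nnext n, curr := c\<rparr>) s)"
| f_loop1: "loc s t = l \<Longrightarrow> pc l = F_loop1 \<Longrightarrow> mem s (curr l) = Some n \<Longrightarrow>
     tstep t s (setl t (l\<lparr>pc := (if mf (nnext n) then F_loop2 else F_cmp)\<rparr>) s)"
| f_loop2: "loc s t = l \<Longrightarrow> pc l = F_loop2 \<Longrightarrow> mem s (curr l) = Some n \<Longrightarrow>
     tstep t s (setl t (l\<lparr>pc := (if pref (nnext n) = None then F_cmp else F_loop3)\<rparr>) s)"
| f_loop3: "loc s t = l \<Longrightarrow> pc l = F_loop3 \<Longrightarrow> mem s (curr l) = Some n \<Longrightarrow> pref (nnext n) = Some c \<Longrightarrow>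
     tstep t s (setl t (l\<lparr>pc := F_loop1, curr := c\<rparr>) s)"
| f_cmp: "loc s t = l \<Longrightarrow> pc l = F_cmp \<Longrightarrow> mem s (curr l) = Some n \<Longrightarrow>
     tstep t s (setl t (if ek_le (fkey l) (nkey n) then l\<lparr>pc := F_ts1\<rparr>
                        else l\<lparr>pc := F_adv, pred := curr l\<rparr>) s)"
| f_adv: "loc s t = l \<Longrightarrow> pc l = F_adv \<Longrightarrow> mem s (pred l) = Some n \<Longrightarrow>
     mf (nnext n) \<or> pref (nnext n) = Some c \<Longrightarrow>
     tstep t s (setl t (if mf (nnext n) then l\<lparr>pc := F_retry, predNext := nnext n\<rparr>
                        else l\<lparr>pc := F_loop1, predNext := nnext n, curr := c\<rparr>) s)"
| f_ts1: "loc s t = l \<Longrightarrow> pc l = F_ts1 \<Longrightarrow>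
     tstep t s (setl t (l\<lparr>pc := F_ts2, tsv := gts s\<rparr>) s)"
| f_ts2: "loc s t = l \<Longrightarrow> pc l = F_ts2 \<Longrightarrow> mem s (pred l) = Some n \<Longrightarrow>
     tstep t s (setl t (l\<lparr>pc := F_chk\<rparr>) (cas_ts (pred l) n (tsv l) s))"
| f_chk_eq: "loc s t = l \<Longrightarrow> pc l = F_chk \<Longrightarrow> predNext l = unm (curr l) \<Longrightarrow>
     tstep t s (setl t (l\<lparr>pc := F_cts1\<rparr>) s)"
| f_chk_ne: "loc s t = l \<Longrightarrow> pc l = F_chk \<Longrightarrow> predNext l \<noteq> unm (curr l) \<Longrightarrow>
     pref (predNext l) = Some v \<Longrightarrow>
     tstep t s (setl t (l\<lparr>pc := T_loop, tvictim := v, tcurr := v\<rparr>) s)"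
| f_aftertrim: "loc s t = l \<Longrightarrow> pc l = F_aftertrim \<Longrightarrow> mem s (pred l) = Some n \<Longrightarrow>
     mf (nnext n) \<or> pref (nnext n) = Some c \<Longrightarrow>
     tstep t s (setl t (if mf (nnext n) then l\<lparr>pc := F_retry, predNext := nnext n\<rparr>
                        else l\<lparr>pc := F_recheck, predNext := nnext n, curr := c\<rparr>) s)"
| f_recheck: "loc s t = l \<Longrightarrow> pc l = F_recheck \<Longrightarrow> mem s (curr l) = Some n \<Longrightarrow>
     tstep t s (setl t (l\<lparr>pc := (if mf (nnext n) \<or> ek_lt (nkey n) (fkey l) then F_retry else F_cts1)\<rparr>) s)"
| f_cts1: "loc s t = l \<Longrightarrow> pc l = F_cts1 \<Longrightarrow>
     tstep t s (setl t (l\<lparr>pc := F_cts2, tsv := gts s\<rparr>) s)"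
| f_cts2: "loc s t = l \<Longrightarrow> pc l = F_cts2 \<Longrightarrow> mem s (curr l) = Some n \<Longrightarrow>
     tstep t s (setl t (l\<lparr>pc := find_ret (caller l)\<rparr>) (cas_ts (curr l) n (tsv l) s))"

  \<comment> \<open>trim(pred, victim); returns to F_aftertrim (true) or F_retry (false)\<close>
| t_loop: "loc s t = l \<Longrightarrow> pc l = T_loop \<Longrightarrow> mem s (tcurr l) = Some n \<Longrightarrow>
     tstep t s (setl t (l\<lparr>pc := (if pmark (nnext n) then T_loop2 else T_ts1)\<rparr>) s)"
| t_loop2: "loc s t = l \<Longrightarrow> pc l = T_loop2 \<Longrightarrow> mem s (tcurr l) = Some n \<Longrightarrow> pref (nnext n) = Some c \<Longrightarrow>
     tstep t s (setl t (l\<lparr>pc := T_loop, tcurr := c\<rparr>) s)"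
| t_ts1: "loc s t = l \<Longrightarrow> pc l = T_ts1 \<Longrightarrow>
     tstep t s (setl t (l\<lparr>pc := T_ts2, tsv := gts s\<rparr>) s)"
| t_ts2: "loc s t = l \<Longrightarrow> pc l = T_ts2 \<Longrightarrow> mem s (tcurr l) = Some n \<Longrightarrow>
     tstep t s (setl t (l\<lparr>pc := T_flag1\<rparr>) (cas_ts (tcurr l) n (tsv l) s))"
| t_flag1: "loc s t = l \<Longrightarrow> pc l = T_flag1 \<Longrightarrow> mem s (tcurr l) = Some n \<Longrightarrow>
     tstep t s (setl t (l\<lparr>pc := (if mf (nnext n) then T_chkflag else T_flag2), tp := nnext n\<rparr>) s)"
| t_flag2: "loc s t = l \<Longrightarrow> pc l = T_flag2 \<Longrightarrow> mem s (tcurr l) = Some n \<Longrightarrow>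
     tstep t s (if nnext n = tp l
                then setl t (l\<lparr>pc := T_succ\<rparr>)
                       (setn (tcurr l) (n\<lparr>nnext := Ptr (pref (tp l)) (pmark (tp l)) True\<rparr>) s)
                else setl t (l\<lparr>pc := T_chkflag\<rparr>) s)"
| t_chkflag: "loc s t = l \<Longrightarrow> pc l = T_chkflag \<Longrightarrow> mem s (tcurr l) = Some n \<Longrightarrow>
     tstep t s (setl t (l\<lparr>pc := (if pflag (nnext n) then T_succ else F_retry)\<rparr>) s)"
| t_succ: "loc s t = l \<Longrightarrow> pc l = T_succ \<Longrightarrow> mem s (tcurr l) = Some n \<Longrightarrow>
     tstep t s (setl t (l\<lparr>pc := (if pref (nnext n) = None then T_alloc else T_sts1),
                          tsucc := pref (nnext n)\<rparr>) s)"
| t_sts1: "loc s t = l \<Longrightarrow> pc l = T_sts1 \<Longrightarrow>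
     tstep t s (setl t (l\<lparr>pc := T_sts2, tsv := gts s\<rparr>) s)"
| t_sts2: "loc s t = l \<Longrightarrow> pc l = T_sts2 \<Longrightarrow> tsucc l = Some a \<Longrightarrow> mem s a = Some n \<Longrightarrow>
     tstep t s (setl t (l\<lparr>pc := T_alloc\<rparr>) (cas_ts a n (tsv l) s))"
| t_alloc: "loc s t = l \<Longrightarrow> pc l = T_alloc \<Longrightarrow> mem s (tcurr l) = Some n \<Longrightarrow> mem s a = None \<Longrightarrow>
     tstep t s (setl t (l\<lparr>pc := T_cas, tnew := a\<rparr>)
       (setn a \<lparr>nts = BOT, nkey = nkey n, nval = nval n, nnext = Ptr (tsucc l) False False,
                nprior = Some (tvictim l)\<rparr> s))"
| t_cas: "loc s t = l \<Longrightarrow> pc l = T_cas \<Longrightarrow> mem s (pred l) = Some n \<Longrightarrow>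
     tstep t s (if nnext n = unm (tvictim l)
                then setl t (l\<lparr>pc := T_nts1\<rparr>) (setn (pred l) (n\<lparr>nnext := unm (tnew l)\<rparr>) s)
                else setl t (l\<lparr>pc := F_retry\<rparr>) s)"
| t_nts1: "loc s t = l \<Longrightarrow> pc l = T_nts1 \<Longrightarrow>
     tstep t s (setl t (l\<lparr>pc := T_nts2, tsv := gts s\<rparr>) s)"
| t_nts2: "loc s t = l \<Longrightarrow> pc l = T_nts2 \<Longrightarrow> mem s (tnew l) = Some n \<Longrightarrow>
     tstep t s (setl t (l\<lparr>pc := F_aftertrim\<rparr>) (cas_ts (tnew l) n (tsv l) s))"

| i_found: "loc s t = l \<Longrightarrow> pc l = I_after \<Longrightarrow> mem s (curr l) = Some n \<Longrightarrow> nkey n = K (kk l) \<Longrightarrow>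
     tstep t s (setl t (l\<lparr>pc := Ret, retv := RV (Some (nval n))\<rparr>) s)"
| i_alloc: "loc s t = l \<Longrightarrow> pc l = I_after \<Longrightarrow> mem s (curr l) = Some n \<Longrightarrow> nkey n \<noteq> K (kk l) \<Longrightarrow>
     mem s a = None \<Longrightarrow>
     tstep t s (setl t (l\<lparr>pc := I_cas, newN := a\<rparr>)
       (setn a \<lparr>nts = BOT, nkey = K (kk l), nval = vv l, nnext = unm (curr l),
                nprior = Some (curr l)\<rparr> s))"
| i_cas: "loc s t = l \<Longrightarrow> pc l = I_cas \<Longrightarrow> mem s (pred l) = Some n \<Longrightarrow>
     tstep t s (if nnext n = unm (curr l)
                then setl t (l\<lparr>pc := I_ts1\<rparr>) (setn (pred l) (n\<lparr>nnext := unm (newN l)\<rparr>) s)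
                else setl t (l\<lparr>pc := F_retry\<rparr>) s)"
| i_ts1: "loc s t = l \<Longrightarrow> pc l = I_ts1 \<Longrightarrow>
     tstep t s (setl t (l\<lparr>pc := I_ts2, tsv := gts s\<rparr>) s)"
| i_ts2: "loc s t = l \<Longrightarrow> pc l = I_ts2 \<Longrightarrow> mem s (newN l) = Some n \<Longrightarrow>
     tstep t s (setl t (l\<lparr>pc := Ret, retv := RV None\<rparr>) (cas_ts (newN l) n (tsv l) s))"

| r_after: "loc s t = l \<Longrightarrow> pc l = R_after \<Longrightarrow> mem s (curr l) = Some n \<Longrightarrow>
     tstep t s (setl t (if nkey n \<noteq> K (kk l) then l\<lparr>pc := Ret, retv := RV None\<rparr>
                        else l\<lparr>pc := R_mark1, rcurr := curr l\<rparr>) s)"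
| r_mark1: "loc s t = l \<Longrightarrow> pc l = R_mark1 \<Longrightarrow> mem s (rcurr l) = Some n \<Longrightarrow>
     tstep t s (setl t (l\<lparr>pc := (if mf (nnext n) then F_retry else R_mark2), tp := nnext n\<rparr>) s)"
| r_mark2: "loc s t = l \<Longrightarrow> pc l = R_mark2 \<Longrightarrow> mem s (rcurr l) = Some n \<Longrightarrow>
     tstep t s (if nnext n = tp l
                then setl t (l\<lparr>pc := F_retry, caller := CRem2\<rparr>)
                       (setn (rcurr l) (n\<lparr>nnext := Ptr (pref (tp l)) True (pflag (tp l))\<rparr>) s)
                else setl t (l\<lparr>pc := F_retry\<rparr>) s)"
| r_done: "loc s t = l \<Longrightarrow> pc l = R_done \<Longrightarrow> mem s (rcurr l) = Some n \<Longrightarrow>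
     tstep t s (setl t (l\<lparr>pc := Ret, retv := RV (Some (nval n))\<rparr>) s)"

| c_after: "loc s t = l \<Longrightarrow> pc l = C_after \<Longrightarrow> mem s (curr l) = Some n \<Longrightarrow>
     tstep t s (setl t (l\<lparr>pc := Ret,
        retv := (if nkey n \<noteq> K (kk l) then RV None else RV (Some (nval n)))\<rparr>) s)"

| q_start: "loc s t = l \<Longrightarrow> pc l = Q_start \<Longrightarrow>
     tstep t s (setl t (l\<lparr>pc := F_retry, caller := CRQ, rts := gts s, currKey := K (lo l),
                          fkey := K (lo l)\<rparr>) (s\<lparr>gts := gts s + 1\<rparr>))"
| q_after: "loc s t = l \<Longrightarrow> pc l = Q_after \<Longrightarrow> mem s (pred l) = Some n \<Longrightarrow>
     tstep t s (setl t (l\<lparr>pc := Q_w1, currKey := nkey n\<rparr>) s)"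
| q_w1: "loc s t = l \<Longrightarrow> pc l = Q_w1 \<Longrightarrow> mem s (pred l) = Some n \<Longrightarrow>
     nts n \<le> rts l \<or> nprior n = Some p \<Longrightarrow>
     tstep t s (setl t (if rts l < nts n then l\<lparr>pc := Q_w1, pred := p\<rparr>
                        else l\<lparr>pc := Q_chk\<rparr>) s)"
| q_chk: "loc s t = l \<Longrightarrow> pc l = Q_chk \<Longrightarrow> mem s (pred l) = Some n \<Longrightarrow>
     tstep t s (setl t (if ek_le (nkey n) (K (lo l)) then l\<lparr>pc := Q_s1, curr := pred l\<rparr>
                        else l\<lparr>pc := Q_rts\<rparr>) s)"
| q_rts: "loc s t = l \<Longrightarrow> pc l = Q_rts \<Longrightarrow>
     tstep t s (setl t (l\<lparr>pc := F_retry, caller := CRQ, rts := gts s - 1,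
                          fkey := currKey l\<rparr>) s)"
| q_s1: "loc s t = l \<Longrightarrow> pc l = Q_s1 \<Longrightarrow> mem s (curr l) = Some n \<Longrightarrow>
     \<not> ek_lt (nkey n) (K (lo l)) \<or> pref (nnext n) = Some c \<Longrightarrow>
     tstep t s (setl t (if ek_lt (nkey n) (K (lo l)) then l\<lparr>pc := Q_sts1, succ := c\<rparr>
                        else l\<lparr>pc := Q_c1\<rparr>) s)"
| q_sts1: "loc s t = l \<Longrightarrow> pc l = Q_sts1 \<Longrightarrow>
     tstep t s (setl t (l\<lparr>pc := Q_sts2, tsv := gts s\<rparr>) s)"
| q_sts2: "loc s t = l \<Longrightarrow> pc l = Q_sts2 \<Longrightarrow> mem s (succ l) = Some n \<Longrightarrow>
     tstep t s (setl t (l\<lparr>pc := Q_s3\<rparr>) (cas_ts (succ l) n (tsv l) s))"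
| q_s3: "loc s t = l \<Longrightarrow> pc l = Q_s3 \<Longrightarrow> mem s (succ l) = Some n \<Longrightarrow>
     nts n \<le> rts l \<or> nprior n = Some p \<Longrightarrow>
     tstep t s (setl t (if rts l < nts n then l\<lparr>pc := Q_s3, succ := p\<rparr>
                        else l\<lparr>pc := Q_s1, curr := succ l\<rparr>) s)"
| q_c1_out: "loc s t = l \<Longrightarrow> pc l = Q_c1 \<Longrightarrow> mem s (curr l) = Some n \<Longrightarrow>
     \<not> ek_le (nkey n) (K (hi l)) \<Longrightarrow>
     tstep t s (setl t (l\<lparr>pc := Ret, retv := RR (arr l)\<rparr>) s)"
| q_c1_in: "loc s t = l \<Longrightarrow> pc l = Q_c1 \<Longrightarrow> mem s (curr l) = Some n \<Longrightarrow>
     nkey n = K k \<Longrightarrow> k \<le> hi l \<Longrightarrow> pref (nnext n) = Some c \<Longrightarrow>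
     tstep t s (setl t (l\<lparr>pc := Q_cts1, arr := arr l @ [(k, nval n)], succ := c\<rparr>) s)"
| q_cts1: "loc s t = l \<Longrightarrow> pc l = Q_cts1 \<Longrightarrow>
     tstep t s (setl t (l\<lparr>pc := Q_cts2, tsv := gts s\<rparr>) s)"
| q_cts2: "loc s t = l \<Longrightarrow> pc l = Q_cts2 \<Longrightarrow> mem s (succ l) = Some n \<Longrightarrow>
     tstep t s (setl t (l\<lparr>pc := Q_c3\<rparr>) (cas_ts (succ l) n (tsv l) s))"
| q_c3: "loc s t = l \<Longrightarrow> pc l = Q_c3 \<Longrightarrow> mem s (succ l) = Some n \<Longrightarrow>
     nts n \<le> rts l \<or> nprior n = Some p \<Longrightarrow>
     tstep t s (setl t (if rts l < nts n then l\<lparr>pc := Q_c3, succ := p\<rparr>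
                        else l\<lparr>pc := Q_c1, curr := succ l\<rparr>) s)"

inductive reachable :: "('k::linorder, 'v) gstate \<Rightarrow> bool" where
  init: "reachable init_state"
| step: "reachable s \<Longrightarrow> tstep t s s' \<Longrightarrow> reachable s'"

end

theory Submission
  imports Defs
begin

text \<open>Points of the linearization order are pairs (clock value, time), ordered lexicographically. A linked
  node takes effect at its stamp, the pair (timestamp, time at which the timestamp was set). The
  timestamp is read from the clock after the node was linked, so the stamp lies between the moments
  of linking and of setting, although it may precede points that were used earlier. Inserts and
  removes are linearized at the stamp of the node that realizes them (the new node, respectively
  the copy that trims the marked node), and a range query with timestamp T just after all stamps
  with timestamp at most T.

  The key-point plane is tiled: the tile of a list edge from a to b consists of the keys in the
  half-open interval from the key of a to the key of b, at the points at which a and b have taken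
  effect and the edge is not yet replaced. Setting the timestamp of y at stamp q replaces, at all
  points from q on, the tiles of the edges that y bypassed by the two edges of y. An edge is
  bypassed only after both of its ends have timestamps, and only by a node that is linked later than
  any read of the edge; hence a stamp that arrives late and lies in the past never changes what an
  operation has already observed. A lookup observes one tile, a range
  query a sequence of adjacent tiles at one point, found by following the prior pointers.\<close>

section \<open>Ghost state and structural invariant\<close>

text \<open>The obstacle is the delay between reading the clock and setting a timestamp. In between,
  other operations may obtain points and even return, so a commit can place an update before
  operations that are already answered, and the commit may be done by a thread other than the one
  whose operation it settles. Hence no abstract map is carried along the execution: the map is a
  function of the point, and an order of the operations is formed only at the end, by sorting. Two
  notions of value are kept apart. \<open>Aval\<close> reads the present tiling and may still change
  in the past; \<open>know\<close> asserts what no later commit can falsify. The gap is closed by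
  \<open>sb\<close>: an uncommitted node will be stamped strictly after its link point, so it cannot
  touch any point up to its link, and a reader needs to fear only nodes that are linked already. For
  a range query with timestamp T the point is \<open>Pt (Suc T) 0\<close>. Time starts at 1, so this
  point lies above everything with clock value T and below every stamp with clock value T + 1. For
  the same reason the sentinels can be given the stamp \<open>Pt 0 0\<close>, which makes the tiling
  total at every point.\<close>

instantiation ekey :: (linorder) linorder
begin

definition "less_eq_ekey a b = ek_le a b"
definition "less_ekey a b = ek_lt a b"

instance
proof
  fix x y z :: "'a ekey"
  show "x < y \<longleftrightarrow> x \<le> y \<and> \<not> y \<le> x"
    by (cases x; cases y) (auto simp: less_eq_ekey_def less_ekey_def ek_lt_def)
  show "x \<le> x"
    by (cases x) (auto simp: less_eq_ekey_def)
  show "x \<le> y \<Longrightarrow> y \<le> z \<Longrightarrow> x \<le> z"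
    by (cases x; cases y; cases z) (auto simp: less_eq_ekey_def)
  show "x \<le> y \<Longrightarrow> y \<le> x \<Longrightarrow> x = y"
    by (cases x; cases y) (auto simp: less_eq_ekey_def)
  show "x \<le> y \<or> y \<le> x"
    by (cases x; cases y) (auto simp: less_eq_ekey_def)
qed

end

lemma ekey_order [simp]:
  "NInf \<le> x" "x \<le> PInf" "\<not> x < NInf" "\<not> PInf < x" "NInf < K a" "K a < PInf"
  "K a \<le> K b \<longleftrightarrow> a \<le> b" "K a < K b \<longleftrightarrow> a < b" "NInf < PInf"
  by (cases x; auto simp: less_eq_ekey_def less_ekey_def ek_lt_def)+

lemma ek_le_iff [simp]: "ek_le a b \<longleftrightarrow> a \<le> b"
  by (simp add: less_eq_ekey_def)

lemma ek_lt_iff [simp]: "ek_lt a b \<longleftrightarrow> a < b"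
  by (simp add: less_ekey_def)

datatype pt = Pt (pfst: nat) (psnd: nat)

instantiation pt :: linorder
begin

definition "less_eq_pt a b \<longleftrightarrow> pfst a < pfst b \<or> pfst a = pfst b \<and> psnd a \<le> psnd b"
definition "less_pt a b \<longleftrightarrow> pfst a < pfst b \<or> pfst a = pfst b \<and> psnd a < psnd b"

instance
  by standard (auto simp: less_eq_pt_def less_pt_def pt.expand)

end

lemma pt_simps [simp]:
  "Pt a b \<le> Pt c d \<longleftrightarrow> a < c \<or> a = c \<and> b \<le> d" "Pt a b < Pt c d \<longleftrightarrow> a < c \<or> a = c \<and> b < d"
  by (auto simp: less_eq_pt_def less_pt_def)

text \<open>The memory, clock and history (gm, gG, gh) are copied from the program state; the other
  fields are ghosts. tm counts steps; gT gives the edge whose tile contains a key and a point;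
  lk is the point at which a node was linked (None while it is private to its creator own) and par
  its predecessor then; stp is meaningful only for nodes whose timestamp is set. A node y
  created by trim removes the nodes chn y, recorded by rmv; an inserted node has
  chn y = []. org and mrk are the operations that inserted and marked a node, opi the
  current operation of a thread, ht the time of a history event, and lin the linearization
  point and response of an operation. Operations are named by the position of their invocation.\<close>

record ('k, 'v) gx =
  gm :: "addr \<Rightarrow> ('k, 'v) node option"
  gG :: nat
  gh :: "('k, 'v) hist"
  tm :: nat
  gT :: "'k ekey \<Rightarrow> pt \<Rightarrow> addr \<times> addr"
  stp :: "addr \<Rightarrow> pt"
  lk :: "addr \<Rightarrow> pt option"
  par :: "addr \<Rightarrow> addr"
  chn :: "addr \<Rightarrow> addr list"
  rmv :: "addr \<Rightarrow> addr option"
  org :: "addr \<Rightarrow> nat option"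
  mrk :: "addr \<Rightarrow> nat option"
  opi :: "nat \<Rightarrow> nat"
  ht :: "nat \<Rightarrow> pt"
  lin :: "nat \<Rightarrow> (pt \<times> ('k, 'v) resp) option"
  own :: "addr \<Rightarrow> nat"

definition "ky X a = nkey (the (gm X a))"
definition "vl X a = nval (the (gm X a))"
definition "nx X a = nnext (the (gm X a))"
definition "pr X a = nprior (the (gm X a))"
definition "ts X a = nts (the (gm X a))"
definition "rf X a = pref (nx X a)"
definition "lkd X a \<longleftrightarrow> lk X a \<noteq> None"
definition "lkp X a = the (lk X a)"
text \<open>A node is committed (cm) when its timestamp is set, and alive at p unless a committed copy with
  stamp at most p trims it.\<close>

definition "cm X a \<longleftrightarrow> lkd X a \<and> ts X a \<noteq> BOT"
definition "now X = Pt (gG X) (tm X)"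
definition "alive X p a \<longleftrightarrow> (\<forall>y. rmv X a = Some y \<longrightarrow> cm X y \<longrightarrow> p < stp X y)"
text \<open>sb is a lower bound for the stamp that a node has or will get. By NR the node a is not trimmed up
  to p, whatever stamps are still to come, by HF its outgoing edge is not bypassed either; a Firm
  edge is therefore an edge of the final tiling.\<close>

definition "sb X y = (if cm X y then stp X y else lkp X y)"
definition "NR X p a \<longleftrightarrow> (\<forall>y. rmv X a = Some y \<longrightarrow> p < sb X y)"
definition "HF X p a \<longleftrightarrow> NR X p a \<and> (\<forall>y. lkd X y \<longrightarrow> \<not> cm X y \<longrightarrow> par X y = a \<longrightarrow> p < lkp X y)"
definition "tile X p a b \<longleftrightarrow> lkd X a \<and> lkd X b \<and> ky X a < ky X b \<and> (\<forall>k. ky X a < k \<longrightarrow> k \<le> ky X b \<longrightarrow> gT X k p = (a, b))"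
definition "Firm X p a b \<longleftrightarrow> p < now X \<and> tile X p a b \<and> HF X p a"
text \<open>The old path bypassed by a newly linked \<open>y\<close>, without its start
  \<open>par X y\<close>. For an insertion it is only the successor; for a copy of a node without
  successor (the tail can be trimmed as well) it is only the removed nodes.\<close>

definition "tlp X y = chn X y @ (case rf X y of None \<Rightarrow> [] | Some x \<Rightarrow> [x])"
definition "lnk X a b \<longleftrightarrow> rf X a = Some b"

text \<open>The walk of a range query with point p along the prior pointers.\<close>

inductive wk :: "('k, 'v) gx \<Rightarrow> pt \<Rightarrow> addr \<Rightarrow> addr \<Rightarrow> bool" for X p where
  base: "cm X a \<Longrightarrow> stp X a \<le> p \<Longrightarrow> wk X p a a"
| step: "\<not> (cm X a \<and> stp X a \<le> p) \<Longrightarrow> pr X a = Some b \<Longrightarrow> wk X p b x \<Longrightarrow> wk X p a x"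

text \<open>Z is what remains of reading the edge from a to b at time r: as long as an end is uncommitted, the
  edge stays in the list. RE is the same for a range query at point p that read the successor c of a.\<close>

definition "Z X a b r \<longleftrightarrow>
  (if cm X a \<and> cm X b then \<exists>p. r \<le> p \<and> Firm X p a b
   else rf X a = Some b \<and> NR X r a)"
definition "RE X a c p \<longleftrightarrow>
  (if cm X c then \<exists>x. wk X p c x \<and> Firm X p a x else rf X a = Some c)"
definition "aliveF X p x \<longleftrightarrow> cm X x \<and> stp X x \<le> p \<and> NR X p x"
text \<open>Built from \<open>NR\<close> and \<open>Firm\<close> so that stamps which arrive later
  but lie before \<open>p\<close> cannot invalidate it; presence and absence need different
  witnesses, a node and an edge.\<close>

definition "know X k p r \<longleftrightarrow> p < now X \<and>
  ((\<exists>x. aliveF X p x \<and> ky X x = K k \<and> r = Some (vl X x)) \<or>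
   (\<exists>a b. Firm X p a b \<and> ky X a < K k \<and> K k < ky X b \<and> r = None))"
definition "Aval X k p = (let x = snd (gT X (K k) p) in if ky X x = K k then Some (vl X x) else None)"

text \<open>\<open>walkP\<close> ties the pointers to the tiling: although the successor of a node
  may be too young for \<open>p\<close>, its prior walk ends at the upper end of the tile.
  \<open>unc_par\<close> can be maintained because a link replaces only edges whose ends are both
  committed, so the parent of an uncommitted node keeps pointing to it and is not trimmed. The
  exceptional case of \<open>stp_ts\<close> covers the sentinels.\<close>

locale ginv =
  fixes X :: "('k::linorder, 'v) gx"
  assumes tm_pos: "1 \<le> tm X" and G_ge: "2 \<le> gG X"
    and alloc: "lkd X a \<Longrightarrow> gm X a \<noteq> None"
    and head: "cm X head" "ky X head = NInf" "rmv X head = None" "\<not> mf (nx X head)"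
    and lk_now: "lkd X a \<Longrightarrow> lkp X a < now X \<and> psnd (lkp X a) < tm X"
    and stp_now: "cm X a \<Longrightarrow> stp X a < now X"
    and stp_ts: "cm X a \<Longrightarrow> (stp X a = Pt 0 0 \<and> ts X a = 2 \<or> pfst (stp X a) = ts X a \<and> 1 \<le> psnd (stp X a)) \<and> lkp X a \<le> stp X a"
    and nextL: "lkd X a \<Longrightarrow> rf X a = Some c \<Longrightarrow> lkd X c \<and> ky X a < ky X c"
    and nextN: "lkd X a \<Longrightarrow> rf X a = None \<Longrightarrow> ky X a = PInf"
    and frozen_cm: "lkd X a \<Longrightarrow> mf (nx X a) \<Longrightarrow> cm X a \<and> \<not> (pmark (nx X a) \<and> pflag (nx X a))"
    and rmvD: "rmv X a = Some y \<Longrightarrow> lkd X y \<and> cm X a \<and> mf (nx X a) \<and> stp X a < lkp X y \<and>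
       (\<forall>c. rf X a = Some c \<longrightarrow> cm X c \<and> stp X c < lkp X y)"
    and active: "lkd X n \<Longrightarrow> rmv X n = None \<Longrightarrow> rf X n = Some x \<Longrightarrow> rmv X x = None"
    and unc_par: "lkd X y \<Longrightarrow> \<not> cm X y \<Longrightarrow> cm X (par X y) \<and> rmv X (par X y) = None \<and>
       rf X (par X y) = Some y \<and> stp X (par X y) < lkp X y \<and> rmv X y = None"
    and unc_path: "lkd X y \<Longrightarrow> \<not> cm X y \<Longrightarrow> tlp X y \<noteq> [] \<and> pr X y = Some (hd (tlp X y)) \<and>
       successively (lnk X) (tlp X y) \<and> (\<forall>a\<in>set (tlp X y). cm X a \<and> stp X a < lkp X y)"
    and unc_rmv: "lkd X y \<Longrightarrow> \<not> cm X y \<Longrightarrow> rmv X a = Some y \<longleftrightarrow> a \<in> set (chn X y)"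
    and unc_chn: "lkd X y \<Longrightarrow> \<not> cm X y \<Longrightarrow> chn X y \<noteq> [] \<Longrightarrow> ky X y = ky X (last (chn X y)) \<and>
       vl X y = vl X (last (chn X y)) \<and> pflag (nx X (last (chn X y))) \<and>
       (\<forall>a\<in>set (butlast (chn X y)). pmark (nx X a))"
    and walkP: "cm X n \<Longrightarrow> stp X n \<le> p \<Longrightarrow> alive X p n \<Longrightarrow> rf X n = Some c \<Longrightarrow>
       \<exists>x. wk X p c x \<and> tile X p n x"
    and tileR: "NInf < k \<Longrightarrow> gT X k p = (n, x) \<Longrightarrow> cm X n \<and> cm X x \<and> stp X n \<le> p \<and> stp X x \<le> p \<and>
       ky X n < k \<and> k \<le> ky X x \<and> alive X p n \<and> alive X p x \<and> tile X p n x"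
    and tileN: "cm X x \<Longrightarrow> x \<noteq> head \<Longrightarrow> stp X x \<le> p \<Longrightarrow> alive X p x \<Longrightarrow> \<exists>n. gT X (ky X x) p = (n, x)"
    and prior: "lkd X y \<Longrightarrow> pr X y = Some x \<Longrightarrow> cm X x \<and>
       (\<forall>y'. rmv X x = Some y' \<longrightarrow> y' \<noteq> y \<longrightarrow> cm X y \<and> stp X y < lkp X y')"
begin

lemma cm_lkd: "cm X a \<Longrightarrow> lkd X a" by (simp add: cm_def)

lemma NInf_less: "a < k \<Longrightarrow> NInf < (k :: 'k ekey)"
  by (metis ekey_order(1) order_le_less_trans)

lemma tileD: "tile X p a b \<Longrightarrow> ky X a < ky X b \<and> gT X (ky X b) p = (a, b) \<and> cm X a \<and> cm X b \<and>
   stp X a \<le> p \<and> stp X b \<le> p \<and> alive X p a \<and> alive X p b"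
  using tileR[of "ky X b" p a b] NInf_less unfolding tile_def by blast

lemma tile_inj: "tile X p a b \<Longrightarrow> tile X p a' b \<Longrightarrow> a = a'"
  using tileD[of p a b] tileD[of p a' b] by auto

text \<open>Both tiles contain the smaller of the two upper keys, and \<open>gT\<close> names a
  single edge there.\<close>

lemma tile_inj2: "tile X p a b \<Longrightarrow> tile X p a b' \<Longrightarrow> b = b'"
proof -
  assume t: "tile X p a b" "tile X p a b'"
  show "b = b'"
  proof (cases "ky X b \<le> ky X b'")
    case True
    then have "gT X (ky X b) p = (a, b')" using t tileD unfolding tile_def by blast
    then show ?thesis using tileD[OF t(1)] by simp
  next
    case False
    then have "gT X (ky X b') p = (a, b)" using t tileD unfolding tile_def by fastforce
    then show ?thesis using tileD[OF t(2)] by simp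
  qed
qed

lemma wk_cm: "cm X a \<Longrightarrow> stp X a \<le> p \<Longrightarrow> wk X p a x \<longleftrightarrow> x = a"
  by (auto elim: wk.cases intro: wk.base)

lemma wk_step: "\<not> (cm X a \<and> stp X a \<le> p) \<Longrightarrow> pr X a = Some b \<Longrightarrow> wk X p a x \<longleftrightarrow> wk X p b x"
  by (auto elim: wk.cases intro: wk.step)

text \<open>The edges that an uncommitted node y bypasses still own their tiles, at all points from the
  linking of y on.\<close>

lemma path_tiles:
  assumes y: "lkd X y" "\<not> cm X y" and p: "lkp X y \<le> p"
  shows "successively (tile X p) (par X y # tlp X y)"
proof -
  note u = unc_par[OF y] unc_path[OF y]
  \<comment> \<open>The parent has no remover, and the nodes in \<open>chn X y\<close> have only
    \<open>y\<close>, which is uncommitted.\<close>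
  have al: "alive X p a" if "a = par X y \<or> a \<in> set (chn X y)" for a
    using that u unc_rmv[OF y, of a] y by (auto simp: alive_def)
  \<comment> \<open>The walk from the uncommitted \<open>y\<close> takes its prior pointer to the
    head of \<open>tlp X y\<close>; that node was stamped before \<open>y\<close> was linked, so the
    walk stops there.\<close>
  have first: "tile X p (par X y) (hd (tlp X y))"
  proof -
    have "\<exists>x. wk X p y x \<and> tile X p (par X y) x"
      using walkP[of "par X y" p y] u al p by auto
    moreover have "wk X p y x \<longleftrightarrow> x = hd (tlp X y)" for x
      using wk_step[of y p "hd (tlp X y)" x] wk_cm[of "hd (tlp X y)" p x] u y p hd_in_set[of "tlp X y"]
      by fastforce
    ultimately show ?thesis by auto
  qed
  have nxt: "tile X p a b" if a: "a \<in> set (chn X y)" and ab: "rf X a = Some b" and b: "b \<in> set (tlp X y)" for a b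
  proof -
    have "a \<in> set (tlp X y)" using a by (simp add: tlp_def)
    then have "\<exists>x. wk X p b x \<and> tile X p a x"
      using walkP[of a p b] u al a ab p by fastforce
    then show ?thesis using wk_cm[of b p] u b p by fastforce
  qed
  have "successively (tile X p) xs" if "successively (lnk X) xs" "set xs \<subseteq> set (tlp X y)"
     "set (butlast xs) \<subseteq> set (chn X y)" for xs
    using that nxt
  proof (induction xs)
    case Nil then show ?case by simp
  next
    case (Cons a xs) then show ?case by (cases xs) (auto simp: lnk_def)
  qed
  moreover have "set (butlast (tlp X y)) \<subseteq> set (chn X y)"
    by (auto simp: tlp_def butlast_append dest: in_set_butlastD split: option.splits if_splits)
  ultimately have "successively (tile X p) (tlp X y)" using u by blast
  then show ?thesis using first u by (cases "tlp X y") auto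
qed

text \<open>At \<open>now X\<close> all committed nodes have taken effect, so the walk given by
  \<open>walkP\<close> stops at once.\<close>

lemma live_tile: "cm X a \<Longrightarrow> rmv X a = None \<Longrightarrow> rf X a = Some b \<Longrightarrow> cm X b \<Longrightarrow> tile X (now X) a b"
  using walkP[of a "now X" b] stp_now[of a] stp_now[of b] wk_cm[of b "now X"] by (auto simp: alive_def)

lemma path_cover:
  assumes "successively (tile X p) (a # xs)" "ky X a < k" "k \<le> ky X (last (a # xs))"
  shows "\<exists>c\<in>set (butlast (a # xs)). \<exists>b\<in>set xs. tile X p c b \<and> ky X c < k \<and> k \<le> ky X b"
  using assms
proof (induction xs arbitrary: a)
  case Nil then show ?case by auto
next
  case (Cons b xs)
  show ?case
  proof (cases "k \<le> ky X b")
    case True then show ?thesis using Cons.prems by auto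
  next
    case False
    then have "\<exists>c\<in>set (butlast (b # xs)). \<exists>d\<in>set xs. tile X p c d \<and> ky X c < k \<and> k \<le> ky X d"
      using Cons.prems by (intro Cons.IH) auto
    then show ?thesis by auto
  qed
qed

lemma path_mono:
  assumes "successively (tile X p) (a # xs)"
  shows "ky X a \<le> ky X (last (a # xs))"
  using assms
proof (induction xs arbitrary: a)
  case (Cons b xs) then show ?case by (fastforce dest: tileD)
qed auto

lemma path_out:
  assumes "successively (tile X p) (a # xs)" "c \<in> set (butlast (a # xs))"
  shows "\<exists>b\<in>set xs. tile X p c b \<and> ky X a \<le> ky X c \<and> ky X b \<le> ky X (last (a # xs))"
  using assms
proof (induction xs arbitrary: a)
  case (Cons b xs)
  then have ab: "ky X a < ky X b" by (auto dest: tileD)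
  show ?case
  proof (cases "c = a")
    case True
    then show ?thesis using Cons.prems path_mono[of p b xs] by (auto intro!: bexI[of _ b])
  next
    case False
    then have "\<exists>d\<in>set xs. tile X p c d \<and> ky X b \<le> ky X c \<and> ky X d \<le> ky X (last (b # xs))"
      using Cons.prems by (intro Cons.IH) auto
    then show ?thesis using ab by fastforce
  qed
qed auto

lemma path_in:
  assumes "successively (tile X p) (a # xs)" "b \<in> set xs"
  shows "\<exists>c\<in>set (butlast (a # xs)). tile X p c b \<and> ky X a \<le> ky X c \<and> ky X b \<le> ky X (last (a # xs))"
  using assms
proof (induction xs arbitrary: a)
  case (Cons d xs)
  then have ab: "ky X a < ky X d" by (auto dest: tileD)
  show ?case
  proof (cases "b = d")
    case True
    then show ?thesis using Cons.prems path_mono[of p d xs] by auto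
  next
    case False
    then have "\<exists>c\<in>set (butlast (d # xs)). tile X p c b \<and> ky X d \<le> ky X c \<and> ky X b \<le> ky X (last (d # xs))"
      using Cons.prems by (intro Cons.IH) auto
    then show ?thesis using ab by fastforce
  qed
qed auto

lemma butlast_path: "lkd X y \<Longrightarrow> \<not> cm X y \<Longrightarrow> set (butlast (par X y # tlp X y)) \<subseteq> insert (par X y) (set (chn X y))"
  using unc_path[of y]
  by (auto simp: tlp_def butlast_append dest: in_set_butlastD split: option.splits if_splits)

text \<open>An uncommitted remover of \<open>b\<close> that was linked no later than
  \<open>p\<close> also bypasses the edge into \<open>b\<close>. By \<open>tile_inj\<close> this is
  the edge from \<open>a\<close>, so \<open>a\<close> is its parent or one of its removed nodes, and
  \<open>HF\<close> excludes both.\<close>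

lemma firm_alive:
  assumes f: "Firm X p a b" shows "aliveF X p b"
proof -
  note t = tileD[of p a b]
  have tl: "tile X p a b" using f by (simp add: Firm_def)
  have "p < sb X y" if r: "rmv X b = Some y" for y
  proof (cases "cm X y")
    case True then show ?thesis using t tl r by (auto simp: sb_def alive_def)
  next
    case False
    note y = conjunct1[OF rmvD[OF r]] False
    show ?thesis
    proof (rule ccontr)
      assume "\<not> p < sb X y"
      then have p: "lkp X y \<le> p" using False by (simp add: sb_def)
      have "b \<in> set (tlp X y)" using unc_rmv[OF y] r by (simp add: tlp_def)
      then obtain c where c: "c \<in> set (butlast (par X y # tlp X y))" "tile X p c b"
        using path_in[OF path_tiles[OF y p]] by blast
      then have "a = c" using tl tile_inj by blast
      then have "a = par X y \<or> rmv X a = Some y" using butlast_path[OF y] c unc_rmv[OF y] by blast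
      then show False using f p y by (auto simp: Firm_def HF_def NR_def sb_def)
    qed
  qed
  then show ?thesis using t tl by (auto simp: aliveF_def NR_def)
qed

lemma NR_alive: "NR X p a \<Longrightarrow> alive X p a"
  by (auto simp: NR_def alive_def sb_def)

text \<open>Since \<open>know\<close> is stable, this applies to the final tiling too, which is
  where responses are compared with the map.\<close>

lemma know_Aval: "know X k p r \<Longrightarrow> Aval X k p = r"
proof -
  assume "know X k p r"
  then consider x where "aliveF X p x" "ky X x = K k" "r = Some (vl X x)"
    | a b where "Firm X p a b" "ky X a < K k" "K k < ky X b" "r = None"
    by (auto simp: know_def)
  then show ?thesis
  proof cases
    case 1
    then have "x \<noteq> head" using head by auto
    then obtain n where "gT X (ky X x) p = (n, x)"
      using 1 tileN[of x p] NR_alive by (auto simp: aliveF_def)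
    then show ?thesis using 1 by (simp add: Aval_def)
  next
    case 2
    then have "gT X (K k) p = (a, b)" by (auto simp: Firm_def tile_def)
    then show ?thesis using 2 by (auto simp: Aval_def)
  qed
qed

text \<open>A Firm edge decides every key of its interval: the upper end is safe from trimming by
  \<open>firm_alive\<close>, and strictly between the ends there is no node.\<close>

lemma firm_know:
  assumes "Firm X p a b" "ky X a < K k" "K k \<le> ky X b"
  shows "know X k p (if ky X b = K k then Some (vl X b) else None)"
proof (cases "ky X b = K k")
  case True
  then show ?thesis using assms firm_alive[OF assms(1)] by (auto simp: know_def Firm_def)
next
  case False
  then have "K k < ky X b" using assms by auto
  then show ?thesis using assms False by (auto simp: know_def Firm_def)
qed

end

section \<open>Steps on the list\<close>

text \<open>Steps that change neither the list nor the tiling; they may freeze a next pointer.\<close>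

definition "same X X' \<longleftrightarrow> now X \<le> now X' \<and> gG X \<le> gG X' \<and> tm X \<le> tm X' \<and>
  lk X' = lk X \<and> stp X' = stp X \<and> par X' = par X \<and> chn X' = chn X \<and> rmv X' = rmv X \<and> gT X' = gT X \<and>
  (\<forall>a. lkd X a \<longrightarrow> gm X' a \<noteq> None \<and> ky X' a = ky X a \<and> vl X' a = vl X a \<and> pr X' a = pr X a \<and>
     ts X' a = ts X a \<and> rf X' a = rf X a \<and> (mf (nx X a) \<longrightarrow> nx X' a = nx X a) \<and>
     (mf (nx X' a) \<longrightarrow> a \<noteq> head \<and> cm X a \<and> \<not> (pmark (nx X' a) \<and> pflag (nx X' a))))"

text \<open>The facts about the list on which other threads rely and which no step destroys.\<close>

definition "sext X X' \<longleftrightarrow> now X \<le> now X' \<and> gG X \<le> gG X' \<and>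
  (\<forall>a. lkd X a \<longrightarrow> lkd X' a \<and> lkp X' a = lkp X a \<and> ky X' a = ky X a \<and> vl X' a = vl X a \<and> pr X' a = pr X a \<and>
     (mf (nx X a) \<longrightarrow> nx X' a = nx X a)) \<and>
  (\<forall>a. cm X a \<longrightarrow> cm X' a \<and> stp X' a = stp X a \<and> ts X' a = ts X a) \<and>
  (\<forall>p a. p < now X \<longrightarrow> NR X p a \<longrightarrow> NR X' p a) \<and>
  (\<forall>p a b. Firm X p a b \<longrightarrow> Firm X' p a b) \<and>
  (\<forall>a b r. lkd X a \<longrightarrow> lkd X b \<longrightarrow> r < now X \<longrightarrow> Z X a b r \<longrightarrow> Z X' a b r) \<and>
  (\<forall>a c p. lkd X c \<longrightarrow> aliveF X p a \<longrightarrow> p < now X \<longrightarrow> RE X a c p \<longrightarrow> RE X' a c p) \<and>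
  (\<forall>p a x. cm X a \<longrightarrow> wk X p a x \<longrightarrow> wk X' p a x)"

lemma sextD:
  assumes "sext X X'"
  shows "now X \<le> now X'" "gG X \<le> gG X'"
    "lkd X a \<Longrightarrow> lkd X' a" "lkd X a \<Longrightarrow> lkp X' a = lkp X a" "lkd X a \<Longrightarrow> ky X' a = ky X a"
    "lkd X a \<Longrightarrow> vl X' a = vl X a" "lkd X a \<Longrightarrow> pr X' a = pr X a"
    "lkd X a \<Longrightarrow> mf (nx X a) \<Longrightarrow> nx X' a = nx X a"
    "cm X a \<Longrightarrow> cm X' a" "cm X a \<Longrightarrow> stp X' a = stp X a" "cm X a \<Longrightarrow> ts X' a = ts X a"
    "p < now X \<Longrightarrow> NR X p a \<Longrightarrow> NR X' p a"
    "Firm X p a b \<Longrightarrow> Firm X' p a b"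
    "lkd X a \<Longrightarrow> lkd X b \<Longrightarrow> r < now X \<Longrightarrow> Z X a b r \<Longrightarrow> Z X' a b r"
    "lkd X c \<Longrightarrow> aliveF X p a \<Longrightarrow> p < now X \<Longrightarrow> RE X a c p \<Longrightarrow> RE X' a c p"
    "cm X a \<Longrightarrow> wk X p a x \<Longrightarrow> wk X' p a x"
    "p < now X \<Longrightarrow> p < now X'"
    "aliveF X p a \<Longrightarrow> p < now X \<Longrightarrow> aliveF X' p a"
  using assms unfolding sext_def aliveF_def by (blast, blast, (metis order_less_le_trans)+)

lemma sext_trans:
  assumes 1: "sext X Y" and 2: "sext Y W" shows "sext X W"
proof (unfold sext_def, intro conjI allI impI)
  show "now X \<le> now W" using order_trans[OF sextD(1)[OF 1] sextD(1)[OF 2]] .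
  show "gG X \<le> gG W" using order_trans[OF sextD(2)[OF 1] sextD(2)[OF 2]] .
qed (simp_all add: sextD(3-18)[OF 1] sextD(3-16)[OF 2])

text \<open>By \<open>prior\<close>, a walk that starts at a linked node visits only linked nodes,
  so private nodes may differ.\<close>

lemma (in ginv) wk_cong:
  assumes eq: "\<And>a. lkd X a \<Longrightarrow> cm X' a \<longleftrightarrow> cm X a" "\<And>a. lkd X a \<Longrightarrow> stp X' a = stp X a"
    "\<And>a. lkd X a \<Longrightarrow> pr X' a = pr X a" and a: "lkd X a"
  shows "wk X' p a x \<longleftrightarrow> wk X p a x"
proof
  show "wk X p a x" if "wk X' p a x" using that a
  proof (induction rule: wk.induct)
    case (base a)
    have "cm X a" "stp X a \<le> p" using base(1,2) eq(1,2)[OF base(3)] by simp_all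
    then show ?case by (rule wk.base)
  next
    case (step a b x)
    have 1: "\<not> (cm X a \<and> stp X a \<le> p)" "pr X a = Some b" using step(1,2) eq[OF step(5)] by simp_all
    have "lkd X b" using prior[OF step(5) 1(2)] cm_lkd by blast
    then show ?case using wk.step[OF 1] step(4) by blast
  qed
  show "wk X' p a x" if "wk X p a x" using that a
  proof (induction rule: wk.induct)
    case (base a)
    have "cm X' a" "stp X' a \<le> p" using base(1,2) eq(1,2)[OF base(3)] by simp_all
    then show ?case by (rule wk.base)
  next
    case (step a b x)
    have 1: "\<not> (cm X' a \<and> stp X' a \<le> p)" "pr X' a = Some b" using step(1,2) eq[OF step(5)] by simp_all
    have "lkd X b" using prior[OF step(5) step(2)] cm_lkd by blast
    then show ?case using wk.step[OF 1] step(4) by blast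
  qed
qed

text \<open>Tiles, lives and walks depend on the references and the ghost fields only. The mark and
  flag bits enter through the clauses on frozen nodes, for which \<open>same\<close> demands that
  frozen pointers stay and that only committed nodes other than \<open>head\<close> become
  frozen.\<close>

lemma same_inv:
  assumes "ginv X" and s: "same X X'"
  shows "ginv X'" "sext X X'"
proof -
  interpret ginv X by fact
  have eqs [simp]: "lkd X' = lkd X" "lkp X' = lkp X" "stp X' = stp X" "par X' = par X" "chn X' = chn X"
     "rmv X' = rmv X" "gT X' = gT X"
    using s by (auto simp: same_def lkd_def lkp_def fun_eq_iff)
  have fld [simp]: "ky X' a = ky X a" "vl X' a = vl X a" "pr X' a = pr X a" "ts X' a = ts X a" "rf X' a = rf X a"
    if "lkd X a" for a using s that by (auto simp: same_def)
  have nxs: "nx X' a = nx X a" if "lkd X a" "mf (nx X a)" for a using s that by (auto simp: same_def)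
  have nxs': "a \<noteq> head \<and> cm X a \<and> \<not> (pmark (nx X' a) \<and> pflag (nx X' a))" if "lkd X a" "mf (nx X' a)" for a
    using s that unfolding same_def by blast
  have cms [simp]: "cm X' = cm X" by (auto simp: cm_def fun_eq_iff)
  have der [simp]: "alive X' = alive X" "sb X' = sb X" "NR X' = NR X" "HF X' = HF X"
    by (auto simp: alive_def sb_def NR_def HF_def fun_eq_iff)
  have tl [simp]: "tile X' = tile X" by (auto simp: tile_def fun_eq_iff)
  have nw: "now X \<le> now X'" "gG X \<le> gG X'" "tm X \<le> tm X'" using s by (auto simp: same_def)
  have tlps [simp]: "tlp X' y = tlp X y" if "lkd X y" for y using that by (simp add: tlp_def)
  have wks: "wk X' p a x \<longleftrightarrow> wk X p a x" if "lkd X a" for a p x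
    using that by (intro wk_cong) auto
  have succ: "successively (lnk X') xs \<longleftrightarrow> successively (lnk X) xs" if "\<forall>a\<in>set xs. lkd X a" for xs
    using that by (intro successively_cong) (auto simp: lnk_def)
  show "ginv X'"
  proof (intro ginv.intro, goal_cases)
    case 1 then show ?case using tm_pos nw by simp
  next
    case 2 then show ?case using G_ge nw by simp
  next
    case (3 a) then show ?case using s by (auto simp: same_def)
  next
    case 4 then show ?case using head by simp
  next
    case 5 then show ?case using head cm_lkd by simp
  next
    case 6 then show ?case using head by simp
  next
    case 7 then show ?case using head cm_lkd nxs' by blast
  next
    case (8 a) then show ?case using lk_now[of a] nw by auto
  next
    case (9 a) then show ?case using stp_now[of a] nw by simp
  next
    case (10 a) then show ?case using stp_ts[of a] cm_lkd[of a] by simp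
  next
    case (11 a c) then show ?case using nextL[of a c] by simp
  next
    case (12 a) then show ?case using nextN[of a] by simp
  next
    case (13 a) then show ?case using nxs'[of a] by simp
  next
    case (14 a y) then show ?case using rmvD[of a y] cm_lkd[of a] nxs[of a] by auto
  next
    case (15 n x) then show ?case using active[of n x] by simp
  next
    case (16 y) then show ?case using unc_par[of y] cm_lkd[of "par X y"] by auto
  next
    case (17 y)
    then have y: "lkd X y" "\<not> cm X y" by auto
    have "\<forall>a\<in>set (tlp X y). lkd X a" using unc_path[OF y] cm_lkd by blast
    then show ?case using unc_path[OF y] succ[of "tlp X y"] y(1) by simp
  next
    case (18 y a) then show ?case using unc_rmv[of y a] by simp
  next
    case (19 y)
    then have y: "lkd X y" "\<not> cm X y" "chn X y \<noteq> []" by auto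
    have c: "\<forall>a\<in>set (chn X y). lkd X a" using unc_path[of y] y cm_lkd by (auto simp: tlp_def)
    have "\<forall>a\<in>set (chn X y). mf (nx X a)" using unc_rmv[of y] y rmvD by blast
    then have "\<forall>a\<in>set (chn X y). nx X' a = nx X a" using c nxs by blast
    moreover have "lkd X (last (chn X y))" using c y(3) by simp
    moreover have "last (chn X y) \<in> set (chn X y)" using y(3) by simp
    moreover have "nx X' a = nx X a" if "a \<in> set (butlast (chn X y))" for a
      using calculation(1) in_set_butlastD[OF that] by simp
    ultimately show ?case using unc_chn[OF y] y(1) by simp
  next
    case (20 n p c)
    then show ?case using walkP[of n p c] cm_lkd[of n] nextL[of n c] wks[of c] by auto
  next
    case (21 k p n x) then show ?case using tileR[of k p n x] cm_lkd[of n] cm_lkd[of x] by simp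
  next
    case (22 x p) then show ?case using tileN[of x p] cm_lkd[of x] by simp
  next
    case (23 y x) then show ?case using prior[of y x] by simp
  qed
  show "sext X X'"
  proof -
    have fm: "Firm X p a b \<Longrightarrow> Firm X' p a b" for p a b using nw by (auto simp: Firm_def)
    have al: "aliveF X' = aliveF X" by (auto simp: aliveF_def fun_eq_iff)
    have zz: "lkd X a \<Longrightarrow> Z X a b r \<Longrightarrow> Z X' a b r" for a b r using fm unfolding Z_def by (cases "cm X a \<and> cm X b") auto
    have rr: "RE X' a c p" if re: "lkd X a" "lkd X c" "RE X a c p" for a c p
    proof (cases "cm X c")
      case True
      then obtain x where "wk X p c x" "Firm X p a x" using re by (auto simp: RE_def)
      then show ?thesis using True fm that wks[of c] unfolding RE_def by auto
    next
      case False then show ?thesis using that by (simp add: RE_def)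
    qed
    show ?thesis unfolding sext_def
      using nw fm zz rr wks nxs cm_lkd by (auto simp: aliveF_def cm_def)
  qed
qed

section \<open>Paths of next pointers, and the effect of a commit on the tiling\<close>

lemma successively_butlast_mono:
  "successively P xs \<Longrightarrow> (\<And>a b. a \<in> set (butlast xs) \<Longrightarrow> P a b \<Longrightarrow> Q a b) \<Longrightarrow> successively Q xs"
  by (induction xs rule: induct_list012) auto

lemma successively_next: "successively P xs \<Longrightarrow> a \<in> set (butlast xs) \<Longrightarrow> \<exists>b\<in>set xs. P a b"
  by (induction xs rule: induct_list012) auto

lemma in_set_last_butlast: "a \<in> set xs \<Longrightarrow> a = last xs \<or> a \<in> set (butlast xs)"
  by (induction xs) auto

lemma (in ginv) rmv_path:
  "successively (lnk X) xs \<Longrightarrow> \<forall>a\<in>set xs. cm X a \<Longrightarrow> xs \<noteq> [] \<Longrightarrow> rmv X (hd xs) = None \<Longrightarrow> \<forall>a\<in>set xs. rmv X a = None"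
proof (induction xs)
  case (Cons a xs)
  show ?case
  proof (cases xs)
    case (Cons b ys)
    have "lnk X a b" "cm X a" using Cons.prems Cons by auto
    then have "rmv X b = None" using active[of a b] cm_lkd Cons.prems(4) by (simp add: lnk_def)
    then have "\<forall>a\<in>set xs. rmv X a = None" using Cons.prems Cons by (intro Cons.IH) simp_all
    then show ?thesis using Cons.prems(4) by simp
  qed (use Cons.prems in simp)
qed simp

text \<open>If \<open>y\<close> has no successor the second case is void; this loses nothing,
  because \<open>y\<close> then has key \<open>PInf\<close>.\<close>

definition commitT :: "('k::linorder, 'v) gx \<Rightarrow> addr \<Rightarrow> pt \<Rightarrow> 'k ekey \<Rightarrow> pt \<Rightarrow> addr \<times> addr" where
  "commitT X y q k p =
     (if q \<le> p \<and> ky X (par X y) < k \<and> k \<le> ky X y then (par X y, y)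
      else if q \<le> p \<and> ky X y < k \<and> (\<exists>x. rf X y = Some x \<and> k \<le> ky X x) then (y, the (rf X y))
      else gT X k p)"

text \<open>The clock value \<open>v\<close> is read after \<open>y\<close> was linked, which gives
  \<open>lv\<close>, but it may lag behind \<open>gG X\<close>. The time component of
  \<open>q\<close> is that of the commit itself, so \<open>q\<close> lies after the link point even
  if the clock has not moved since.\<close>

locale committing = ginv X for X :: "('k::linorder, 'v) gx" +
  fixes y :: addr and v :: nat and X' :: "('k, 'v) gx" and q
  assumes ly: "lkd X y" and cy: "\<not> cm X y" and v2: "2 \<le> v" and lv: "pfst (lkp X y) \<le> v" and vG: "v \<le> gG X"
    and q: "q = Pt v (tm X)"
    and X': "X' = X\<lparr>gm := (gm X)(y \<mapsto> (the (gm X y))\<lparr>nts := v\<rparr>), tm := Suc (tm X),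
       stp := (stp X)(y := q), gT := commitT X y q\<rparr>"
begin

abbreviation "n \<equiv> par X y"
abbreviation "W \<equiv> tlp X y"

lemmas unc_y = unc_par[OF ly cy] unc_path[OF ly cy]

lemma link_less: "lkp X y < q"
  using lk_now[OF ly] lv vG by (auto simp: q less_pt_def now_def)

lemma stamp_le_now: "q \<le> now X" "q < now X'" "now X < now X'"
  using vG by (auto simp: q now_def X')

lemma link_le: "q \<le> p \<Longrightarrow> lkp X y \<le> p"
  using link_less by (meson order.strict_implies_order order_trans)

lemma lkd' [simp]: "lkd X' = lkd X" "lkp X' = lkp X" "par X' = par X" "chn X' = chn X" "rmv X' = rmv X"
    "gT X' = commitT X y q" "gG X' = gG X" "tm X' = Suc (tm X)"
  by (auto simp: lkd_def lkp_def X' fun_eq_iff)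

lemma flds [simp]: "ky X' a = ky X a" "vl X' a = vl X a" "pr X' a = pr X a" "nx X' a = nx X a" "rf X' a = rf X a"
   "ts X' a = (if a = y then v else ts X a)" "tlp X' a = tlp X a" "lnk X' = lnk X"
  by (auto simp: ky_def vl_def pr_def nx_def ts_def rf_def tlp_def lnk_def fun_eq_iff X')

lemma cm' [simp]: "cm X' a \<longleftrightarrow> cm X a \<or> a = y"
  using ly v2 by (auto simp: cm_def BOT_def)

lemma stp' [simp]: "stp X' a = (if a = y then q else stp X a)"
  by (simp add: X')

lemma cm_not_y: "cm X a \<Longrightarrow> a \<noteq> y" using cy by auto

lemma ky_pred_less: "ky X n < ky X y"
  using nextL[of n y] unc_y cm_lkd by blast

lemma ky_succ_less: "rf X y = Some x \<Longrightarrow> ky X y < ky X x"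
  using nextL[OF ly] by blast

lemma ky_last: "rf X y = None \<Longrightarrow> ky X y = PInf"
  using nextN[OF ly] by blast

lemma lastW: "ky X (last (n # W)) = (case rf X y of None \<Rightarrow> ky X y | Some x \<Rightarrow> ky X x)"
  using unc_y unc_chn[OF ly cy] by (auto simp: tlp_def split: option.splits)

lemma footprint_iff: "ky X n < k \<and> k \<le> ky X (last (n # W)) \<longleftrightarrow>
   ky X n < k \<and> k \<le> ky X y \<or> ky X y < k \<and> (\<exists>x. rf X y = Some x \<and> k \<le> ky X x)"
  using lastW ky_pred_less ky_succ_less by (auto split: option.splits)

lemma commitT_outside: "\<not> (q \<le> p \<and> ky X n < k \<and> k \<le> ky X (last (n # W))) \<Longrightarrow> commitT X y q k p = gT X k p"
  using footprint_iff[of k] by (auto simp: commitT_def)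

lemma tiles: "lkp X y \<le> p \<Longrightarrow> successively (tile X p) (n # W)"
  using path_tiles[OF ly cy] .

lemma path_heads: "set (butlast (n # W)) \<subseteq> insert n (set (chn X y))"
  using butlast_path[OF ly cy] .

text \<open>If \<open>y\<close> has no successor, the last removed node ends the path and starts no
  tile of it; that node has key \<open>PInf\<close>, whence the side condition.\<close>

lemma path_headI: "a \<in> insert n (set (chn X y)) \<Longrightarrow> ky X a \<noteq> PInf \<Longrightarrow> a \<in> set (butlast (n # W))"
  using unc_y ky_last unc_chn[OF ly cy] in_set_last_butlast[of a "chn X y"]
  by (cases "rf X y") (auto simp: tlp_def butlast_append)

lemma footprint_tile:
  assumes "lkp X y \<le> p" "ky X n < k" "k \<le> ky X (last (n # W))"
  shows "\<exists>a\<in>insert n (set (chn X y)). \<exists>b\<in>set W. tile X p a b \<and> ky X a < k \<and> k \<le> ky X b \<and> gT X k p = (a, b)"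
  using path_cover[OF tiles[OF assms(1)] assms(2,3)] path_heads by (fastforce simp: tile_def)

text \<open>Keys increase strictly along a path of tiles, so its last node cannot occur earlier on
  it.\<close>

lemma succ_notin_chn: "rf X y = Some x \<Longrightarrow> x \<notin> set (chn X y)"
proof
  assume s: "rf X y = Some x" and x: "x \<in> set (chn X y)"
  have w: "W = chn X y @ [x]" using s by (simp add: tlp_def)
  then have "x \<in> set (butlast (n # W))" "last (n # W) = x" using x by (auto simp: butlast_append)
  then show False using path_out[OF tiles[OF order_refl], of x] tileD by fastforce
qed

text \<open>At points from \<open>q\<close> on, each key of the replaced area lies in the tile of a
  bypassed edge, and the lower end of such an edge is \<open>par X y\<close> or a node in
  \<open>chn X y\<close>. A tile with another lower end is therefore disjoint from the area.\<close>

lemma tile_kept: "tile X p a b \<Longrightarrow> \<not> q \<le> p \<or> a \<notin> insert n (set (chn X y)) \<Longrightarrow> tile X' p a b"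
proof -
  assume t: "tile X p a b" and d: "\<not> q \<le> p \<or> a \<notin> insert n (set (chn X y))"
  have "commitT X y q k p = (a, b)" if k: "ky X a < k" "k \<le> ky X b" for k
  proof -
    have g: "gT X k p = (a, b)" using t k by (simp add: tile_def)
    have "\<not> (q \<le> p \<and> ky X n < k \<and> k \<le> ky X (last (n # W)))"
    proof
      assume f: "q \<le> p \<and> ky X n < k \<and> k \<le> ky X (last (n # W))"
      then have "lkp X y \<le> p" using link_le by simp
      then show False using footprint_tile[of p k] f d g by auto
    qed
    then show ?thesis using commitT_outside[of p k] g by simp
  qed
  then show "tile X' p a b" using t by (simp add: tile_def)
qed

lemma tile_pred_new: "q \<le> p \<Longrightarrow> tile X' p n y"
  using ky_pred_less unc_y ly cm_lkd by (auto simp: tile_def commitT_def)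

lemma tile_new_succ: "q \<le> p \<Longrightarrow> rf X y = Some x \<Longrightarrow> tile X' p y x"
  using ky_pred_less ky_succ_less nextL[OF ly] ly by (auto simp: tile_def commitT_def)

lemma alive_new: "alive X' p n" "alive X' p y"
  using unc_y by (auto simp: alive_def)

lemma alive_kept: "alive X p a \<Longrightarrow> \<not> q \<le> p \<or> a \<notin> set (chn X y) \<Longrightarrow> alive X' p a"
  using unc_rmv[OF ly cy, of a] cm_not_y by (auto simp: alive_def not_le)

lemma alive_before: "alive X' p a \<Longrightarrow> alive X p a"
proof -
  assume h: "alive X' p a"
  have "p < stp X y0" if "rmv X a = Some y0" "cm X y0" for y0
    using h that cm_not_y[OF that(2)] by (simp add: alive_def)
  then show ?thesis by (simp add: alive_def)
qed

lemma alive_notin_chn: "alive X' p a \<Longrightarrow> q \<le> p \<Longrightarrow> a \<notin> set (chn X y)"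
  using unc_rmv[OF ly cy, of a] by (auto simp: alive_def)

text \<open>The commit alters only the walk step at \<open>y\<close>, and only for points from
  \<open>q\<close> on; a walk from a committed node never meets \<open>y\<close>, because prior
  pointers lead to nodes committed before.\<close>

lemma wk'_lt: "\<not> q \<le> p \<or> cm X a \<Longrightarrow> lkd X a \<Longrightarrow> wk X p a x \<Longrightarrow> wk X' p a x"
proof -
  assume h: "\<not> q \<le> p \<or> cm X a" "lkd X a" "wk X p a x"
  from h(3,1,2) show "wk X' p a x"
  proof (induction rule: wk.induct)
    case (base a) then show ?case using cm_not_y by (intro wk.base) auto
  next
    case (step a b x)
    have "cm X b" using prior[OF step(6) step(2)] by simp
    then have "wk X' p b x" using step(4) cm_lkd by blast
    moreover have "\<not> (cm X' a \<and> stp X' a \<le> p)" using step(1,5) cy by auto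
    ultimately show ?case using step(2) by (intro wk.step[of X' a p b]) auto
  qed
qed

lemma ginv': "ginv X'"
proof (intro ginv.intro, goal_cases)
  case 1 then show ?case by simp
next
  case 2 then show ?case using G_ge by simp
next
  case (3 a) then show ?case using alloc[of a] unfolding lkd' by (auto simp: X')
next
  case 4 then show ?case using head by simp
next
  case 5 then show ?case using head by simp
next
  case 6 then show ?case using head by simp
next
  case 7 then show ?case using head by simp
next
  case (8 a) then show ?case using lk_now[of a] stamp_le_now(3) by auto
next
  case (9 a) then show ?case using stp_now[of a] stamp_le_now by auto
next
  case (10 a) then show ?case using stp_ts[of a] cm_not_y[of a] tm_pos link_less by (auto simp: q)
next
  case (11 a c) then show ?case using nextL[of a c] by simp
next
  case (12 a) then show ?case using nextN[of a] by simp
next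
  case (13 a) then show ?case using frozen_cm[of a] by simp
next
  case (14 a y0) then show ?case using rmvD[of a y0] cm_not_y by auto
next
  case (15 n x) then show ?case using active[of n x] by simp
next
  case (16 y0) then show ?case using unc_par[of y0] cm_not_y by auto
next
  case (17 y0) then show ?case using unc_path[of y0] cm_not_y by auto
next
  case (18 y0 a) then show ?case using unc_rmv[of y0 a] by simp
next
  case (19 y0) then show ?case using unc_chn[of y0] by simp
next
  case (20 n2 p c)
  show ?case
  proof (cases "n2 = y")
    case True
    then have c: "rf X y = Some c" "q \<le> p" using 20 by auto
    then have "c \<in> set W" by (simp add: tlp_def)
    then have "cm X c" "stp X c \<le> p" using unc_y link_less c by (auto intro: order.trans[OF order.strict_implies_order])
    then have "wk X' p c c" using cm_not_y by (intro wk.base) auto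
    then show ?thesis using tile_new_succ[OF c(2,1)] True by blast
  next
    case False
    then have n2: "cm X n2" "stp X n2 \<le> p" "alive X p n2" "rf X n2 = Some c" using 20 alive_before by auto
    then obtain x where x: "wk X p c x" "tile X p n2 x" using walkP by blast
    have lc: "lkd X c" using nextL n2 cm_lkd by blast
    show ?thesis
    proof (cases "q \<le> p")
      case False then show ?thesis using x tile_kept wk'_lt lc by blast
    next
      case qp: True
      show ?thesis
      proof (cases "n2 = n")
        case True
        then have "c = y" using n2 unc_y by simp
        have "wk X' p y y" using qp by (intro wk.base) auto
        then show ?thesis using tile_pred_new[OF qp] True \<open>c = y\<close> by blast
      next
        case False
        then have n2p: "n2 \<notin> insert n (set (chn X y))" using alive_notin_chn[of p n2] 20 qp by auto
        \<comment> \<open>Before the commit the walk from \<open>y\<close> ends at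
          \<open>hd W\<close>, whose tile starts at \<open>n\<close>; another living node pointing
          to \<open>y\<close> would have to own the same tile.\<close>
        have "c \<noteq> y"
        proof
          assume c: "c = y"
          have "lkp X y \<le> p" using link_le qp by simp
          then have t: "tile X p n (hd W)" using tiles[of p] unc_y by (cases W) auto
          have "hd W \<in> set W" using unc_y by simp
          then have "wk X p y x \<longleftrightarrow> x = hd W"
            using wk_step[of y p "hd W" x] wk_cm[of "hd W" p x] unc_y cy \<open>lkp X y \<le> p\<close> by fastforce
          then show False using x c t tile_inj False by blast
        qed
        then have "wk X' p c x"
        proof (cases "cm X c")
          case True then show ?thesis using wk'_lt x lc by blast
        next
          case cc: False
          then obtain b where b: "pr X c = Some b" "wk X p b x" using x(1) by (auto elim: wk.cases)
          then have "cm X b" using prior[OF lc] by blast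
          then have "wk X' p b x" using wk'_lt b cm_lkd by blast
          then show ?thesis using b cc \<open>c \<noteq> y\<close> by (intro wk.step[of _ c p b]) auto
        qed
        then show ?thesis using tile_kept x n2p by blast
      qed
    qed
  qed
next
  case (21 k p n0 x0)
  show ?case
  proof (cases "q \<le> p \<and> ky X n < k \<and> k \<le> ky X (last (n # W))")
    case True
    then have lp: "lkp X y \<le> p" using link_le True by simp
    consider "ky X n < k" "k \<le> ky X y" | x where "ky X y < k" "rf X y = Some x" "k \<le> ky X x"
      using footprint_iff True by blast
    then show ?thesis
    proof cases
      case 1
      then have "n0 = n" "x0 = y" using 21 True by (auto simp: commitT_def)
      moreover have "stp X n \<le> p" using unc_y lp by auto
      ultimately show ?thesis using unc_y 1 True tile_pred_new alive_new cm_not_y by auto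
    next
      case 2
      then have nx: "n0 = y" "x0 = x" using 21 True 2(1)[folded not_le] 2 by (auto simp: commitT_def)
      have xW: "x \<in> set W" using 2 by (simp add: tlp_def)
      then have "alive X p x" using path_in[OF tiles[OF lp]] tileD by blast
      then have "alive X' p x" using alive_kept succ_notin_chn 2 by blast
      moreover have "cm X x" "stp X x \<le> p" using unc_y xW lp by auto
      ultimately show ?thesis using nx 2 True tile_new_succ[OF _ 2(2)] alive_new cm_not_y by auto
    qed
  next
    case nf: False
    then have g: "gT X k p = (n0, x0)" using 21 commitT_outside by simp
    note R = tileR[OF 21(1) g]
    \<comment> \<open>A bypassed node starts only one tile at \<open>p\<close>, and that tile lies
      inside the replaced area, which does not contain \<open>k\<close>.\<close>
    have nn: "n0 \<notin> insert n (set (chn X y))" if "q \<le> p"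
    proof
      assume "n0 \<in> insert n (set (chn X y))"
      moreover have "ky X n0 \<noteq> PInf" using R by auto
      ultimately have "n0 \<in> set (butlast (n # W))" using path_headI by blast
      moreover have lp: "lkp X y \<le> p" using that link_le by simp
      ultimately obtain b where b: "tile X p n0 b" "ky X n \<le> ky X n0" "ky X b \<le> ky X (last (n # W))"
        using path_out[OF tiles[OF lp]] by blast
      then have "b = x0" using R tile_inj2 by blast
      then show False using b R nf that by auto
    qed
    have xx: "x0 \<notin> set (chn X y)" if "q \<le> p"
    proof
      assume "x0 \<in> set (chn X y)"
      then have "x0 \<in> set W" by (simp add: tlp_def)
      moreover have lp: "lkp X y \<le> p" using that link_le by simp
      ultimately obtain c where c: "c \<in> set (butlast (n # W))" "tile X p c x0" using path_in[OF tiles[OF lp]] by blast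
      then have "c = n0" using R tile_inj by blast
      then show False using c path_heads nn that by blast
    qed
    have "alive X' p n0" "alive X' p x0" using R alive_kept nn xx by blast+
    moreover have "tile X' p n0 x0" using R tile_kept nn by blast
    ultimately show ?thesis using R cm_not_y by auto
  qed
next
  case (22 x0 p)
  show ?case
  proof (cases "x0 = y")
    case True
    then have "q \<le> p" using 22 by simp
    then show ?thesis using True ky_pred_less by (auto simp: commitT_def)
  next
    case False
    then have "cm X x0" "stp X x0 \<le> p" "alive X p x0" using 22 alive_before by auto
    then obtain n0 where g: "gT X (ky X x0) p = (n0, x0)" using tileN 22 by blast
    show ?thesis
    proof (cases "q \<le> p \<and> ky X n < ky X x0 \<and> ky X x0 \<le> ky X (last (n # W))")
      case True
      then have "lkp X y \<le> p" using link_le True by simp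
      then have "x0 \<in> set W" using footprint_tile[of p "ky X x0"] True g by auto
      moreover have "x0 \<notin> set (chn X y)" using alive_notin_chn True 22 by blast
      ultimately have s: "rf X y = Some x0" by (auto simp: tlp_def split: option.splits)
      then have "commitT X y q (ky X x0) p = (y, x0)" using True ky_succ_less[OF s] by (auto simp: commitT_def)
      then show ?thesis by auto
    next
      case False then show ?thesis using commitT_outside g by auto
    qed
  qed
next
  case (23 y0 x) then show ?case using prior[of y0 x] cm_not_y by auto
qed

text \<open>Committing can only raise the bound \<open>sb\<close>, from the link point of
  \<open>y\<close> to its stamp.\<close>

lemma NR': "NR X p a \<Longrightarrow> NR X' p a"
  using link_less cm_not_y by (fastforce simp: NR_def sb_def)

text \<open>Here late stamps turn out to be harmless: a Firm edge that \<open>y\<close> bypasses has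
  its point before the link of \<open>y\<close>, hence before \<open>q\<close>, where the tiling is
  not touched.\<close>

lemma Firm': "Firm X p a b \<Longrightarrow> Firm X' p a b"
proof -
  assume f: "Firm X p a b"
  have "\<not> q \<le> p \<or> a \<notin> insert n (set (chn X y))"
  proof (rule ccontr)
    assume "\<not> ?thesis"
    then have "q \<le> p" "a = n \<or> rmv X a = Some y" using unc_rmv[OF ly cy] by auto
    then show False using f ly cy link_less by (auto simp: Firm_def HF_def NR_def sb_def)
  qed
  then have "tile X' p a b" using f tile_kept by (auto simp: Firm_def)
  then show ?thesis using f NR' stamp_le_now by (auto simp: Firm_def HF_def)
qed

lemma sext': "sext X X'"
proof -
  interpret I: ginv X' by (rule ginv')
  have Z': "Z X' a b r" if ab: "lkd X a" "lkd X b" "r < now X" "Z X a b r" for a b r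
  proof (cases "cm X a \<and> cm X b")
    case True then show ?thesis using ab Firm' unfolding Z_def by auto
  next
    case False
    then have f: "rf X a = Some b" "NR X r a" using ab by (auto simp: Z_def)
    show ?thesis
    proof (cases "cm X' a \<and> cm X' b")
      case False then show ?thesis using \<open>\<not> (cm X a \<and> cm X b)\<close> f NR' unfolding Z_def by auto
    next
      case c: True
      \<comment> \<open>The first point from the read on at which both ends have taken
        effect.\<close>
      define p where "p = max r (max (stp X' a) (stp X' b))"
      \<comment> \<open>Either \<open>a\<close> is \<open>y\<close>, which was uncommitted and hence
        unremoved, or \<open>b\<close> is \<open>y\<close>, and by \<open>rmvD\<close> the successor
        of a removed node is committed.\<close>
      have "rmv X a = None"
      proof (cases "a = y")
        case True then show ?thesis using unc_y by simp
      next
        case False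
        then have "b = y" using c \<open>\<not> (cm X a \<and> cm X b)\<close> by auto
        then show ?thesis using rmvD[of a] f cy by (cases "rmv X a") auto
      qed
      then have NRa: "NR X' p a" by (simp add: NR_def)
      have pn: "p < now X'" using ab(3) I.stp_now[of a] I.stp_now[of b] c stamp_le_now by (auto simp: p_def)
      have le: "r \<le> p" "stp X' a \<le> p" "stp X' b \<le> p" unfolding p_def by (simp_all add: le_max_iff_disj)
      have "\<exists>x. wk X' p b x \<and> tile X' p a x"
        using I.walkP[of a p b] c f I.NR_alive[OF NRa] le by simp
      then have "tile X' p a b" using I.wk_cm[of b p] c le by auto
      \<comment> \<open>A node still uncommitted with parent \<open>a\<close> would be the successor
        of \<open>a\<close>, but that is the committed \<open>b\<close>.\<close>
      moreover have "HF X' p a" using NRa f I.unc_par c unfolding HF_def by fastforce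
      ultimately show ?thesis using le c pn unfolding Z_def Firm_def by auto
    qed
  qed
  have RE': "RE X' a c p" if h: "lkd X c" "aliveF X p a" "p < now X" "RE X a c p" for a c p
  proof (cases "cm X c")
    case True
    then obtain x where "wk X p c x" "Firm X p a x" using h by (auto simp: RE_def)
    then have "wk X' p c x" "Firm X' p a x" using True h(1) Firm' wk'_lt by auto
    then show ?thesis using True unfolding RE_def by auto
  next
    case nc: False
    then have f: "rf X a = Some c" using h by (simp add: RE_def)
    show ?thesis
    proof (cases "c = y")
      case False then show ?thesis using nc f by (simp add: RE_def)
    next
      case True
      have NRa: "NR X' p a" using h NR' by (simp add: aliveF_def)
      have a: "cm X a" "stp X' a \<le> p" using h cm_not_y by (auto simp: aliveF_def)
      then obtain x where x: "wk X' p c x" "tile X' p a x"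
        using I.walkP[of a p c] f I.NR_alive[OF NRa] by auto
      have "HF X' p a" using NRa f True I.unc_par unfolding HF_def by fastforce
      then show ?thesis using x h(3) stamp_le_now True unfolding RE_def Firm_def by auto
    qed
  qed
  show ?thesis unfolding sext_def
    using stamp_le_now NR' Firm' Z' RE' wk'_lt cm_not_y cm_lkd by auto
qed

lemma Aval_lt: "\<not> q \<le> p \<Longrightarrow> Aval X' k p = Aval X k p"
  by (simp add: Aval_def Let_def commitT_def)

lemma chn_keys: "a \<in> set (butlast (chn X y)) \<Longrightarrow> ky X n < ky X a \<and> ky X a < ky X y"
proof -
  assume a: "a \<in> set (butlast (chn X y))"
  then have ne: "chn X y \<noteq> []" by auto
  have "successively (tile X (lkp X y)) (n # chn X y)"
    using tiles[OF order_refl] by (cases "rf X y") (auto simp: tlp_def successively_append_iff simp flip: append_Cons)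
  note p = path_in[OF this in_set_butlastD[OF a]] path_out[OF this, of a]
  have "a \<in> set (butlast (n # chn X y))" using a ne by simp
  then obtain b where "tile X (lkp X y) a b" "ky X b \<le> ky X (last (chn X y))" using p ne by auto
  moreover obtain c where "tile X (lkp X y) c a" "ky X n \<le> ky X c" using p by auto
  ultimately show ?thesis using unc_chn[OF ly cy ne] tileD by fastforce
qed

lemma Aval_present: "cm X a \<Longrightarrow> a \<in> set W \<Longrightarrow> ky X a = K k \<Longrightarrow> lkp X y \<le> p \<Longrightarrow> Aval X k p = Some (vl X a)"
proof -
  assume h: "cm X a" "a \<in> set W" "ky X a = K k" "lkp X y \<le> p"
  then obtain c where "tile X p c a" using path_in[OF tiles] by blast
  then show ?thesis using h tileD by (fastforce simp: Aval_def Let_def)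
qed

lemma Aval_chn:
  assumes "a \<in> set (butlast (chn X y))" "ky X a = K k"
  shows "q \<le> p \<Longrightarrow> Aval X' k p = None" "lkp X y \<le> p \<Longrightarrow> Aval X k p = Some (vl X a)"
proof -
  note kk = chn_keys[OF assms(1)]
  show "q \<le> p \<Longrightarrow> Aval X' k p = None" using kk assms by (auto simp: Aval_def Let_def commitT_def)
  have "a \<in> set W" using in_set_butlastD[OF assms(1)] by (simp add: tlp_def)
  then show "lkp X y \<le> p \<Longrightarrow> Aval X k p = Some (vl X a)" using Aval_present unc_y assms by blast
qed

lemma Aval_ins:
  assumes "chn X y = []" "ky X y = K k"
  shows "q \<le> p \<Longrightarrow> Aval X' k p = Some (vl X y)" "lkp X y \<le> p \<Longrightarrow> Aval X k p = None"
proof -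
  show "q \<le> p \<Longrightarrow> Aval X' k p = Some (vl X y)" using ky_pred_less assms by (auto simp: Aval_def Let_def commitT_def)
  assume p: "lkp X y \<le> p"
  obtain x where x: "W = [x]" "rf X y = Some x" using unc_y assms by (cases "rf X y") (auto simp: tlp_def)
  then have "tile X p n x" using tiles[OF p] by simp
  then show "Aval X k p = None" using ky_pred_less ky_succ_less[OF x(2)] assms by (auto simp: Aval_def Let_def tile_def)
qed

text \<open>The last node of \<open>chn X y\<close> is flagged, not marked, and \<open>y\<close>
  copies its key and value; the successor stays in place. So the map changes only at the key of an
  insertion and at the keys of the other, marked, nodes of the chain.\<close>

lemma Aval_other:
  assumes "\<not> (chn X y = [] \<and> ky X y = K k)" "\<not> (\<exists>a\<in>set (butlast (chn X y)). ky X a = K k)"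
  shows "Aval X' k p = Aval X k p"
proof (cases "q \<le> p \<and> ky X n < K k \<and> K k \<le> ky X (last (n # W))")
  case False then show ?thesis using commitT_outside[of p "K k"] by (simp add: Aval_def Let_def)
next
  case True
  then have lp: "lkp X y \<le> p" using link_le True by simp
  obtain a b where ab: "b \<in> set W" "ky X a < K k" "K k \<le> ky X b" "gT X (K k) p = (a, b)" "tile X p a b"
    using footprint_tile[OF lp] True by blast
  have old: "Aval X k p = (if ky X b = K k then Some (vl X b) else None)" using ab by (simp add: Aval_def Let_def)
  have bc: "b \<in> set (butlast (chn X y)) \<or> chn X y \<noteq> [] \<and> b = last (chn X y) \<or> rf X y = Some b"
    using ab(1) in_set_last_butlast[of b "chn X y"] by (auto simp: tlp_def split: option.splits)
  consider "K k \<le> ky X y" | x where "ky X y < K k" "rf X y = Some x" "K k \<le> ky X x"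
    using footprint_iff True by blast
  then show ?thesis
  proof cases
    case 1
    then have new: "Aval X' k p = (if ky X y = K k then Some (vl X y) else None)"
      using True by (simp add: Aval_def Let_def commitT_def)
    show ?thesis
    proof (cases "ky X y = K k")
      case True
      then have ne: "chn X y \<noteq> []" using assms by auto
      note c = unc_chn[OF ly cy ne]
      have "last (chn X y) \<in> set W" using ne by (simp add: tlp_def)
      then show ?thesis using Aval_present[of "last (chn X y)" k p] unc_y c True new lp by auto
    next
      case False
      then have "ky X b \<noteq> K k"
        using bc assms ky_succ_less[of b] 1 unc_chn[OF ly cy] by auto
      then show ?thesis using old new False by simp
    qed
  next
    case 2
    then have new: "Aval X' k p = (if ky X x = K k then Some (vl X x) else None)"
      using True by (auto simp: Aval_def Let_def commitT_def)
    show ?thesis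
    proof (cases "ky X x = K k")
      case True
      then show ?thesis using Aval_present[of x k p] unc_y 2 new lp by (auto simp: tlp_def)
    next
      case False
      then have "ky X b \<noteq> K k"
        using bc assms 2 unc_chn[OF ly cy] by auto
      then show ?thesis using old new False by simp
    qed
  qed
qed

end

section \<open>Histories and linearization points\<close>

text \<open>U is the set of updates (operation, point, old value, new value) of one key, f its value as a function
  of the point.\<close>

definition "logk f U \<longleftrightarrow>
  (\<forall>p1 p2. p1 \<le> p2 \<longrightarrow> f p1 \<noteq> f p2 \<longrightarrow> (\<exists>i q a b. (i, q, a, b) \<in> U \<and> p1 < q \<and> q \<le> p2)) \<and>
  (\<forall>i q a b. (i, q, a, b) \<in> U \<longrightarrow> f q = b \<and> a \<noteq> b \<and> (\<exists>p0<q. \<forall>p. p0 \<le> p \<longrightarrow> p < q \<longrightarrow> f p = a)) \<and>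
  (\<forall>i q a b i' a' b'. (i, q, a, b) \<in> U \<longrightarrow> (i', q, a', b') \<in> U \<longrightarrow> i = i')"

text \<open>The new point q exceeds all earlier ones, because f is constant from S on.\<close>

lemma logk_extend:
  fixes q :: "'p::linorder"
  assumes f: "logk f U" and S: "S < q" "\<And>p. S \<le> p \<Longrightarrow> f p = a" and ab: "a \<noteq> b"
    and f': "\<And>p. f' p = (if q \<le> p then b else f p)"
  shows "logk f' (insert (i, q, a, b) U)"
proof -
  have old: "q1 \<le> S" if u: "(i1, q1, a1, b1) \<in> U" for i1 q1 a1 b1
  proof (rule ccontr)
    assume "\<not> q1 \<le> S"
    then have Sq: "S < q1" by simp
    obtain p0 where p0: "p0 < q1" "\<And>p. p0 \<le> p \<Longrightarrow> p < q1 \<Longrightarrow> f p = a1" and b1: "f q1 = b1" "a1 \<noteq> b1"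
      using f u unfolding logk_def by blast
    \<comment> \<open>The point \<open>max p0 S\<close> lies in both regions where \<open>f\<close>
      is constant, so \<open>a1 = a\<close>; but \<open>f\<close> also has the value
      \<open>a\<close> at \<open>q1\<close>, leaving no change there.\<close>
    have "f (max p0 S) = a1" using p0 Sq by simp
    moreover have "f (max p0 S) = a" using S by simp
    moreover have "f q1 = a" using S Sq by simp
    ultimately show False using b1 by simp
  qed
  show ?thesis
    unfolding logk_def
  proof (intro conjI allI impI)
    fix p1 p2 assume p: "p1 \<le> p2" "f' p1 \<noteq> f' p2"
    show "\<exists>i' q' a' b'. (i', q', a', b') \<in> insert (i, q, a, b) U \<and> p1 < q' \<and> q' \<le> p2"
    proof (cases "q \<le> p2")
      case True
      then have "p1 < q" using p f' by (metis not_le)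
      then show ?thesis using True by blast
    next
      case False
      then have "f p1 \<noteq> f p2" using p f' by (metis order_trans)
      then have "\<exists>i q a b. (i, q, a, b) \<in> U \<and> p1 < q \<and> q \<le> p2" using f p(1) unfolding logk_def by blast
      then show ?thesis by blast
    qed
  next
    fix i1 q1 a1 b1 assume u: "(i1, q1, a1, b1) \<in> insert (i, q, a, b) U"
    show "f' q1 = b1"
    proof (cases "(i1, q1, a1, b1) \<in> U")
      case True
      then have "q1 < q" "f q1 = b1" using old S(1) f unfolding logk_def by (fastforce, blast)
      then show ?thesis using f'[of q1] by auto
    next
      case False then show ?thesis using u f' by simp
    qed
    show "a1 \<noteq> b1" using u ab f unfolding logk_def by blast
    show "\<exists>p0<q1. \<forall>p. p0 \<le> p \<longrightarrow> p < q1 \<longrightarrow> f' p = a1"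
    proof (cases "(i1, q1, a1, b1) \<in> U")
      case True
      then have "q1 < q" using old S(1) by fastforce
      moreover have "\<exists>p0<q1. \<forall>p. p0 \<le> p \<longrightarrow> p < q1 \<longrightarrow> f p = a1" using True f unfolding logk_def by blast
      ultimately show ?thesis using f' by (metis leD order.strict_trans)
    next
      case False then show ?thesis using u f' S by (auto intro!: exI[of _ S])
    qed
  next
    fix i1 q1 a1 b1 i2 a2 b2
    assume u: "(i1, q1, a1, b1) \<in> insert (i, q, a, b) U" "(i2, q1, a2, b2) \<in> insert (i, q, a, b) U"
    have "q1 \<noteq> q" if "(i', q1, a', b') \<in> U" for i' a' b' using old[OF that] S(1) by auto
    moreover have "i1 = i2" if "(i1, q1, a1, b1) \<in> U" "(i2, q1, a2, b2) \<in> U"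
      using f that unfolding logk_def by blast
    ultimately show "i1 = i2" using u by auto
  qed
qed

definition "fresh X i \<longleftrightarrow> lin X i = None \<and> (\<forall>a. org X a \<noteq> Some i) \<and> (\<forall>a. mrk X a \<noteq> Some i)"

text \<open>Success of an update is read off from its response, so that the set follows from
  \<open>lin\<close> and the history and needs no ghost of its own.\<close>

definition "upds X k = {(i, q, a, b). i < length (gh X) \<and>
  ((\<exists>v. op_of (gh X) i = Insert k v \<and> lin X i = Some (q, RV None) \<and> a = None \<and> b = Some v) \<or>
   (op_of (gh X) i = Remove k \<and> (\<exists>v. lin X i = Some (q, RV (Some v)) \<and> a = Some v \<and> b = None)))}"

text \<open>For a successful update only the form of the response is required; that it fits the map
  before and after is the business of \<open>logk\<close>.\<close>

definition linok :: "('k::linorder, 'v) gx \<Rightarrow> ('k, 'v) mop \<Rightarrow> pt \<Rightarrow> ('k, 'v) resp \<Rightarrow> bool" where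
  "linok X op p r = (case op of
     Insert k v \<Rightarrow> r = RV None \<or> (\<exists>w. r = RV (Some w) \<and> know X k p (Some w))
   | Remove k \<Rightarrow> (\<exists>w. r = RV (Some w)) \<or> r = RV None \<and> know X k p None
   | Contains k \<Rightarrow> (\<exists>w. r = RV w \<and> know X k p w)
   | RangeQuery a b \<Rightarrow> (\<exists>xs. r = RR xs \<and> distinct (map fst xs) \<and> (\<forall>(k, v)\<in>set xs. a \<le> k \<and> k \<le> b) \<and>
       (\<forall>k. a \<le> k \<longrightarrow> k \<le> b \<longrightarrow> know X k p (map_of xs k))))"

text \<open>By \<open>h_org\<close> and \<open>h_mrk\<close> an update that is bound to a node has a
  point exactly when that node, respectively the copy trimming it, is committed. As the invocation
  precedes the link, any stamp the node may get later respects real time. \<open>h_zero\<close>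
  provides the empty initial map.\<close>

locale hinv = ginv +
  assumes h_org: "org X a = Some i \<Longrightarrow> lkd X a \<and> chn X a = [] \<and> is_inv (gh X) i \<and>
      (\<exists>k. op_of (gh X) i = Insert k (vl X a) \<and> ky X a = K k) \<and> ht X i < lkp X a \<and>
      lin X i = (if cm X a then Some (stp X a, RV None) else None)"
    and h_org_inj: "org X a = Some i \<Longrightarrow> org X a' = Some i \<Longrightarrow> a = a'"
    and h_ins: "lkd X y \<Longrightarrow> \<not> cm X y \<Longrightarrow> chn X y = [] \<Longrightarrow> org X y \<noteq> None"
    and h_mrk: "mrk X a = Some i \<Longrightarrow> lkd X a \<and> pmark (nx X a) \<and> is_inv (gh X) i \<and>
      (\<exists>k. op_of (gh X) i = Remove k \<and> ky X a = K k) \<and> (\<forall>y. rmv X a = Some y \<longrightarrow> ht X i < lkp X y) \<and>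
      (\<forall>y. rmv X a = Some y \<longrightarrow> cm X y \<longrightarrow> lin X i = Some (stp X y, RV (Some (vl X a)))) \<and>
      ((\<forall>y. rmv X a = Some y \<longrightarrow> \<not> cm X y) \<longrightarrow> lin X i = None)"
    and h_mrk_inj: "mrk X a = Some i \<Longrightarrow> mrk X a' = Some i \<Longrightarrow> a = a'"
    and h_mrk_ex: "lkd X a \<Longrightarrow> pmark (nx X a) \<Longrightarrow> mrk X a \<noteq> None"
    and h_ht: "j < length (gh X) \<Longrightarrow> ht X j < now X"
    and h_mono: "j < j' \<Longrightarrow> j' < length (gh X) \<Longrightarrow> ht X j < ht X j'"
    and h_lin: "lin X i = Some (p, r) \<Longrightarrow> is_inv (gh X) i \<and> ht X i < p \<and> p < now X \<and> linok X (op_of (gh X) i) p r"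
    and h_log: "logk (Aval X k) (upds X k)"
    and h_zero: "Aval X k (Pt 0 0) = None"
    and h_match: "matches (gh X) i j r \<Longrightarrow> \<exists>p. lin X i = Some (p, r) \<and> p < ht X j"

definition "mine X t i \<longleftrightarrow> i < length (gh X) \<and> (\<exists>op. gh X ! i = Inv t op)"

text \<open>A step of \<open>t\<close> may linearize operations of other threads by committing their
  nodes, but such operations are already bound to a node through \<open>org\<close> or
  \<open>mrk\<close>; this is why fresh operations of others stay fresh.\<close>

definition "hext t X X' \<longleftrightarrow>
  (\<forall>i. \<not> mine X t i \<longrightarrow> fresh X i \<longrightarrow> fresh X' i) \<and>
  (\<forall>i x. lin X i = Some x \<longrightarrow> lin X' i = Some x) \<and>
  (\<forall>a i. org X a = Some i \<longrightarrow> org X' a = Some i) \<and>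
  (\<forall>a i. mrk X a = Some i \<longrightarrow> mrk X' a = Some i) \<and>
  (\<exists>es. gh X' = gh X @ es \<and> (\<forall>e\<in>set es. ev_thr e = t)) \<and> (\<forall>j<length (gh X). ht X' j = ht X j) \<and>
  (\<forall>a. gm X a \<noteq> None \<longrightarrow> lk X a = None \<longrightarrow> own X a \<noteq> t \<longrightarrow> gm X' a = gm X a \<and> lk X' a = None \<and> own X' a = own X a) \<and>
  (\<forall>u. u \<noteq> t \<longrightarrow> opi X' u = opi X u)"

lemma know_ext:
  assumes s: "sext X X'" and k: "know X k p r"
  shows "know X' k p r"
proof -
  have p: "p < now X" using k by (simp add: know_def)
  consider x where "aliveF X p x" "ky X x = K k" "r = Some (vl X x)"
    | a b where "Firm X p a b" "ky X a < K k" "K k < ky X b" "r = None"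
    using k by (auto simp: know_def)
  then show ?thesis
  proof cases
    case 1
    then have "lkd X x" by (simp add: aliveF_def cm_def)
    then show ?thesis using 1 sextD(5,6,17,18)[OF s] p unfolding know_def by metis
  next
    case 2
    then have "lkd X a" "lkd X b" by (auto simp: Firm_def tile_def)
    then show ?thesis using 2 sextD(5,13,17)[OF s] p unfolding know_def by metis
  qed
qed

lemma linok_ext: "sext X X' \<Longrightarrow> linok X op p r \<Longrightarrow> linok X' op p r"
proof -
  assume s: "sext X X'" and l: "linok X op p r"
  note k = know_ext[OF s]
  show ?thesis
    using l by (cases op) (simp_all add: linok_def, (blast intro: k)+)
qed

lemma op_of_append [simp]: "i < length h \<Longrightarrow> op_of (h @ es) i = op_of h i"
  by (simp add: op_of_def nth_append)

lemma is_inv_append: "is_inv h i \<Longrightarrow> is_inv (h @ es) i"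
  by (auto simp: is_inv_def nth_append)

lemma is_inv_len: "is_inv h i \<Longrightarrow> i < length h"
  by (simp add: is_inv_def)

lemma (in ginv) Aval_same: "same X X' \<Longrightarrow> Aval X' k p = Aval X k p"
proof -
  assume s: "same X X'"
  obtain n x where g: "gT X (K k) p = (n, x)" by fastforce
  then have "lkd X x" using tileR[of "K k" p n x] cm_lkd by simp
  then show ?thesis using g s by (simp add: Aval_def same_def)
qed

text \<open>The steps that only change histories: a node may be marked, a lookup may be linearized, or an
  event may be appended.\<close>

definition "hsame X X' \<longleftrightarrow> same X X' \<and> org X' = org X \<and>
  (mrk X' = mrk X \<and> lin X' = lin X \<or>
   lin X' = lin X \<and> (\<exists>a i k. mrk X' = (mrk X)(a \<mapsto> i) \<and> lkd X a \<and> \<not> mf (nx X a) \<and> ky X a = K k \<and>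
      is_inv (gh X) i \<and> op_of (gh X) i = Remove k \<and> fresh X i) \<or>
   mrk X' = mrk X \<and> (\<exists>i p r. lin X' = (lin X)(i \<mapsto> (p, r)) \<and> is_inv (gh X) i \<and> fresh X i \<and>
      ht X i < p \<and> p < now X \<and> linok X (op_of (gh X) i) p r \<and>
      (\<forall>k v. op_of (gh X) i = Insert k v \<longrightarrow> r \<noteq> RV None) \<and>
      (\<forall>k v. op_of (gh X) i = Remove k \<longrightarrow> r \<noteq> RV (Some v)))) \<and>
  (\<forall>a. lkd X a \<longrightarrow> pmark (nx X' a) = (pmark (nx X a) \<or> mrk X' a \<noteq> mrk X a)) \<and>
  (gh X' = gh X \<and> ht X' = ht X \<or>
   (\<exists>e. gh X' = gh X @ [e] \<and> ht X' = (ht X)(length (gh X) := now X) \<and> now X < now X' \<and>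
      (\<forall>i r. matches (gh X @ [e]) i (length (gh X)) r \<longrightarrow> (\<exists>p. lin X i = Some (p, r) \<and> p < now X))))"

lemma same_eqs:
  assumes "same X X'"
  shows "lkd X' = lkd X" "lkp X' = lkp X" "stp X' = stp X" "par X' = par X" "chn X' = chn X"
     "rmv X' = rmv X" "gT X' = gT X" "cm X' = cm X"
     "lkd X a \<Longrightarrow> ky X' a = ky X a" "lkd X a \<Longrightarrow> vl X' a = vl X a"
proof -
  show *: "lkd X' = lkd X" "lkp X' = lkp X" "stp X' = stp X" "par X' = par X" "chn X' = chn X"
     "rmv X' = rmv X" "gT X' = gT X"
    using assms by (auto simp: same_def lkd_def lkp_def fun_eq_iff)
  show "lkd X a \<Longrightarrow> ky X' a = ky X a" "lkd X a \<Longrightarrow> vl X' a = vl X a" using assms by (auto simp: same_def)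
  have "ts X' a = ts X a" if "lkd X a" for a using assms that by (auto simp: same_def)
  then show "cm X' = cm X" using * by (auto simp: cm_def fun_eq_iff)
qed

lemma matches_append: "matches (h @ [e]) i j r \<Longrightarrow> matches h i j r \<or> j = length h"
  by (auto simp: matches_def nth_append)

text \<open>The new entry of \<open>lin\<close>, if any, belongs to an operation that changes
  nothing, so \<open>upds\<close> is unchanged; so is \<open>Aval\<close>, and \<open>h_log\<close>
  carries over.\<close>

lemma hsame_inv:
  fixes X :: "('k::linorder, 'v) gx"
  assumes "hinv X" and h: "hsame X X'"
  shows "hinv X'" "sext X X'"
proof -
  interpret hinv X by fact
  have s: "same X X'" and org [simp]: "org X' = org X"
    and pm: "\<And>a. lkd X a \<Longrightarrow> pmark (nx X' a) = (pmark (nx X a) \<or> mrk X' a \<noteq> mrk X a)"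
    using h by (auto simp: hsame_def)
  note si = same_inv[OF ginv_axioms s]
  show "sext X X'" by (rule si(2))
  note e = same_eqs[OF s]
  have nw: "now X \<le> now X'" using s by (simp add: same_def)
  have gh: "\<exists>es. gh X' = gh X @ es" using h unfolding hsame_def by (metis append_Nil2)
  have inv: "is_inv (gh X) i \<Longrightarrow> is_inv (gh X') i" for i using gh is_inv_append by metis
  have op: "is_inv (gh X) i \<Longrightarrow> op_of (gh X') i = op_of (gh X) i" for i using gh is_inv_len op_of_append by metis
  have ht: "is_inv (gh X) i \<Longrightarrow> ht X' i = ht X i" for i using h is_inv_len by (fastforce simp: hsame_def)
  have lin_keep: "lin X i = Some x \<Longrightarrow> lin X' i = Some x" for i x
    using h by (auto simp: hsame_def fresh_def)
  have lin_used: "org X a = Some i \<or> mrk X a = Some i \<Longrightarrow> lin X' i = lin X i" for a i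
    using h by (auto simp: hsame_def fresh_def)
  have lin': "is_inv (gh X) i \<and> ht X i < p \<and> p < now X \<and> linok X (op_of (gh X) i) p r"
    if "lin X' i = Some (p, r)" for i p r
    using h that h_lin[of i p r] by (auto simp: hsame_def split: if_splits)
  have lin_upd: "lin X' i = Some (p, r) \<Longrightarrow> op_of (gh X) i = Insert k v \<and> r = RV None \<or> op_of (gh X) i = Remove k \<and> r = RV (Some v)
      \<Longrightarrow> lin X i = Some (p, r)" for i p r k v
    using h by (auto simp: hsame_def split: if_splits)
  have mrk': "mrk X a = Some i \<or> mrk X a = None \<and> fresh X i \<and> lkd X a \<and> rmv X a = None \<and> is_inv (gh X) i \<and>
      (\<exists>k. op_of (gh X) i = Remove k \<and> ky X a = K k) \<and> lin X' i = None" if "mrk X' a = Some i" for a i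
  proof -
    \<comment> \<open>Marked nodes and removed nodes have frozen next pointers, so the node being
      marked in this step is neither.\<close>
    have "mrk X a = None \<and> rmv X a = None" if m: "\<not> mf (nx X a)"
    proof -
      have "\<not> pmark (nx X a)" using m by (simp add: mf_def)
      then show ?thesis using m h_mrk[of a] rmvD[of a] by (cases "mrk X a"; cases "rmv X a") auto
    qed
    then show ?thesis using h that by (auto simp: hsame_def fresh_def split: if_splits)
  qed
  have mrk_keep: "mrk X' a = None \<Longrightarrow> mrk X a = None" for a using h by (auto simp: hsame_def split: if_splits)
  have upd: "upds X' k = upds X k" for k
  proof -
    have "(i, q, a, b) \<in> upds X' k \<longleftrightarrow> (i, q, a, b) \<in> upds X k" for i q a b
    proof (cases "lin X' i")
      case None
      then have "lin X i = None" using lin_keep by (cases "lin X i") auto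
      then show ?thesis using None by (simp add: upds_def)
    next
      case (Some x)
      then have "is_inv (gh X) i" using lin'[of i "fst x" "snd x"] by simp
      then have "op_of (gh X') i = op_of (gh X) i" "i < length (gh X')" "i < length (gh X)"
        using op inv is_inv_len by blast+
      moreover have "x = y" if "lin X i = Some y" for y using lin_keep[OF that] Some by simp
      ultimately show ?thesis using Some lin_upd[of i q] by (cases "lin X i") (auto simp: upds_def)
    qed
    then show ?thesis by (auto simp: set_eq_iff)
  qed
  show "hinv X'"
  proof (rule hinv.intro[OF si(1)], rule hinv_axioms.intro, goal_cases)
    case (1 a i)
    then show ?case using h_org[of a i] lin_used[of a i] ht op inv e by simp
  next
    case (2 a i a') then show ?case using h_org_inj by simp
  next
    case (3 y) then show ?case using h_ins e by simp
  next
    case (4 a i)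
    from mrk'[OF this] show ?case
    proof
      assume m: "mrk X a = Some i"
      then show ?thesis using h_mrk[OF m] lin_used[of a i] ht op inv e pm by simp
    next
      assume "mrk X a = None \<and> fresh X i \<and> lkd X a \<and> rmv X a = None \<and> is_inv (gh X) i \<and>
        (\<exists>k. op_of (gh X) i = Remove k \<and> ky X a = K k) \<and> lin X' i = None"
      then show ?thesis using 4 ht op inv e pm by simp
    qed
  next
    case (5 a i a')
    then show ?case using h h_mrk_inj[of a i a'] by (auto simp: hsame_def fresh_def split: if_splits)
  next
    case (6 a) then show ?case using h_mrk_ex[of a] e pm[of a] mrk_keep[of a] by (cases "mrk X' a") auto
  next
    case (7 j)
    show ?case
    proof (cases "j < length (gh X)")
      case True then show ?thesis using h_ht[OF True] h nw by (auto simp: hsame_def)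
    next
      case False then show ?thesis using 7 h by (auto simp: hsame_def less_Suc_eq)
    qed
  next
    case (8 j j')
    show ?case
    proof (cases "j' < length (gh X)")
      case True then show ?thesis using h_mono[OF 8(1) True] h 8 by (auto simp: hsame_def)
    next
      case False then show ?thesis using 8 h h_ht[of j] by (auto simp: hsame_def less_Suc_eq)
    qed
  next
    case (9 i p r)
    then show ?case using lin'[of i p r] ht op inv linok_ext[OF si(2)] sextD(17)[OF si(2)] by simp
  next
    case (10 k)
    have "Aval X' k = Aval X k" using Aval_same[OF s] by auto
    then show ?case using h_log[of k] upd by simp
  next
    case (11 k) then show ?case using Aval_same[OF s] h_zero by simp
  next
    case (12 i j r)
    show ?case
    proof (cases "matches (gh X) i j r")
      case True
      then have "ht X' j = ht X j" using h by (auto simp: hsame_def matches_def)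
      then show ?thesis using h_match[OF True] lin_keep by auto
    next
      case False
      then obtain ev where ev: "gh X' = gh X @ [ev]" "ht X' = (ht X)(length (gh X) := now X)"
        "\<And>i r. matches (gh X @ [ev]) i (length (gh X)) r \<Longrightarrow> \<exists>p. lin X i = Some (p, r) \<and> p < now X"
        using 12 h unfolding hsame_def by metis
      have "j = length (gh X)" using 12 False ev(1) matches_append by metis
      then show ?thesis using ev(3)[of i r] 12 ev(1,2) lin_keep by auto
    qed
  qed
qed

section \<open>Steps that keep the memory, and linking a node\<close>

lemma (in ginv) same_core:
  assumes "gm X' = gm X" "gG X \<le> gG X'" "tm X \<le> tm X'" "lk X' = lk X" "stp X' = stp X" "par X' = par X" "chn X' = chn X"
    "rmv X' = rmv X" "gT X' = gT X"
  shows "same X X'"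
proof -
  have "nx X' = nx X" "ky X' = ky X" "vl X' = vl X" "pr X' = pr X" "ts X' = ts X" "rf X' = rf X"
    using assms(1) by (auto simp: fun_eq_iff nx_def ky_def vl_def pr_def ts_def rf_def)
  moreover have "now X \<le> now X'" using assms(2,3) by (auto simp: now_def)
  ultimately show ?thesis using assms alloc frozen_cm head by (auto simp: same_def)
qed

text \<open>Linking moves no tile and linearizes nothing, because \<open>y\<close> is still
  uncommitted. What must be shown is that the bypassed path is intact and is not claimed by another
  uncommitted node; this follows from the unfrozen pointer of \<open>n\<close> and from all of
  \<open>W\<close> being committed.\<close>

lemma link_hinv:
  fixes X :: "('k::linorder, 'v) gx"
  assumes "hinv X"
    and n: "cm X n" "\<not> mf (nx X n)" "rf X n = Some v"
    and y: "gm X y = Some nd" "lk X y = None" "nts nd = BOT" "nnext nd = Ptr s False False" "nprior nd = Some v"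
    and own: "own X y = t"
    and W: "W = C @ (case s of None \<Rightarrow> [] | Some x \<Rightarrow> [x])" "W \<noteq> []" "hd W = v"
      "successively (lnk X) W" "\<forall>a\<in>set W. cm X a"
    and C: "C \<noteq> [] \<Longrightarrow> rf X (last C) = s \<and> nkey nd = ky X (last C) \<and> nval nd = vl X (last C) \<and>
       pflag (nx X (last C)) \<and> (\<forall>a\<in>set (butlast C). pmark (nx X a))"
    and kn: "ky X n < nkey nd" and ks: "\<And>x. s = Some x \<Longrightarrow> nkey nd < ky X x" "s = None \<Longrightarrow> nkey nd = PInf"
    and i: "C = [] \<Longrightarrow> mine X t (opi X t) \<and> (\<exists>k. op_of (gh X) (opi X t) = Insert k (nval nd) \<and> nkey nd = K k) \<and>
      fresh X (opi X t)"
    and X': "X' = X\<lparr>gm := (gm X)(n \<mapsto> (the (gm X n))\<lparr>nnext := unm y\<rparr>), tm := Suc (tm X),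
       lk := (lk X)(y \<mapsto> now X), par := (par X)(y := n), chn := (chn X)(y := C),
       rmv := (\<lambda>a. if a \<in> set C then Some y else rmv X a),
       org := (if C = [] then (org X)(y \<mapsto> opi X t) else org X)\<rparr>"
  shows "hinv X'" "sext X X'" "hext t X X'" "C = [] \<Longrightarrow> org X' y = Some (opi X t)" "lkd X' y"
proof -
  interpret hinv X by fact
  have i: "C = [] \<Longrightarrow> mine X t (opi X t) \<and> is_inv (gh X) (opi X t) \<and>
     (\<exists>k. op_of (gh X) (opi X t) = Insert k (nval nd) \<and> nkey nd = K k) \<and> fresh X (opi X t)"
    using i by (auto simp: mine_def is_inv_def)
  have ly: "\<not> lkd X y" using y by (simp add: lkd_def)
  then have cy: "\<not> cm X y" by (simp add: cm_def)
  have yn: "y \<noteq> n" using n cy by auto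
  have lkd': "lkd X' a \<longleftrightarrow> lkd X a \<or> a = y" for a by (simp add: lkd_def X')
  have lkp': "lkp X' a = (if a = y then now X else lkp X a)" for a by (simp add: lkp_def X')
  have flds [simp]: "ky X' a = ky X a" "vl X' a = vl X a" "pr X' a = pr X a" "ts X' a = ts X a" for a
    by (auto simp: ky_def vl_def pr_def ts_def X')
  have nx': "nx X' a = (if a = n then unm y else nx X a)" for a by (auto simp: nx_def X')
  have rf': "rf X' a = (if a = n then Some y else rf X a)" for a by (simp add: rf_def nx' unm_def)
  have yflds: "ky X y = nkey nd" "vl X y = nval nd" "pr X y = Some v" "ts X y = BOT" "nx X y = Ptr s False False" "rf X y = s"
    using y by (auto simp: ky_def vl_def pr_def ts_def nx_def rf_def)
  have cm' [simp]: "cm X' a \<longleftrightarrow> cm X a" for a using yflds cy by (auto simp: cm_def lkd')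
  have stp' [simp]: "stp X' = stp X" "gT X' = gT X" "gG X' = gG X" "tm X' = Suc (tm X)" by (simp_all add: X')
  have now': "now X < now X'" by (simp add: now_def)
  have par': "par X' a = (if a = y then n else par X a)" for a by (simp add: X')
  have chn': "chn X' a = (if a = y then C else chn X a)" for a by (simp add: X')
  have rmv': "rmv X' a = (if a \<in> set C then Some y else rmv X a)" for a by (simp add: X')
  \<comment> \<open>A removed node has a frozen pointer, so \<open>n\<close> is not removed;
    \<open>active\<close> carries this along the path, so that no node gets a second
    remover.\<close>
  have rn: "rmv X n = None" using rmvD[of n] n by (cases "rmv X n") auto
  have rv: "rmv X v = None" using active[OF cm_lkd[OF n(1)] rn n(3)] .
  have rW: "\<forall>a\<in>set W. rmv X a = None" using rmv_path[OF W(4,5,2)] unfolding W(3) using rv .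
  have cv: "cm X v" using W(2,3,5) hd_in_set by metis
  have CW: "set C \<subseteq> set W" using W by auto
  have mC: "mf (nx X a)" if "a \<in> set C" for a
  proof -
    have "C \<noteq> []" using that by auto
    then show ?thesis using C in_set_last_butlast[OF that] by (auto simp: mf_def)
  qed
  have nC: "n \<notin> set C" using mC n by blast
  have yW: "y \<notin> set W" using W cy by auto
  have tls: "successively (tile X (now X)) (n # W)"
  proof -
    have "successively (tile X (now X)) W"
      using W(4)
    proof (rule successively_mono)
      fix a b assume "a \<in> set W" "b \<in> set W" "lnk X a b"
      then show "tile X (now X) a b" using live_tile[of a b] W(5) rW by (simp add: lnk_def)
    qed
    moreover have "tile X (now X) n (hd W)" using live_tile[OF n(1) rn n(3) cv] W(3) by simp
    ultimately show ?thesis using W(2) by (cases W) auto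
  qed
  have bl: "set (butlast (n # W)) \<subseteq> insert n (set C)"
    using W by (auto simp: butlast_append dest: in_set_butlastD split: option.splits if_splits)
  have sC: "x \<notin> set C" if "s = Some x" for x
  proof
    assume x: "x \<in> set C"
    have "W = C @ [x]" using W that by simp
    then have "x \<in> set (butlast (n # W))" "last (n # W) = x" using x by (auto simp: butlast_append)
    then show False using path_out[OF tls, of x] tileD by fastforce
  qed
  have nxtC: "c \<in> set W" if "a \<in> set C" "rf X a = Some c" for a c
  proof -
    have "a = last C \<and> s = Some c \<or> a \<in> set (butlast W)"
    proof (cases "a = last C")
      case True
      have "C \<noteq> []" using that by auto
      then have "rf X (last C) = s" using C by blast
      then show ?thesis using that True by simp
    next
      case False
      then have "a \<in> set (butlast C)" using in_set_last_butlast[OF that(1)] by simp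
      then show ?thesis using W by (auto simp: butlast_append dest: in_set_butlastD split: option.splits)
    qed
    then show ?thesis
    proof
      assume "a = last C \<and> s = Some c" then show ?thesis using W by simp
    next
      assume "a \<in> set (butlast W)"
      then obtain b where "b \<in> set W" "lnk X a b" using successively_next[OF W(4)] by blast
      then show ?thesis using \<open>rf X a = Some c\<close> by (simp add: lnk_def)
    qed
  qed
  \<comment> \<open>The successor of \<open>par X y0\<close> is the uncommitted \<open>y0\<close>,
    whereas \<open>n\<close> and the nodes in \<open>C\<close> have committed successors.\<close>
  have parn: "par X y0 \<noteq> n" "par X y0 \<notin> set C" if "lkd X y0" "\<not> cm X y0" for y0
  proof -
    note u = unc_par[OF that]
    show "par X y0 \<noteq> n" using u n(3) cv that by (metis option.inject)
    show "par X y0 \<notin> set C" using u nxtC W(5) that by metis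
  qed
  have nchn: "n \<notin> set (chn X y0)" if "lkd X y0" "\<not> cm X y0" for y0
    using unc_rmv[OF that, of n] rn by simp
  have alive' [simp]: "alive X' p a \<longleftrightarrow> alive X p a" for p a
    using rW CW cy by (auto simp: alive_def rmv')
  have tile'I: "tile X p a b \<Longrightarrow> tile X' p a b" for p a b by (simp add: tile_def lkd')
  have tlp': "tlp X' y0 = (if y0 = y then W else tlp X y0)" if "y0 \<noteq> n" for y0
    using that yn by (simp add: tlp_def chn' rf' yflds W)
  have sb': "sb X' a = (if a = y then now X else sb X a)" for a using cy by (simp add: sb_def lkp')
  have wk': "wk X' p a x \<longleftrightarrow> wk X p a x" if "lkd X a" for p a x using that by (intro wk_cong) auto
  have g: "ginv X'"
  proof (intro ginv.intro, goal_cases)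
    case 1 then show ?case by simp
  next
    case 2 then show ?case using G_ge by simp
  next
    case (3 a) then show ?case using alloc[of a] y unfolding lkd' by (auto simp: X')
  next
    case 4 then show ?case using head by simp
  next
    case 5 then show ?case using head by simp
  next
    case 6 then show ?case using head mC by (auto simp: rmv')
  next
    case 7 then show ?case using head by (auto simp: nx' mf_def unm_def)
  next
    case (8 a)
    show ?case
    proof (cases "a = y")
      case True then show ?thesis using now' by (simp add: lkp') (simp add: now_def)
    next
      case False then show ?thesis using 8 lk_now[of a] now' by (auto simp: lkd' lkp')
    qed
  next
    case (9 a) then show ?case using stp_now[of a] now' by simp
  next
    case (10 a) then show ?case using stp_ts[of a] cy by (auto simp: lkp')
  next
    case (11 a c)
    show ?case
    proof (cases "a = n")
      case True then show ?thesis using 11 kn yflds by (simp add: rf' lkd')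
    next
      case False
      show ?thesis
      proof (cases "a = y")
        case True
        then have s: "s = Some c" using 11 False yflds by (simp add: rf')
        then have "cm X c" using W by simp
        then show ?thesis using ks(1)[OF s] True yflds cm_lkd by (simp add: lkd')
      next
        case False then show ?thesis using 11 \<open>a \<noteq> n\<close> nextL[of a c] by (simp add: rf' lkd')
      qed
    qed
  next
    case (12 a) then show ?case using nextN[of a] ks(2) yflds by (auto simp: rf' lkd' split: if_splits)
  next
    case (13 a) then show ?case using frozen_cm[of a] yflds by (auto simp: nx' lkd' mf_def unm_def split: if_splits)
  next
    case (14 a y0)
    show ?case
    proof (cases "a \<in> set C")
      case True
      then have "y0 = y" using 14 by (simp add: rmv')
      moreover have "cm X a" "a \<noteq> n" using True CW W(5) nC by auto
      ultimately show ?thesis using True mC[OF True] nxtC[OF True] W(5) stp_now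
        by (auto simp: lkd' lkp' nx' rf')
    next
      case False
      then have r: "rmv X a = Some y0" using 14 by (simp add: rmv')
      moreover have "y0 \<noteq> y" "a \<noteq> n" using rmvD[OF r] ly r rn by auto
      ultimately show ?thesis using rmvD[OF r] by (auto simp: lkd' lkp' nx' rf')
    qed
  next
    case (15 n2 x2)
    then have n2C: "n2 \<notin> set C" and r2: "rmv X n2 = None" by (auto simp: rmv' split: if_splits)
    show ?case
    proof (cases "n2 = n \<or> n2 = y")
      case True
      then show ?thesis
      proof
        assume "n2 = n"
        then have "x2 = y" using 15 by (simp add: rf')
        then show ?thesis using yW CW rmvD[of y] cy by (cases "rmv X y") (auto simp: rmv')
      next
        assume "n2 = y"
        then have s: "s = Some x2" using 15 yn yflds by (simp add: rf')
        then show ?thesis using sC[OF s] rW W(1) by (simp add: rmv')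
      qed
    next
      case False
      then have l2: "lkd X n2" and f2: "rf X n2 = Some x2" using 15 by (auto simp: lkd' rf')
      have "rmv X x2 = None" using active[OF l2 r2 f2] .
      \<comment> \<open>A node in \<open>C\<close> is the upper end of only one tile at
        \<open>now X\<close>, and that tile starts at \<open>n\<close> or in \<open>C\<close>. If
        \<open>n2\<close> is committed, it would own this tile; if not, the path bypassed by
        \<open>n2\<close> would share it.\<close>
      moreover have "x2 \<notin> set C"
      proof
        assume x2: "x2 \<in> set C"
        then obtain c where c: "c \<in> insert n (set C)" "tile X (now X) c x2"
          using path_in[OF tls, of x2] CW bl by blast
        show False
        proof (cases "cm X n2")
          case True
          then have "n2 = c" using live_tile[OF True r2 f2] x2 CW W(5) c tile_inj by blast
          then show False using c n2C False by auto
        next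
          case nc: False
          have "lkp X n2 \<le> now X" using lk_now[OF l2] by (simp add: order.strict_implies_order)
          moreover have "x2 \<in> set (tlp X n2)" using f2 by (simp add: tlp_def)
          ultimately obtain d where d: "d \<in> insert (par X n2) (set (chn X n2))" "tile X (now X) d x2"
            using path_in[OF path_tiles[OF l2 nc]] butlast_path[OF l2 nc] by blast
          then have "d = c" using c tile_inj by blast
          then show False using c d parn[OF l2 nc] unc_rmv[OF l2 nc, of d] rn rW CW by auto
        qed
      qed
      ultimately show ?thesis by (simp add: rmv')
    qed
  next
    case (16 y0)
    show ?case
    proof (cases "y0 = y")
      case True
      have "rmv X y = None" using rmvD[of y] cy by (cases "rmv X y") auto
      then show ?thesis using True n rn nC stp_now[OF n(1)] yW CW by (auto simp: par' rmv' rf' lkp')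
    next
      case False
      then have "lkd X y0" "\<not> cm X y0" using 16 by (auto simp: lkd')
      moreover have "y0 \<notin> set C" using CW W(5) calculation by auto
      ultimately show ?thesis using False unc_par[of y0] parn[of y0] by (auto simp: par' rmv' rf' lkp')
    qed
  next
    case (17 y0)
    show ?case
    proof (cases "y0 = y")
      case True
      have "successively (lnk X') W"
      proof (rule successively_butlast_mono[OF W(4)])
        fix a b assume a: "a \<in> set (butlast W)" "lnk X a b"
        have "a \<in> set C" using a W by (auto simp: butlast_append dest: in_set_butlastD split: option.splits if_splits)
        then show "lnk X' a b" using nC a by (auto simp: lnk_def rf')
      qed
      then show ?thesis using True W(2,3,5) yn yflds stp_now by (auto simp: tlp' lkp')
    next
      case False
      then have u: "lkd X y0" "\<not> cm X y0" using 17 by (auto simp: lkd')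
      then have "y0 \<noteq> n" using n by auto
      have "successively (lnk X') (tlp X y0)"
      proof (rule successively_butlast_mono)
        show "successively (lnk X) (tlp X y0)" using unc_path[OF u] by simp
        fix a b assume a: "a \<in> set (butlast (tlp X y0))" "lnk X a b"
        have "a \<in> set (chn X y0)" using a by (auto simp: tlp_def butlast_append dest: in_set_butlastD split: option.splits if_splits)
        then show "lnk X' a b" using nchn[OF u] a by (auto simp: lnk_def rf')
      qed
      then show ?thesis using unc_path[OF u] False \<open>y0 \<noteq> n\<close> by (simp add: tlp' lkp')
    qed
  next
    case (18 y0 a)
    show ?case
    proof (cases "y0 = y")
      case True then show ?thesis using rmvD[of a y] ly by (auto simp: rmv' chn')
    next
      case False
      then have u: "lkd X y0" "\<not> cm X y0" using 18 by (auto simp: lkd')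
      show ?thesis using unc_rmv[OF u, of a] False rW CW by (auto simp: rmv' chn')
    qed
  next
    case (19 y0)
    show ?case
    proof (cases "y0 = y")
      case True
      then have "C \<noteq> []" using 19 by (simp add: chn')
      moreover have "a \<noteq> n" if "a \<in> set C" for a using that nC by auto
      ultimately show ?thesis using True C yflds in_set_butlastD[of _ C] by (auto simp: chn' nx')
    next
      case False
      then have u: "lkd X y0" "\<not> cm X y0" "chn X y0 \<noteq> []" using 19 by (auto simp: lkd' chn')
      have "a \<noteq> n" if "a \<in> set (chn X y0)" for a using that nchn[OF u(1,2)] by auto
      then show ?thesis using unc_chn[OF u] False u(3) in_set_butlastD[of _ "chn X y0"] by (auto simp: chn' nx')
    qed
  next
    case (20 n0 p c)
    show ?case
    proof (cases "n0 = n")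
      case True
      then have "c = y" using 20 by (simp add: rf')
      obtain x where x: "wk X p v x" "tile X p n x" using walkP[of n p v] n 20 True by auto
      have "lkd X v" using x(1) nextL[OF cm_lkd[OF n(1)] n(3)] by simp
      then have "wk X' p y x" using x yflds cy by (intro wk.step[of _ y p v]) (auto simp: wk')
      then show ?thesis using x True \<open>c = y\<close> tile'I by auto
    next
      case False
      then have "rf X n0 = Some c" using 20 by (simp add: rf')
      moreover then have "lkd X c" using nextL[of n0 c] 20 cm_lkd by simp
      ultimately show ?thesis using walkP[of n0 p c] 20 wk' tile'I by auto
    qed
  next
    case (21 k p n0 x) then show ?case using tileR[of k p n0 x] tile'I by simp
  next
    case (22 x p) then show ?case using tileN[of x p] by simp
  next
    case (23 y0 x)
    show ?case
    proof (cases "y0 = y")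
      case True
      then have "x = v" using 23 yflds by simp
      then show ?thesis using True cv rv by (auto simp: rmv' split: if_splits)
    next
      case False
      then have l0: "lkd X y0" and p0: "pr X y0 = Some x" using 23 by (auto simp: lkd')
      note pp = prior[OF l0 p0]
      \<comment> \<open>If \<open>y0\<close> were uncommitted, the tile with upper end
        \<open>x\<close> would start at the parent of \<open>y0\<close>; it also starts at
        \<open>n\<close> or in \<open>C\<close>, against \<open>parn\<close>.\<close>
      have "cm X y0" if xC: "x \<in> set C"
      proof (rule ccontr)
        assume nc: "\<not> cm X y0"
        note u = l0 nc
        have xh: "x = hd (tlp X y0)" "tlp X y0 \<noteq> []" using unc_path[OF u] p0 by auto
        have "lkp X y0 \<le> now X" using lk_now[OF l0] by (simp add: order.strict_implies_order)
        then have "tile X (now X) (par X y0) x" using path_tiles[OF u] xh by (cases "tlp X y0") auto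
        moreover obtain c where "c \<in> insert n (set C)" "tile X (now X) c x"
          using path_in[OF tls, of x] CW bl xC by blast
        ultimately show False using parn[OF u] tile_inj by blast
      qed
      then show ?thesis using False pp l0 stp_now[of y0] rmvD[of x] ly by (auto simp: rmv' lkp')
    qed
  qed
  \<comment> \<open>The newly removed nodes get a remover with bound \<open>now X\<close>, hence the
    restriction on \<open>p\<close>.\<close>
  have NR': "p < now X \<Longrightarrow> NR X p a \<Longrightarrow> NR X' p a" for p a
    using rmvD[of a] ly by (auto simp: NR_def rmv' sb')
  have Firm': "Firm X p a b \<Longrightarrow> Firm X' p a b" for p a b
    using NR' tile'I now' unfolding Firm_def HF_def by (auto simp: lkd' par' lkp')
  have Z': "Z X' a b r" if "r < now X" "Z X a b r" for a b r
  proof (cases "cm X a \<and> cm X b")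
    case True then show ?thesis using that Firm' unfolding Z_def by auto
  next
    case False
    \<comment> \<open>The only edge that disappears is the one from \<open>n\<close> to
      \<open>v\<close>; both of its ends are committed, so no assertion of the pointer form relies
      on it.\<close>
    then have "a \<noteq> n" using that n cv unfolding Z_def by auto
    then show ?thesis using that False NR' unfolding Z_def by (auto simp: rf')
  qed
  have RE': "RE X' a c p" if "lkd X c" "RE X a c p" for a c p
  proof (cases "cm X c")
    case True then show ?thesis using that Firm' wk' unfolding RE_def by auto
  next
    case False
    then have "a \<noteq> n" using that n cv unfolding RE_def by auto
    then show ?thesis using that False unfolding RE_def by (auto simp: rf')
  qed
  show se: "sext X X'" unfolding sext_def
    using now' NR' Firm' Z' RE' wk' cm_lkd n ly by (auto simp: lkd' lkp' nx')
  have oth [simp]: "gh X' = gh X" "ht X' = ht X" "mrk X' = mrk X" "lin X' = lin X" "opi X' = opi X" "own X' = own X"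
    by (simp_all add: X')
  have org': "org X' a = (if C = [] \<and> a = y then Some (opi X t) else org X a)" for a by (simp add: X')
  have rC: "a \<in> set C \<Longrightarrow> rmv X a = None" for a using rW W(1) by simp
  have Av: "Aval X' k = Aval X k" for k by (simp add: Aval_def Let_def fun_eq_iff)
  show "hinv X'"
  proof (rule hinv.intro[OF g], rule hinv_axioms.intro, goal_cases)
    case (1 a j)
    show ?case
    proof (cases "C = [] \<and> a = y")
      case True
      then have "j = opi X t" using 1 by (simp add: org')
      moreover have "ht X (opi X t) < now X" using i True is_inv_len h_ht by blast
      ultimately show ?thesis using True i cy by (auto simp: lkd' chn' yflds lkp' fresh_def)
    next
      case False
      then have o: "org X a = Some j" using 1 by (simp only: org' if_False)
      then have "a \<noteq> y" using h_org[OF o] ly by auto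
      then show ?thesis using h_org[OF o] by (simp add: lkd' chn' lkp')
    qed
  next
    case (2 a j a')
    then show ?case using i h_org_inj[of a j a'] by (auto simp: org' fresh_def split: if_splits)
  next
    case (3 z)
    then show ?case using h_ins[of z] by (cases "z = y") (auto simp: lkd' chn' org')
  next
    case (4 a j)
    then have m: "mrk X a = Some j" by simp
    note f = h_mrk[OF m]
    have an: "nx X' a = nx X a" using f n by (auto simp: nx' mf_def)
    have hj: "ht X j < now X" using f is_inv_len h_ht by blast
    show ?case
    proof (cases "a \<in> set C")
      case True
      then show ?thesis using f an hj rC[OF True] cy by (auto simp: lkd' rmv' lkp')
    next
      case False
      moreover have "rmv X a \<noteq> Some y" using rmvD[of a y] ly by auto
      ultimately show ?thesis using f an by (auto simp: lkd' rmv' lkp')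
    qed
  next
    case (5 a j a') then show ?case using h_mrk_inj by simp
  next
    case (6 a) then show ?case using h_mrk_ex[of a] yflds by (auto simp: lkd' nx' unm_def split: if_splits)
  next
    case (7 j) then show ?case using h_ht[of j] now' by auto
  next
    case (8 j j') then show ?case using h_mono by simp
  next
    case (9 j p r) then show ?case using h_lin[of j p r] linok_ext[OF se] sextD(17)[OF se] by simp
  next
    case (10 k) show ?case using h_log[of k] by (simp add: Av upds_def)
  next
    case (11 k) show ?case using h_zero[of k] by (simp add: Av)
  next
    case (12 j j' r) then show ?case using h_match by simp
  qed
  show "C = [] \<Longrightarrow> org X' y = Some (opi X t)" "lkd X' y" by (auto simp: org' lkd')
  show "hext t X X'"
    unfolding hext_def
  proof (intro conjI allI impI)
    fix a j assume "org X a = Some j"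
    moreover then have "a \<noteq> y" using h_org ly by blast
    ultimately show "org X' a = Some j" by (simp add: org')
  next
    fix a assume a: "gm X a \<noteq> None" "lk X a = None" "own X a \<noteq> t"
    then have "a \<noteq> y" "a \<noteq> n" using own n(1) by (auto simp: cm_def lkd_def)
    then show "gm X' a = gm X a" "lk X' a = None" using a by (simp_all add: X')
    next
    fix j assume "\<not> mine X t j" "fresh X j"
    then show "fresh X' j" using i by (auto simp: fresh_def org' split: if_splits)
  qed auto
qed

section \<open>Commits and the linearization of updates\<close>

locale hcommitting = committing X y v X' q + hinv X for X :: "('k::linorder, 'v) gx" and y v X' q
begin

text \<open>One commit settles the insert that created \<open>y\<close> or all removes whose marked
  nodes \<open>y\<close> trims, the latter at one common point. The choice is unambiguous because an
  operation marks at most one node.\<close>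

definition "clin i = (if org X y = Some i then Some (q, RV None)
   else if \<exists>a\<in>set (chn X y). mrk X a = Some i then Some (q, RV (Some (vl X (SOME a. mrk X a = Some i)))) else lin X i)"

definition "X2 = X'\<lparr>lin := clin\<rparr>"

lemma clin_mrk: "mrk X a = Some i \<Longrightarrow> a \<in> set (chn X y) \<Longrightarrow> clin i = Some (q, RV (Some (vl X a)))"
proof -
  assume a: "mrk X a = Some i" "a \<in> set (chn X y)"
  then have "(SOME a. mrk X a = Some i) = a" using h_mrk_inj by blast
  moreover have "org X y \<noteq> Some i" using h_org[of y i] h_mrk[OF a(1)] by auto
  ultimately show ?thesis using a by (auto simp: clin_def)
qed

lemma clin_org: "org X y = Some i \<Longrightarrow> clin i = Some (q, RV None)"
  by (simp add: clin_def)

lemma clin_other: "org X y \<noteq> Some i \<Longrightarrow> (\<And>a. a \<in> set (chn X y) \<Longrightarrow> mrk X a \<noteq> Some i) \<Longrightarrow> clin i = lin X i"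
  by (auto simp: clin_def)

lemma chn_lin: "a \<in> set (chn X y) \<Longrightarrow> mrk X a = Some i \<Longrightarrow> lin X i = None"
  using h_mrk[of a i] unc_rmv[OF ly cy, of a] cy by auto

lemma org_lin: "org X y = Some i \<Longrightarrow> lin X i = None"
  using h_org[of y i] cy by auto

lemma clin_keep: "lin X i = Some x \<Longrightarrow> clin i = Some x"
proof -
  assume l: "lin X i = Some x"
  have "org X y \<noteq> Some i" using l org_lin by auto
  moreover have "mrk X a \<noteq> Some i" if "a \<in> set (chn X y)" for a using l chn_lin[OF that] by auto
  ultimately show ?thesis using clin_other l by simp
qed

lemma X2_core [simp]: "lkd X2 = lkd X" "cm X2 = cm X'" "stp X2 = stp X'" "ky X2 = ky X" "vl X2 = vl X" "nx X2 = nx X"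
  "lkp X2 = lkp X" "chn X2 = chn X" "rmv X2 = rmv X" "org X2 = org X" "mrk X2 = mrk X" "gh X2 = gh X" "ht X2 = ht X"
  "lin X2 = clin" "opi X2 = opi X" "own X2 = own X" "lk X2 = lk X"
  by (auto simp: X2_def fun_eq_iff cm_def ts_def lkd_def ky_def vl_def nx_def lkp_def) (auto simp: X' )

lemma same2: "same X' X2"
  by (rule ginv.same_core[OF ginv']) (simp_all add: X2_def)

lemma ginv2: "ginv X2" and sext2: "sext X X2"
  using same_inv[OF ginv' same2] sext_trans[OF sext'] by auto

lemma Aval2: "Aval X2 k p = Aval X' k p"
  using ginv.Aval_same[OF ginv' same2] .

text \<open>At one point a key is the upper key of only one tile. So the removes that share a stamp
  concern different keys, and their mutual order is immaterial.\<close>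

lemma chn_inj: "a \<in> set (chn X y) \<Longrightarrow> b \<in> set (chn X y) \<Longrightarrow> ky X a = ky X b \<Longrightarrow> a = b"
proof -
  assume ab: "a \<in> set (chn X y)" "b \<in> set (chn X y)" "ky X a = ky X b"
  then have "a \<in> set W" "b \<in> set W" by (auto simp: tlp_def)
  then obtain c d where "tile X (lkp X y) c a" "tile X (lkp X y) d b"
    using path_in[OF tiles[OF order_refl]] by blast
  then show ?thesis using tileD ab(3) by (metis prod.inject)
qed

text \<open>A pointer is never both marked and flagged, and the last node of the chain is
  flagged.\<close>

lemma marked_chn: "a \<in> set (chn X y) \<Longrightarrow> mrk X a \<noteq> None \<longleftrightarrow> a \<in> set (butlast (chn X y))"
proof -
  assume a: "a \<in> set (chn X y)"
  then have ne: "chn X y \<noteq> []" by auto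
  note c = unc_chn[OF ly cy ne]
  have la: "lkd X a" using a unc_y cm_lkd by (auto simp: tlp_def)
  show ?thesis
  proof
    assume "mrk X a \<noteq> None"
    then have "pmark (nx X a)" using h_mrk by blast
    moreover have "\<not> pmark (nx X (last (chn X y)))" using c frozen_cm[of "last (chn X y)"]
      ne unc_y cm_lkd by (auto simp: tlp_def mf_def)
    ultimately show "a \<in> set (butlast (chn X y))" using in_set_last_butlast[OF a] by auto
  next
    assume "a \<in> set (butlast (chn X y))"
    then show "mrk X a \<noteq> None" using c h_mrk_ex la by blast
  qed
qed

lemma upds2: "upds X2 k = upds X k \<union> {(i, q, None, Some (vl X y)) |i. org X y = Some i \<and> ky X y = K k}
   \<union> {(i, q, Some (vl X a), None) |i a. a \<in> set (butlast (chn X y)) \<and> mrk X a = Some i \<and> ky X a = K k}" (is "_ = ?R")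
proof -
  have "(i, p, a, b) \<in> upds X2 k \<longleftrightarrow> (i, p, a, b) \<in> ?R" for i p a b
  proof (cases "org X y = Some i")
    case True
    obtain k' where f: "is_inv (gh X) i" "op_of (gh X) i = Insert k' (vl X y)" "ky X y = K k'" using h_org[OF True] by auto
    have "mrk X c \<noteq> Some i" for c using h_mrk[of c i] f by auto
    then show ?thesis using f True org_lin[OF True] clin_org[OF True] is_inv_len[OF f(1)] by (auto simp: upds_def)
  next
    case no: False
    show ?thesis
    proof (cases "\<exists>c\<in>set (chn X y). mrk X c = Some i")
      case True
      then obtain c where c: "c \<in> set (chn X y)" "mrk X c = Some i" by blast
      obtain k' where f: "is_inv (gh X) i" "op_of (gh X) i = Remove k'" "ky X c = K k'" using h_mrk[OF c(2)] by auto
      have cb: "c \<in> set (butlast (chn X y))" using marked_chn[OF c(1)] c(2) by auto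
      have "mrk X d = Some i \<longleftrightarrow> d = c" for d using h_mrk_inj c by blast
      then show ?thesis using f no chn_lin[OF c] clin_mrk[OF c(2,1)] is_inv_len[OF f(1)] cb by (auto simp: upds_def)
    next
      case False
      then have "clin i = lin X i" using clin_other no by blast
      moreover have "\<not> (a' \<in> set (butlast (chn X y)) \<and> mrk X a' = Some i)" for a'
        using False in_set_butlastD by fastforce
      ultimately show ?thesis using no by (auto simp: upds_def)
    qed
  qed
  then show ?thesis by (auto simp: set_eq_iff)
qed

text \<open>By \<open>path_tiles\<close> the affected key has a constant value at all points from
  the link of \<open>y\<close> on, which provides \<open>S\<close> for \<open>logk_extend\<close>.
  So \<open>q\<close> is the latest update of this key, even if other operations already have points
  after it.\<close>

lemma log2: "logk (Aval X2 k) (upds X2 k)"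
proof (cases "chn X y = [] \<and> ky X y = K k")
  case True
  then obtain i where i: "org X y = Some i" using h_ins[OF ly cy] by auto
  have "upds X2 k = insert (i, q, None, Some (vl X y)) (upds X k)"
    using True i by (auto simp: upds2)
  moreover have "logk (Aval X2 k) (insert (i, q, None, Some (vl X y)) (upds X k))"
  proof (rule logk_extend[OF h_log link_less])
    show "Aval X k p = None" if "lkp X y \<le> p" for p using Aval_ins(2) True that by blast
    show "Aval X2 k p = (if q \<le> p then Some (vl X y) else Aval X k p)" for p
      using Aval_ins(1)[of k p] Aval_lt[of p k] True by (simp add: Aval2)
  qed simp
  ultimately show ?thesis by simp
next
  case no: False
  have no_org: "\<not> (org X y = Some i \<and> ky X y = K k)" for i using h_org[of y i] no by auto
  show ?thesis
  proof (cases "\<exists>a\<in>set (butlast (chn X y)). ky X a = K k")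
    case True
    then obtain a where a: "a \<in> set (butlast (chn X y))" "ky X a = K k" by blast
    have ac: "a \<in> set (chn X y)" using in_set_butlastD[OF a(1)] .
    then obtain i where i: "mrk X a = Some i" using marked_chn a by auto
    have un: "b = a" if "b \<in> set (butlast (chn X y))" "ky X b = K k" for b
      using chn_inj[OF ac in_set_butlastD[OF that(1)]] that a by auto
    have 1: "{(i, q, Some (vl X a), None) |i a. a \<in> set (butlast (chn X y)) \<and> mrk X a = Some i \<and> ky X a = K k} =
      {(i, q, Some (vl X a), None :: 'v option)}"
      using i a by (auto dest: un)
    have 2: "{(i, q, None, Some (vl X y)) |i. org X y = Some i \<and> ky X y = K k} = {}"
      using no_org by auto
    have "upds X2 k = insert (i, q, Some (vl X a), None) (upds X k)"
      unfolding upds2 1 2 by simp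
    moreover have "logk (Aval X2 k) (insert (i, q, Some (vl X a), None) (upds X k))"
    proof (rule logk_extend[OF h_log link_less])
      show "Aval X k p = Some (vl X a)" if "lkp X y \<le> p" for p using Aval_chn(2)[OF a] that by blast
      show "Aval X2 k p = (if q \<le> p then None else Aval X k p)" for p
        using Aval_chn(1)[OF a, of p] Aval_lt[of p k] by (simp add: Aval2)
    qed simp
    ultimately show ?thesis by simp
  next
    case False
    have "upds X2 k = upds X k" using no_org False unfolding upds2 by auto
    moreover have "Aval X2 k = Aval X k" using Aval_other[OF no False] by (simp add: Aval2 fun_eq_iff)
    ultimately show ?thesis using h_log by simp
  qed
qed

lemma hinv2: "hinv X2"
proof (rule hinv.intro[OF ginv2], rule hinv_axioms.intro, goal_cases)
  case (1 a i)
  then have o: "org X a = Some i" by simp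
  note f = h_org[OF o]
  show ?case
  proof (cases "a = y")
    case True then show ?thesis using f o clin_org by simp
  next
    case False
    have "clin i = lin X i"
    proof (rule clin_other)
      show "org X y \<noteq> Some i" using h_org_inj[OF o] False by blast
      show "mrk X c \<noteq> Some i" for c using h_mrk[of c i] f by auto
    qed
    then show ?thesis using f False by simp
  qed
next
  case (2 a i a') then show ?case using h_org_inj by simp
next
  case (3 z) then show ?case using h_ins by simp
next
  case (4 a i)
  then have m: "mrk X a = Some i" by simp
  note f = h_mrk[OF m]
  show ?case
  proof (cases "a \<in> set (chn X y)")
    case True
    then have "rmv X a = Some y" using unc_rmv[OF ly cy] by simp
    then show ?thesis using f clin_mrk[OF m True] by simp
  next
    case False
    then have r: "rmv X a \<noteq> Some y" using unc_rmv[OF ly cy] by simp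
    have "clin i = lin X i"
    proof (rule clin_other)
      show "org X y \<noteq> Some i" using h_org[of y i] f by auto
      show "mrk X c \<noteq> Some i" if "c \<in> set (chn X y)" for c using h_mrk_inj[OF m, of c] that False by auto
    qed
    then show ?thesis using f r cm_not_y by auto
  qed
next
  case (5 a i a') then show ?case using h_mrk_inj by simp
next
  case (6 a) then show ?case using h_mrk_ex by simp
next
  case (7 j) then show ?case using h_ht[of j] sextD(17)[OF sext2] by simp
next
  case (8 j j') then show ?case using h_mono by simp
next
  case (9 i p r)
  have qn: "q < now X2" using stamp_le_now by (simp add: now_def X2_def)
  show ?case
  proof (cases "org X y = Some i")
    case True
    note f = h_org[OF True]
    have "p = q" "r = RV None" using 9 clin_org[OF True] by auto
    then show ?thesis using f link_less qn by (auto simp: linok_def)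
  next
    case no: False
    show ?thesis
    proof (cases "\<exists>c\<in>set (chn X y). mrk X c = Some i")
      case True
      then obtain c where c: "c \<in> set (chn X y)" "mrk X c = Some i" by blast
      note f = h_mrk[OF c(2)]
      have "rmv X c = Some y" using unc_rmv[OF ly cy] c by simp
      then have "ht X i < lkp X y" using f by blast
      moreover have "p = q" "r = RV (Some (vl X c))" using 9 clin_mrk[OF c(2,1)] by auto
      ultimately show ?thesis using f link_less qn by (auto simp: linok_def)
    next
      case False
      then have "lin X i = Some (p, r)" using 9 clin_other no by simp
      then show ?thesis using h_lin[of i p r] linok_ext[OF sext2] sextD(17)[OF sext2] by simp
    qed
  qed
next
  case (10 k) show ?case by (rule log2)
next
  case (11 k)
  have "\<not> q \<le> Pt 0 0" using link_less by (auto simp: less_pt_def less_eq_pt_def)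
  then show ?case using h_zero[of k] Aval_lt by (simp add: Aval2)
next
  case (12 i j r) then show ?case using h_match[of i j r] clin_keep by auto
qed

lemma hext2: "hext t X X2"
  unfolding hext_def
proof (intro conjI allI impI)
  fix i assume f: "fresh X i"
  then have "clin i = lin X i" by (auto simp: clin_def fresh_def)
  then show "fresh X2 i" using f by (simp add: fresh_def)
next
  fix a assume a: "gm X a \<noteq> None" "lk X a = None"
  then have "a \<noteq> y" using ly by (auto simp: lkd_def)
  then have "gm X' a = gm X a" by (simp add: X')
  moreover have "gm X2 a = gm X' a" by (simp add: X2_def)
  ultimately show "gm X2 a = gm X a" by simp
qed (use clin_keep in auto)

end

section \<open>Thread invariant\<close>

text \<open>Assertions about the local state l of a thread, with current operation i: CF about the operation
  itself; PB, VB and FL about the loop of find (the edge from pred to v was read at time r); FC and PF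
  about find with adjacent pred and curr; TP and TB about trim, where ms are the marked nodes from
  the victim to tcurr; QB, COV, COV2, SB and SW about the two loops of a range query, which knows
  the map at its point prq for all keys below, respectively up to, the key of curr.\<close>

definition "prq l = Pt (Suc (rts l)) 0"
definition "act X t i \<longleftrightarrow> mine X t i \<and> (\<forall>k>i. k < length (gh X) \<longrightarrow> ev_thr (gh X ! k) \<noteq> t)"
definition "RQ X i l \<longleftrightarrow> 2 \<le> rts l \<and> ht X i < prq l \<and> Suc (rts l) \<le> gG X"
definition "CF X i l = (case caller l of
    CIns \<Rightarrow> op_of (gh X) i = Insert (kk l) (vv l) \<and> fkey l = K (kk l) \<and> fresh X i
  | CRem1 \<Rightarrow> op_of (gh X) i = Remove (kk l) \<and> fkey l = K (kk l) \<and> fresh X i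
  | CRem2 \<Rightarrow> op_of (gh X) i = Remove (kk l) \<and> fkey l = K (kk l) \<and> mrk X (rcurr l) = Some i
  | CCon \<Rightarrow> op_of (gh X) i = Contains (kk l) \<and> fkey l = K (kk l) \<and> fresh X i
  | CRQ \<Rightarrow> op_of (gh X) i = RangeQuery (lo l) (hi l) \<and> fresh X i \<and> arr l = [] \<and> RQ X i l)"
lemma CF_upd [simp]:
  "CF X i (l\<lparr>pc := x0\<rparr>) = CF X i l"
  "CF X i (l\<lparr>pred := x1\<rparr>) = CF X i l"
  "CF X i (l\<lparr>curr := x2\<rparr>) = CF X i l"
  "CF X i (l\<lparr>predNext := x3\<rparr>) = CF X i l"
  "CF X i (l\<lparr>tsv := x4\<rparr>) = CF X i l"
  "CF X i (l\<lparr>tvictim := x5\<rparr>) = CF X i l"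
  "CF X i (l\<lparr>tcurr := x6\<rparr>) = CF X i l"
  "CF X i (l\<lparr>tp := x7\<rparr>) = CF X i l"
  "CF X i (l\<lparr>tsucc := x8\<rparr>) = CF X i l"
  "CF X i (l\<lparr>tnew := x9\<rparr>) = CF X i l"
  "CF X i (l\<lparr>newN := x10\<rparr>) = CF X i l"
  "CF X i (l\<lparr>currKey := x11\<rparr>) = CF X i l"
  "CF X i (l\<lparr>succ := x12\<rparr>) = CF X i l"
  "CF X i (l\<lparr>retv := x13\<rparr>) = CF X i l"
  by (simp_all add: CF_def RQ_def prq_def cong: callr.case_cong)

definition "PB X l \<longleftrightarrow> lkd X (pred l) \<and> (caller l \<noteq> CRQ \<longrightarrow> ky X (pred l) < fkey l)"
definition "VB X i l v r \<longleftrightarrow> predNext l = unm v \<and> lkd X v \<and> v \<noteq> head \<and> ht X i < r \<and> r < now X \<and>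
   (caller l = CRQ \<longrightarrow> prq l \<le> r) \<and> (caller l = CRem2 \<longrightarrow> stp X (rcurr l) \<le> r) \<and>
   NR X r (pred l) \<and> Z X (pred l) v r"
definition "NC l \<longleftrightarrow> (caller l = CRem2 \<longrightarrow> curr l \<noteq> rcurr l)"
definition "tsok X a v \<longleftrightarrow> v \<le> gG X \<and> 2 \<le> v \<and> lkd X a \<and> (\<not> cm X a \<longrightarrow> pfst (lkp X a) \<le> v)"
definition "TP X l ms \<longleftrightarrow> hd (ms @ [tcurr l]) = tvictim l \<and> successively (lnk X) (ms @ [tcurr l]) \<and>
   (\<forall>a\<in>set ms. lkd X a \<and> pmark (nx X a))"
definition "TB X i l \<longleftrightarrow> CF X i l \<and> PB X l \<and> cm X (pred l) \<and> lkd X (tcurr l) \<and> tcurr l \<noteq> head \<and> (\<exists>ms. TP X l ms)"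
definition "FL X i l \<longleftrightarrow> CF X i l \<and> PB X l \<and> lkd X (curr l) \<and> (\<exists>v r. VB X i l v r)"
definition "FC X i l \<longleftrightarrow> CF X i l \<and> PB X l \<and> lkd X (curr l) \<and> cm X (pred l) \<and> (\<exists>r. VB X i l (curr l) r)"
definition "PF X i l \<longleftrightarrow> CF X i l \<and> PB X l \<and> cm X (pred l) \<and> cm X (curr l) \<and> NC l \<and> fkey l \<le> ky X (curr l) \<and>
   (caller l = CRQ \<longrightarrow> NR X (prq l) (pred l)) \<and>
   (\<exists>p. ht X i < p \<and> (caller l = CRem2 \<longrightarrow> stp X (rcurr l) \<le> p) \<and> Firm X p (pred l) (curr l))"
definition "QB X i l \<longleftrightarrow> op_of (gh X) i = RangeQuery (lo l) (hi l) \<and> fresh X i \<and> RQ X i l \<and> aliveF X (prq l) (curr l)"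
definition "COV X l \<longleftrightarrow> (\<forall>k. lo l \<le> k \<longrightarrow> K k < ky X (curr l) \<longrightarrow> know X k (prq l) (map_of (arr l) k)) \<and>
   distinct (map fst (arr l)) \<and> (\<forall>(k, v)\<in>set (arr l). lo l \<le> k \<and> k \<le> hi l \<and> K k < ky X (curr l))"
definition "COV2 X l \<longleftrightarrow> (\<forall>k. lo l \<le> k \<longrightarrow> K k \<le> ky X (curr l) \<longrightarrow> know X k (prq l) (map_of (arr l) k)) \<and>
   distinct (map fst (arr l)) \<and> (\<forall>(k, v)\<in>set (arr l). lo l \<le> k \<and> k \<le> hi l \<and> K k \<le> ky X (curr l))"
definition "SB X l \<longleftrightarrow> lkd X (succ l) \<and> RE X (curr l) (succ l) (prq l)"
definition "SW X l \<longleftrightarrow> cm X (succ l) \<and> (\<exists>x. wk X (prq l) (succ l) x \<and> Firm X (prq l) (curr l) x)"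
definition "priv X t a nd \<longleftrightarrow> gm X a = Some nd \<and> lk X a = None \<and> own X a = t"

lemma local_upd [simp]:
  "prq (l\<lparr>pc := x_pc\<rparr>) = prq l" "prq (l\<lparr>tsv := x_tsv\<rparr>) = prq l" "prq (l\<lparr>pred := x_pred\<rparr>) = prq l" "prq (l\<lparr>curr := x_curr\<rparr>) = prq l" "prq (l\<lparr>arr := x_arr\<rparr>) = prq l" "prq (l\<lparr>succ := x_succ\<rparr>) = prq l"
  "PB X (l\<lparr>pc := x_pc\<rparr>) = PB X l" "PB X (l\<lparr>tsv := x_tsv\<rparr>) = PB X l" "PB X (l\<lparr>curr := x_curr\<rparr>) = PB X l" "PB X (l\<lparr>predNext := x_predNext\<rparr>) = PB X l" "PB X (l\<lparr>tvictim := x_tvictim\<rparr>) = PB X l" "PB X (l\<lparr>tcurr := x_tcurr\<rparr>) = PB X l" "PB X (l\<lparr>tp := x_tp\<rparr>) = PB X l" "PB X (l\<lparr>tsucc := x_tsucc\<rparr>) = PB X l" "PB X (l\<lparr>tnew := x_tnew\<rparr>) = PB X l"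
  "VB X i (l\<lparr>pc := x_pc\<rparr>) v r = VB X i l v r" "VB X i (l\<lparr>tsv := x_tsv\<rparr>) v r = VB X i l v r" "VB X i (l\<lparr>curr := x_curr\<rparr>) v r = VB X i l v r"
  "NC (l\<lparr>pc := x_pc\<rparr>) = NC l" "NC (l\<lparr>tsv := x_tsv\<rparr>) = NC l"
  "TP X (l\<lparr>pc := x_pc\<rparr>) ms = TP X l ms" "TP X (l\<lparr>tsv := x_tsv\<rparr>) ms = TP X l ms" "TP X (l\<lparr>tp := x_tp\<rparr>) ms = TP X l ms" "TP X (l\<lparr>tsucc := x_tsucc\<rparr>) ms = TP X l ms" "TP X (l\<lparr>tnew := x_tnew\<rparr>) ms = TP X l ms"
  "TB X i (l\<lparr>pc := x_pc\<rparr>) = TB X i l" "TB X i (l\<lparr>tsv := x_tsv\<rparr>) = TB X i l" "TB X i (l\<lparr>tp := x_tp\<rparr>) = TB X i l" "TB X i (l\<lparr>tsucc := x_tsucc\<rparr>) = TB X i l" "TB X i (l\<lparr>tnew := x_tnew\<rparr>) = TB X i l"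
  "FL X i (l\<lparr>pc := x_pc\<rparr>) = FL X i l" "FL X i (l\<lparr>tsv := x_tsv\<rparr>) = FL X i l"
  "FC X i (l\<lparr>pc := x_pc\<rparr>) = FC X i l" "FC X i (l\<lparr>tsv := x_tsv\<rparr>) = FC X i l"
  "PF X i (l\<lparr>pc := x_pc\<rparr>) = PF X i l"
  "QB X i (l\<lparr>pc := x_pc\<rparr>) = QB X i l" "QB X i (l\<lparr>tsv := x_tsv\<rparr>) = QB X i l" "QB X i (l\<lparr>succ := x_succ\<rparr>) = QB X i l" "QB X i (l\<lparr>arr := x_arr\<rparr>) = QB X i l"
  "COV X (l\<lparr>pc := x_pc\<rparr>) = COV X l"
  "COV2 X (l\<lparr>pc := x_pc\<rparr>) = COV2 X l" "COV2 X (l\<lparr>tsv := x_tsv\<rparr>) = COV2 X l" "COV2 X (l\<lparr>succ := x_succ\<rparr>) = COV2 X l"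
  "SB X (l\<lparr>pc := x_pc\<rparr>) = SB X l" "SB X (l\<lparr>tsv := x_tsv\<rparr>) = SB X l" "SB X (l\<lparr>arr := x_arr\<rparr>) = SB X l"
  "SW X (l\<lparr>pc := x_pc\<rparr>) = SW X l"
  by (simp_all add: prq_def PB_def VB_def NC_def TP_def TB_def FL_def FC_def PF_def QB_def RQ_def COV_def COV2_def SB_def SW_def)

definition TI0 :: "('k::linorder, 'v) gx \<Rightarrow> nat \<Rightarrow> nat \<Rightarrow> ('k, 'v) lst \<Rightarrow> bool" where
  "TI0 X t i l = (case pc l of
    Idle \<Rightarrow> True
  | Ret \<Rightarrow> \<exists>p. lin X i = Some (p, retv l)
  | F_retry \<Rightarrow> CF X i l
  | F_loop1 \<Rightarrow> FL X i l
  | F_loop2 \<Rightarrow> FL X i l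
  | F_loop3 \<Rightarrow> FL X i l
  | F_cmp \<Rightarrow> FL X i l \<and> NC l
  | F_adv \<Rightarrow> CF X i l \<and> PB X l
  | F_ts1 \<Rightarrow> FL X i l \<and> NC l \<and> fkey l \<le> ky X (curr l)
  | F_ts2 \<Rightarrow> FL X i l \<and> NC l \<and> fkey l \<le> ky X (curr l) \<and> tsok X (pred l) (tsv l)
  | F_chk \<Rightarrow> FL X i l \<and> NC l \<and> fkey l \<le> ky X (curr l) \<and> cm X (pred l)
  | F_aftertrim \<Rightarrow> CF X i l \<and> PB X l \<and> cm X (pred l)
  | F_recheck \<Rightarrow> FC X i l
  | F_cts1 \<Rightarrow> FC X i l \<and> NC l \<and> fkey l \<le> ky X (curr l)
  | F_cts2 \<Rightarrow> FC X i l \<and> NC l \<and> fkey l \<le> ky X (curr l) \<and> tsok X (curr l) (tsv l)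
  | T_loop \<Rightarrow> TB X i l
  | T_loop2 \<Rightarrow> TB X i l \<and> pmark (nx X (tcurr l))
  | T_ts1 \<Rightarrow> TB X i l
  | T_ts2 \<Rightarrow> TB X i l \<and> tsok X (tcurr l) (tsv l)
  | T_flag1 \<Rightarrow> TB X i l \<and> cm X (tcurr l)
  | T_flag2 \<Rightarrow> TB X i l \<and> cm X (tcurr l) \<and> \<not> mf (tp l)
  | T_chkflag \<Rightarrow> TB X i l
  | T_succ \<Rightarrow> TB X i l \<and> pflag (nx X (tcurr l))
  | T_sts1 \<Rightarrow> TB X i l \<and> pflag (nx X (tcurr l)) \<and> tsucc l = rf X (tcurr l) \<and> rf X (tcurr l) \<noteq> None
  | T_sts2 \<Rightarrow> TB X i l \<and> pflag (nx X (tcurr l)) \<and> tsucc l = rf X (tcurr l) \<and> tsok X (the (tsucc l)) (tsv l)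
  | T_alloc \<Rightarrow> TB X i l \<and> pflag (nx X (tcurr l)) \<and> tsucc l = rf X (tcurr l) \<and> (\<forall>a. tsucc l = Some a \<longrightarrow> cm X a)
  | T_cas \<Rightarrow> TB X i l \<and> pflag (nx X (tcurr l)) \<and> tsucc l = rf X (tcurr l) \<and> (\<forall>a. tsucc l = Some a \<longrightarrow> cm X a) \<and>
      priv X t (tnew l) \<lparr>nts = BOT, nkey = ky X (tcurr l), nval = vl X (tcurr l), nnext = Ptr (tsucc l) False False,
                nprior = Some (tvictim l)\<rparr>
  | T_nts1 \<Rightarrow> CF X i l \<and> PB X l \<and> cm X (pred l) \<and> lkd X (tnew l)
  | T_nts2 \<Rightarrow> CF X i l \<and> PB X l \<and> cm X (pred l) \<and> tsok X (tnew l) (tsv l)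
  | I_after \<Rightarrow> PF X i l \<and> caller l = CIns
  | I_cas \<Rightarrow> caller l = CIns \<and> CF X i l \<and> cm X (pred l) \<and> cm X (curr l) \<and> ky X (pred l) < K (kk l) \<and> K (kk l) < ky X (curr l) \<and>
      priv X t (newN l) \<lparr>nts = BOT, nkey = K (kk l), nval = vv l, nnext = unm (curr l), nprior = Some (curr l)\<rparr>
  | I_ts1 \<Rightarrow> lkd X (newN l) \<and> org X (newN l) = Some i
  | I_ts2 \<Rightarrow> tsok X (newN l) (tsv l) \<and> org X (newN l) = Some i
  | R_after \<Rightarrow> PF X i l \<and> caller l = CRem1
  | R_mark1 \<Rightarrow> caller l = CRem1 \<and> CF X i l \<and> cm X (rcurr l) \<and> ky X (rcurr l) = K (kk l)
  | R_mark2 \<Rightarrow> caller l = CRem1 \<and> CF X i l \<and> cm X (rcurr l) \<and> ky X (rcurr l) = K (kk l) \<and> \<not> mf (tp l)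
  | R_done \<Rightarrow> PF X i l \<and> caller l = CRem2
  | C_after \<Rightarrow> PF X i l \<and> caller l = CCon
  | Q_start \<Rightarrow> op_of (gh X) i = RangeQuery (lo l) (hi l) \<and> fresh X i \<and> arr l = []
  | Q_after \<Rightarrow> PF X i l \<and> caller l = CRQ
  | Q_w1 \<Rightarrow> caller l = CRQ \<and> CF X i l \<and> cm X (pred l) \<and> NR X (prq l) (pred l)
  | Q_chk \<Rightarrow> caller l = CRQ \<and> CF X i l \<and> aliveF X (prq l) (pred l)
  | Q_rts \<Rightarrow> caller l = CRQ \<and> CF X i l
  | Q_s1 \<Rightarrow> QB X i l \<and> COV X l \<and> arr l = []
  | Q_sts1 \<Rightarrow> QB X i l \<and> arr l = [] \<and> ky X (curr l) < K (lo l) \<and> SB X l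
  | Q_sts2 \<Rightarrow> QB X i l \<and> arr l = [] \<and> ky X (curr l) < K (lo l) \<and> SB X l \<and> tsok X (succ l) (tsv l)
  | Q_s3 \<Rightarrow> QB X i l \<and> arr l = [] \<and> ky X (curr l) < K (lo l) \<and> SW X l
  | Q_c1 \<Rightarrow> QB X i l \<and> COV X l \<and> K (lo l) \<le> ky X (curr l)
  | Q_cts1 \<Rightarrow> QB X i l \<and> COV2 X l \<and> K (lo l) \<le> ky X (curr l) \<and> SB X l
  | Q_cts2 \<Rightarrow> QB X i l \<and> COV2 X l \<and> K (lo l) \<le> ky X (curr l) \<and> SB X l \<and> tsok X (succ l) (tsv l)
  | Q_c3 \<Rightarrow> QB X i l \<and> COV2 X l \<and> K (lo l) \<le> ky X (curr l) \<and> SW X l)"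

definition "TI X t l \<longleftrightarrow> (pc l \<noteq> Idle \<longrightarrow> act X t (opi X t)) \<and> TI0 X t (opi X t) l"

text \<open>Separate from \<open>keepF\<close> because the linking step of \<open>t\<close> itself
  satisfies only this part: the new node is no longer private, and an insert is no longer
  fresh.\<close>

definition "keepH t X X' \<longleftrightarrow> opi X' t = opi X t \<and>
  (\<exists>es. gh X' = gh X @ es \<and> (\<forall>e\<in>set es. ev_thr e \<noteq> t)) \<and> (\<forall>j<length (gh X). ht X' j = ht X j) \<and>
  (\<forall>i x. lin X i = Some x \<longrightarrow> lin X' i = Some x) \<and>
  (\<forall>a i. org X a = Some i \<longrightarrow> org X' a = Some i) \<and>
  (\<forall>a i. mrk X a = Some i \<longrightarrow> mrk X' a = Some i)"

definition "keepF t X X' \<longleftrightarrow> (mine X t (opi X t) \<longrightarrow> fresh X (opi X t) \<longrightarrow> fresh X' (opi X t)) \<and>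
  (\<forall>a nd. priv X t a nd \<longrightarrow> priv X' t a nd)"

lemma keep_other: "hext t' X X' \<Longrightarrow> t \<noteq> t' \<Longrightarrow> keepH t X X' \<and> keepF t X X'"
  unfolding keepH_def keepF_def hext_def priv_def mine_def by auto

section \<open>Stability of the thread assertions\<close>

locale ext = hinv X for X :: "('k::linorder, 'v) gx" +
  fixes X' :: "('k, 'v) gx" and t
  assumes se: "sext X X'" and kH: "keepH t X X'"
begin

abbreviation "i \<equiv> opi X t"

lemmas sD = sextD[OF se]

lemma act': "act X t i \<Longrightarrow> act X' t i"
proof -
  assume a: "act X t i"
  obtain es where es: "gh X' = gh X @ es" "\<forall>e\<in>set es. ev_thr e \<noteq> t" using kH by (auto simp: keepH_def)
  have "ev_thr (gh X' ! k) \<noteq> t" if "k > i" "k < length (gh X')" for k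
  proof (cases "k < length (gh X)")
    case True then show ?thesis using a that es by (auto simp: act_def nth_append)
  next
    case False
    then have "gh X' ! k \<in> set es" using that es by (auto simp: nth_append)
    then show ?thesis using es by blast
  qed
  then show ?thesis using a es by (auto simp: act_def mine_def nth_append)
qed

lemma op': "act X t i \<Longrightarrow> op_of (gh X') i = op_of (gh X) i"
  using kH by (auto simp: keepH_def act_def mine_def)

lemma ht': "act X t i \<Longrightarrow> ht X' i = ht X i"
  using kH by (auto simp: keepH_def act_def mine_def)

lemma RQ': "act X t i \<Longrightarrow> RQ X i l \<Longrightarrow> RQ X' i l"
  using ht' sD(2) by (auto simp: RQ_def)

lemma RQ_now: "RQ X i l \<Longrightarrow> prq l < now X"
  using tm_pos by (auto simp: RQ_def prq_def now_def)

lemma CF': "act X t i \<Longrightarrow> (fresh X i \<Longrightarrow> fresh X' i) \<Longrightarrow> CF X i l \<Longrightarrow> CF X' i l"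
  using op' RQ' kH unfolding CF_def keepH_def by (cases "caller l") auto

lemma CF_rem2: "CF X i l \<Longrightarrow> caller l = CRem2 \<Longrightarrow> cm X (rcurr l)"
  using h_mrk[of "rcurr l" i] frozen_cm by (auto simp: CF_def mf_def)

lemma PB': "PB X l \<Longrightarrow> PB X' l"
  using sD(3,5) by (auto simp: PB_def)

lemma VB': "act X t i \<Longrightarrow> CF X i l \<Longrightarrow> PB X l \<Longrightarrow> VB X i l v r \<Longrightarrow> VB X' i l v r"
proof -
  assume h: "act X t i" "CF X i l" "PB X l" "VB X i l v r"
  have "caller l = CRem2 \<longrightarrow> stp X' (rcurr l) = stp X (rcurr l)" using CF_rem2 h sD(10) by blast
  then show ?thesis using h sD(3,12,14,17) ht' by (auto simp: VB_def PB_def)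
qed

lemma tsok': "tsok X a v \<Longrightarrow> tsok X' a v"
  using sD(2,3,4,9) by (fastforce simp: tsok_def)

lemma froz: "lkd X a \<Longrightarrow> pmark (nx X a) \<Longrightarrow> nx X' a = nx X a" "lkd X a \<Longrightarrow> pflag (nx X a) \<Longrightarrow> nx X' a = nx X a"
  using sD(8) by (auto simp: mf_def)

lemma TP': "TP X l ms \<Longrightarrow> TP X' l ms"
proof -
  assume tp: "TP X l ms"
  have "successively (lnk X') (ms @ [tcurr l])"
  proof (rule successively_butlast_mono)
    show "successively (lnk X) (ms @ [tcurr l])" using tp by (simp add: TP_def)
    show "lnk X' a b" if "a \<in> set (butlast (ms @ [tcurr l]))" "lnk X a b" for a b
      using that tp froz[of a] by (auto simp: TP_def lnk_def rf_def)
  qed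
  then show ?thesis using tp froz sD(3) by (auto simp: TP_def)
qed

lemma TB': "CF X' i l \<Longrightarrow> TB X i l \<Longrightarrow> TB X' i l"
  using PB' TP' sD(3,9) unfolding TB_def by blast

lemma FL': "act X t i \<Longrightarrow> CF X' i l \<Longrightarrow> FL X i l \<Longrightarrow> FL X' i l"
  using PB' VB' sD(3) unfolding FL_def by blast

lemma FC': "act X t i \<Longrightarrow> CF X' i l \<Longrightarrow> FC X i l \<Longrightarrow> FC X' i l"
  using PB' VB' sD(3,9) unfolding FC_def by blast

lemma PF': "act X t i \<Longrightarrow> CF X' i l \<Longrightarrow> PF X i l \<Longrightarrow> PF X' i l"
proof -
  assume a: "act X t i" "CF X' i l" "PF X i l"
  obtain p where p: "ht X i < p" "caller l = CRem2 \<longrightarrow> stp X (rcurr l) \<le> p" "Firm X p (pred l) (curr l)"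
    using a by (auto simp: PF_def)
  have CF: "CF X i l" using a by (simp add: PF_def)
  have "caller l = CRem2 \<longrightarrow> stp X' (rcurr l) \<le> p" using p CF_rem2[OF CF] sD(10) by auto
  moreover have "caller l = CRQ \<longrightarrow> NR X' (prq l) (pred l)"
    using a CF RQ_now[of l] sD(12) by (auto simp: PF_def CF_def)
  moreover have "ky X' (curr l) = ky X (curr l)" using a sD(5) cm_lkd by (auto simp: PF_def)
  ultimately show ?thesis using a p sD(13) sD(9) PB' ht' unfolding PF_def by metis
qed

lemma QB': "act X t i \<Longrightarrow> (fresh X i \<Longrightarrow> fresh X' i) \<Longrightarrow> QB X i l \<Longrightarrow> QB X' i l"
  using op' RQ' RQ_now sD(18) unfolding QB_def by auto

lemma COV': "QB X i l \<Longrightarrow> COV X l \<Longrightarrow> COV X' l"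
  using know_ext[OF se] sD(5) cm_lkd unfolding COV_def QB_def aliveF_def by auto

lemma COV2': "QB X i l \<Longrightarrow> COV2 X l \<Longrightarrow> COV2 X' l"
  using know_ext[OF se] sD(5) cm_lkd unfolding COV2_def QB_def aliveF_def by auto

lemma SB': "QB X i l \<Longrightarrow> SB X l \<Longrightarrow> SB X' l"
  using sD(3,15) RQ_now unfolding SB_def QB_def by blast

lemma SW': "SW X l \<Longrightarrow> SW X' l"
  using sD(9,13,16) unfolding SW_def by blast

lemma kyQ: "QB X i l \<Longrightarrow> ky X' (curr l) = ky X (curr l)"
  using sD(5) cm_lkd unfolding QB_def aliveF_def by auto

lemma TI0':
  assumes F: "keepF t X X'" and a: "act X t i" and T: "TI0 X t i l"
  shows "TI0 X' t i l"
proof -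
  have fr: "fresh X i \<Longrightarrow> fresh X' i" using F a by (auto simp: keepF_def act_def)
  have pv: "priv X t b nd \<Longrightarrow> priv X' t b nd" for b nd using F by (simp add: keepF_def)
  note CF = CF'[OF a fr]
  note QB = QB'[OF a fr]
  have CFL: "FL X i l \<Longrightarrow> CF X i l" and CFC: "FC X i l \<Longrightarrow> CF X i l" and CTB: "TB X i l \<Longrightarrow> CF X i l"
    and CPF: "PF X i l \<Longrightarrow> CF X i l" by (auto simp: FL_def FC_def TB_def PF_def)
  have FL: "FL X i l \<Longrightarrow> FL X' i l" using FL'[OF a] CF CFL by blast
  have FC: "FC X i l \<Longrightarrow> FC X' i l" using FC'[OF a] CF CFC by blast
  have TB: "TB X i l \<Longrightarrow> TB X' i l" using TB' CF CTB by blast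
  have PF: "PF X i l \<Longrightarrow> PF X' i l" using PF'[OF a] CF CPF by blast
  have kc: "FL X i l \<or> FC X i l \<Longrightarrow> ky X' (curr l) = ky X (curr l)" using sD(5) by (auto simp: FL_def FC_def)
  have kt: "TB X i l \<Longrightarrow> ky X' (tcurr l) = ky X (tcurr l) \<and> vl X' (tcurr l) = vl X (tcurr l)" using sD(5,6) by (auto simp: TB_def)
  have nt: "TB X i l \<Longrightarrow> pmark (nx X (tcurr l)) \<or> pflag (nx X (tcurr l)) \<Longrightarrow> nx X' (tcurr l) = nx X (tcurr l)"
    using froz by (auto simp: TB_def)
  have rt: "TB X i l \<Longrightarrow> pflag (nx X (tcurr l)) \<Longrightarrow> rf X' (tcurr l) = rf X (tcurr l)" using nt by (simp add: rf_def)
  have kcm: "cm X b \<Longrightarrow> ky X' b = ky X b" for b using sD(5) cm_lkd by blast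
  have li: "lin X i = Some x \<Longrightarrow> lin X' i = Some x" for x using kH unfolding keepH_def by blast
  have og: "org X b = Some i \<Longrightarrow> org X' b = Some i" for b using kH by (auto simp: keepH_def)
  have nrq: "caller l = CRQ \<Longrightarrow> CF X i l \<Longrightarrow> prq l < now X" using RQ_now by (auto simp: CF_def)
  show ?thesis
  proof (cases "pc l")
    case Q_w1 then show ?thesis using T by (auto simp: TI0_def CF sD(9,12) nrq)
  next
    case Q_chk then show ?thesis using T by (auto simp: TI0_def CF sD(18) nrq)
  next
    case Q_start then show ?thesis using T by (auto simp: TI0_def fr op'[OF a])
  next
    case Ret then show ?thesis using T li by (auto simp: TI0_def)
  next
    case T_cas then show ?thesis using T by (auto simp: TI0_def TB kt nt rt pv sD(9))
  next
    case I_cas then show ?thesis using T by (auto simp: TI0_def CF kcm pv sD(9))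
  qed (use T in \<open>auto simp: TI0_def CF QB FL FC TB PF kc kt nt rt kcm og sD(3,9) PB' tsok' COV' COV2' SB' SW' kyQ\<close>)
qed

lemma TI': "keepF t X X' \<Longrightarrow> TI X t l \<Longrightarrow> TI X' t l"
proof -
  assume F: "keepF t X X'" and T: "TI X t l"
  have o: "opi X' t = i" using kH by (simp add: keepH_def)
  show ?thesis
  proof (cases "pc l = Idle")
    case True then show ?thesis by (simp add: TI_def TI0_def)
  next
    case False
    then show ?thesis using T TI0'[OF F] act' o by (auto simp: TI_def)
  qed
qed

end

section \<open>Transitions\<close>

lemma acc: "gm X a = Some n \<Longrightarrow> ky X a = nkey n \<and> vl X a = nval n \<and> nx X a = nnext n \<and> pr X a = nprior n \<and>
   ts X a = nts n \<and> rf X a = pref (nnext n)"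
  by (simp add: ky_def vl_def nx_def pr_def ts_def rf_def)

text \<open>What may be assumed about the point \<open>r\<close> of a read: it comes after the
  invocation and all stamps set so far, and every unfrozen edge read at this moment satisfies
  \<open>Z\<close>.\<close>

definition "obs X i r \<longleftrightarrow> r < now X \<and> (\<forall>a. cm X a \<longrightarrow> stp X a \<le> r) \<and> ht X i < r \<and>
  (\<forall>n. Suc n \<le> gG X \<longrightarrow> Pt (Suc n) 0 \<le> r) \<and>
  (\<forall>a v. lkd X a \<longrightarrow> \<not> mf (nx X a) \<longrightarrow> rf X a = Some v \<longrightarrow> NR X r a \<and> Z X a v r)"

definition "Sinv s \<longleftrightarrow> (\<exists>X. gm X = mem s \<and> gG X = gts s \<and> gh X = hist s \<and> hinv X \<and> (\<forall>u. TI X u (loc s u)))"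

lemma (in hinv) tsok_now: "lkd X a \<Longrightarrow> tsok X a (gG X)"
  using lk_now[of a] G_ge by (auto simp: tsok_def now_def less_pt_def)

text \<open>An unfrozen node \<open>a\<close> is not removed, and an uncommitted node with parent
  \<open>a\<close> would be its successor. So an edge with committed ends is Firm at the old
  \<open>now X\<close>, and any other edge falls under the pointer case of \<open>Z\<close>.\<close>

lemma same_obs:
  fixes X X' :: "('k::linorder, 'v) gx"
  assumes h: "hinv X" and s: "same X X'" "now X < now X'" and i: "ht X' i = ht X i" "i < length (gh X)"
    and nx: "nx X' = nx X" and G: "gG X' = gG X"
  shows "obs X' i (now X)"
proof -
  interpret hinv X by fact
  note e = same_eqs[OF s(1)]
  interpret Y: ginv X' using same_inv[OF ginv_axioms s(1)] by blast
  have rd: "NR X' (now X) a \<and> Z X' a v (now X)" if a: "lkd X a" "\<not> mf (nx X a)" "rf X a = Some v" for a v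
  proof -
    have ra: "rmv X a = None" using rmvD[of a] a by (cases "rmv X a") auto
    then have NRa: "NR X' (now X) a" using e by (simp add: NR_def)
    have rf': "rf X' a = Some v" using a nx by (simp add: rf_def)
    have "Firm X' (now X) a v" if c: "cm X a" "cm X v"
    proof -
      have "tile X (now X) a v" using live_tile c ra a by blast
      then have "tile X' (now X) a v" using e by (simp add: tile_def)
      moreover have "HF X' (now X) a"
        unfolding HF_def using NRa Y.unc_par rf' c e by fastforce
      ultimately show ?thesis using s by (simp add: Firm_def)
    qed
    then show ?thesis using NRa rf' e unfolding Z_def by auto
  qed
  have "Pt (Suc n) 0 \<le> now X" if "Suc n \<le> gG X'" for n
    using that G by (auto simp: now_def)
  moreover have "rf X' = rf X" using nx by (simp add: rf_def fun_eq_iff)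
  ultimately show ?thesis
    unfolding obs_def using s e i h_ht[of i] stp_now rd nx by (auto simp: order.strict_implies_order)
qed

lemma Sinv_step:
  fixes X X' :: "('k::linorder, 'v) gx"
  assumes X: "gm X = mem s" "gG X = gts s" "gh X = hist s" "hinv X" "\<And>u. TI X u (loc s u)"
    and X': "hinv X'" "sext X X'" "hext t X X'" "gm X' = mem s'" "gG X' = gts s'" "gh X' = hist s'"
    and l: "\<And>u. u \<noteq> t \<Longrightarrow> loc s' u = loc s u" "TI X' t (loc s' t)"
  shows "Sinv s'"
proof -
  have "TI X' u (loc s' u)" for u
  proof (cases "u = t")
    case False
    have k: "keepH u X X'" "keepF u X X'" using keep_other[OF X'(3) False] by auto
    interpret ext X X' u by (intro ext.intro ext_axioms.intro X X' k)
    show ?thesis using TI'[OF k(2) X(5)] l(1)[OF False] by simp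
  qed (use l in simp)
  then show ?thesis using X' unfolding Sinv_def by blast
qed

lemma loc_setl [simp]: "loc (setl t l s) u = (if u = t then l else loc s u)" "mem (setl t l s) = mem s"
  "gts (setl t l s) = gts s" "hist (setl t l s) = hist s"
  by (simp_all add: setl_def)

lemma setn_simps [simp]: "loc (setn a n s) = loc s" "mem (setn a n s) = (mem s)(a \<mapsto> n)"
  "gts (setn a n s) = gts s" "hist (setn a n s) = hist s"
  by (simp_all add: setn_def)

lemma hext_keep: "hext t X X' \<Longrightarrow> opi X' t = opi X t \<Longrightarrow> gh X' = gh X \<Longrightarrow> keepH t X X'"
  by (auto simp: hext_def keepH_def)

section \<open>The kinds of transitions\<close>

locale st =
  fixes s :: "('k::linorder, 'v) gstate" and X :: "('k, 'v) gx" and t :: nat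
  assumes core: "gm X = mem s" "gG X = gts s" "gh X = hist s" and hi: "hinv X" and TI: "\<And>u. TI X u (loc s u)"
begin

abbreviation "i \<equiv> opi X t"

sublocale hinv X by (rule hi)

lemma finish:
  assumes X': "hinv X'" "sext X X'" "hext t X X'" "gm X' = mem s'" "gG X' = gts s'" "gh X' = hist s'" "opi X' t = i"
    and l: "loc s' = loc s" "act X' t i" "TI0 X' t i l'"
  shows "Sinv (setl t l' s')"
  by (rule Sinv_step[OF core hi TI X'(1-3)]) (use X' l in \<open>auto simp: TI_def\<close>)

lemma pre:
  assumes "hinv X'" "sext X X'" "hext t X X'" "opi X' t = i" "gh X' = gh X" "pc (loc s t) \<noteq> Idle"
  shows "act X t i" "TI0 X t i (loc s t)" "act X' t i" "keepF t X X' \<Longrightarrow> TI0 X' t i (loc s t)"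
    "i < length (gh X)" "mine X t i" "is_inv (gh X) i" "keepH t X X'" "ht X' i = ht X i" "ext X X' t"
proof -
  show a: "act X t i" "TI0 X t i (loc s t)" using TI[of t] assms(6) by (auto simp: TI_def)
  show k: "keepH t X X'" using hext_keep assms by blast
  show e: "ext X X' t" by (intro ext.intro ext_axioms.intro hi assms k)
  interpret e: ext X X' t by (rule e)
  show "act X' t i" using e.act' a by blast
  show "keepF t X X' \<Longrightarrow> TI0 X' t i (loc s t)" using e.TI0' a by blast
  show "i < length (gh X)" "mine X t i" "is_inv (gh X) i" using a by (auto simp: act_def mine_def is_inv_def)
  show "ht X' i = ht X i" using e.ht' a by blast
qed

text \<open>Time advances even if memory does not, so the read happens at the old
  \<open>now X\<close>, a point strictly in the past of the new state.\<close>

lemma local_step: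
  assumes l: "loc s t = l" "pc l = c"
    and l': "\<And>Y r. \<lbrakk>hinv Y; sext X Y; gm Y = mem s; gG Y = gts s; act Y t i; TI0 Y t i l; obs Y i r\<rbrakk> \<Longrightarrow> TI0 Y t i l'"
    and c: "c \<noteq> Idle"
  shows "Sinv (setl t l' s)"
proof -
  have pc: "pc (loc s t) \<noteq> Idle" using l c by simp
  note l' = l'[folded l(1)]
  define Y where "Y = X\<lparr>tm := Suc (tm X)\<rparr>"
  have sm: "same X Y" by (rule same_core) (simp_all add: Y_def)
  have hs: "hsame X Y" using sm by (simp add: hsame_def Y_def nx_def)
  note h = hsame_inv[OF hi hs]
  have hx: "hext t X Y" by (simp add: hext_def Y_def fresh_def)
  have kf: "keepF t X Y" by (simp add: keepF_def Y_def fresh_def priv_def)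
  note p = pre[OF h hx _ _ pc]
  have y: "opi Y t = i" "gh Y = gh X" "gm Y = mem s" "gG Y = gts s" by (simp_all add: Y_def core)
  have "obs Y i (now X)"
    by (rule same_obs[OF hi sm]) (use p y in \<open>simp_all add: Y_def now_def nx_def fun_eq_iff\<close>)
  then have "TI0 Y t i l'" using l'[OF h] y p kf by blast
  then show ?thesis by (intro finish[OF h hx]) (use y p core in auto)
qed

text \<open>The increment puts the point of the range query after the old \<open>now X\<close>,
  hence after the invocation, while it already lies in the past of the new clock.\<close>

lemma gts_step:
  assumes l: "loc s t = l" "pc l = c"
    and l': "\<And>Y. \<lbrakk>hinv Y; gG Y = Suc (gts s); act Y t i; TI0 Y t i l; ht Y i < Pt (Suc (gts s)) 0\<rbrakk> \<Longrightarrow> TI0 Y t i l'"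
    and c: "c \<noteq> Idle"
  shows "Sinv (setl t l' (s\<lparr>gts := gts s + 1\<rparr>))"
proof -
  have pc: "pc (loc s t) \<noteq> Idle" using l c by simp
  note l' = l'[folded l(1)]
  define Y where "Y = X\<lparr>tm := Suc (tm X), gG := Suc (gG X)\<rparr>"
  have sm: "same X Y" by (rule same_core) (simp_all add: Y_def)
  have hs: "hsame X Y" using sm by (simp add: hsame_def Y_def nx_def)
  note h = hsame_inv[OF hi hs]
  have hx: "hext t X Y" by (simp add: hext_def Y_def fresh_def)
  have kf: "keepF t X Y" by (simp add: keepF_def Y_def fresh_def priv_def)
  note p = pre[OF h hx _ _ pc]
  have y: "opi Y t = i" "gh Y = gh X" "gm Y = mem s" "gG Y = Suc (gts s)" by (simp_all add: Y_def core)
  have "now X < Pt (Suc (gts s)) 0" by (simp add: now_def core)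
  then have "ht Y i < Pt (Suc (gts s)) 0" using h_ht p y by (metis order.strict_trans)
  then have "TI0 Y t i l'" using l'[OF h(1)] y p kf by blast
  then show ?thesis by (intro finish[OF h hx]) (use y p core in auto)
qed

text \<open>In either case \<open>a\<close> is committed afterwards: a failing compare-and-swap
  means that another thread has set the timestamp.\<close>

lemma cas_step:
  assumes l: "loc s t = l" "pc l = c" and n: "mem s a = Some n" and ok: "tsok X a v"
    and l': "\<And>Y. \<lbrakk>hinv Y; act Y t i; TI0 Y t i l; cm Y a\<rbrakk> \<Longrightarrow> TI0 Y t i l'"
    and c: "c \<noteq> Idle"
  shows "Sinv (setl t l' (cas_ts a n v s))"
proof (cases "nts n = BOT")
  case False
  note l' = l'[folded l(1)]
  have la: "lkd X a" using ok by (simp add: tsok_def)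
  have "ts X a \<noteq> BOT" using n False core by (simp add: ts_def)
  then have ca: "cm X a" using la by (simp add: cm_def)
  have "Sinv (setl t l' s)"
  proof (rule local_step[OF refl])
    fix Y r assume y: "hinv Y" "sext X Y" "act Y t i" "TI0 Y t i (loc s t)"
    show "TI0 Y t i l'" using l'[OF y(1,3,4)] sextD(9)[OF y(2) ca] by blast
  qed (use l c in simp_all)
  then show ?thesis using False by (simp add: cas_ts_def)
next
  case True
  have pc: "pc (loc s t) \<noteq> Idle" using l c by simp
  note l' = l'[folded l(1)]
  have la: "lkd X a" using ok by (simp add: tsok_def)
  have ca: "\<not> cm X a" using n True core by (simp add: cm_def ts_def)
  define q where "q = Pt v (tm X)"
  define X1 where "X1 = X\<lparr>gm := (gm X)(a \<mapsto> (the (gm X a))\<lparr>nts := v\<rparr>), tm := Suc (tm X),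
       stp := (stp X)(a := q), gT := commitT X a q\<rparr>"
  interpret c: hcommitting X a v X1 q
    by (intro hcommitting.intro committing.intro committing_axioms.intro hi ginv_axioms)
      (use ok la ca in \<open>auto simp: tsok_def q_def X1_def\<close>)
  note h = c.hinv2 c.sext2 c.hext2[of t]
  have y: "opi c.X2 t = i" "gh c.X2 = gh X" "gm c.X2 = (mem s)(a \<mapsto> n\<lparr>nts := v\<rparr>)" "gG c.X2 = gG X"
  proof -
    have "gm c.X2 = gm X1" "gG c.X2 = gG X1" by (simp_all add: c.X2_def)
    moreover have "gm X1 = (mem s)(a \<mapsto> n\<lparr>nts := v\<rparr>)" "gG X1 = gG X" using n core by (simp_all add: X1_def)
    ultimately show "gm c.X2 = (mem s)(a \<mapsto> n\<lparr>nts := v\<rparr>)" "gG c.X2 = gG X" by simp_all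
  qed (simp_all only: c.X2_core)
  have "cm c.X2 a" by simp
  have kf: "keepF t X c.X2"
    unfolding keepF_def
  proof (intro conjI impI allI)
    assume f: "fresh X i"
    then have "c.clin i = lin X i" by (auto simp: c.clin_def fresh_def)
    then show "fresh c.X2 i" using f by (simp add: fresh_def)
  next
    fix b nd assume b: "priv X t b nd"
    then have "b \<noteq> a" using la by (auto simp: priv_def lkd_def)
    then show "priv c.X2 t b nd" using b y core by (simp add: priv_def)
  qed
  note p = pre[OF h y(1,2) pc]
  have "TI0 c.X2 t i l'" using l'[OF h(1)] p kf \<open>cm c.X2 a\<close> by blast
  then show ?thesis unfolding cas_ts_def using True by (simp, intro finish[OF h]) (use y p core in auto)
qed

lemma tsv_step:
  assumes l: "loc s t = l" "pc l = c" and a: "\<And>Y. \<lbrakk>hinv Y; TI0 Y t i l\<rbrakk> \<Longrightarrow> lkd Y a \<or> cm Y a"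
    and l': "\<And>Y. \<lbrakk>hinv Y; TI0 Y t i l; tsok Y a (gts s)\<rbrakk> \<Longrightarrow> TI0 Y t i l'"
    and c: "c \<noteq> Idle"
  shows "Sinv (setl t l' s)"
proof (rule local_step[OF l])
  fix Y :: "('k, 'v) gx"
  assume Y: "hinv Y" "gG Y = gts s" "TI0 Y t i l"
  interpret Y: hinv Y by fact
  have "lkd Y a" using a[OF Y(1,3)] Y.cm_lkd by blast
  then show "TI0 Y t i l'" using Y.tsok_now l'[OF Y(1,3)] Y(2) by metis
qed (rule c)

lemma alloc_step:
  assumes l: "loc s t = l" "pc l = c" and n: "mem s a = None"
    and l': "\<And>Y. \<lbrakk>hinv Y; act Y t i; TI0 Y t i l; \<And>b. mem s b \<noteq> None \<Longrightarrow> gm Y b = mem s b; priv Y t a nd\<rbrakk> \<Longrightarrow> TI0 Y t i l'"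
    and c: "c \<noteq> Idle"
  shows "Sinv (setl t l' (setn a nd s))"
proof -
  have pc: "pc (loc s t) \<noteq> Idle" using l c by simp
  note l' = l'[folded l(1)]
  define Y where "Y = X\<lparr>tm := Suc (tm X), gm := (gm X)(a \<mapsto> nd), own := (own X)(a := t)\<rparr>"
  have la: "\<not> lkd X a" using alloc[of a] n core by auto
  have eq: "ky Y b = ky X b" "vl Y b = vl X b" "pr Y b = pr X b" "ts Y b = ts X b" "nx Y b = nx X b" "rf Y b = rf X b"
    if "lkd X b" for b using that la by (auto simp: Y_def ky_def vl_def pr_def ts_def nx_def rf_def)
  have sm: "same X Y"
    unfolding same_def using eq alloc frozen_cm head la by (auto simp: Y_def now_def)
  have hs: "hsame X Y" using sm eq by (simp add: hsame_def Y_def)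
  note h = hsame_inv[OF hi hs]
  have hx: "hext t X Y" using n core by (auto simp: hext_def Y_def fresh_def)
  have kf: "keepF t X Y" using n core by (auto simp: keepF_def Y_def fresh_def priv_def)
  have y: "opi Y t = i" "gh Y = gh X" "gm Y = (mem s)(a \<mapsto> nd)" "gG Y = gG X" by (simp_all add: Y_def core)
  note p = pre[OF h hx y(1,2) pc]
  have pv: "priv Y t a nd" using la by (simp add: priv_def Y_def lkd_def)
  have bb: "mem s b \<noteq> None \<Longrightarrow> gm Y b = mem s b" for b using n y by auto
  have "TI0 Y t i l'" using l'[OF h(1) p(3) p(4)[OF kf] bb pv] .
  then show ?thesis by (intro finish[OF h hx]) (use y p core in auto)
qed

lemma freeze_same:
  assumes a: "cm X a" "a \<noteq> head" "\<not> mf (nx X a)" "mem s a = Some n" "nnext n = tp'" and mk: "\<not> (mk \<and> fg)"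
    and Y: "Y = X\<lparr>tm := Suc (tm X), gm := (gm X)(a \<mapsto> n\<lparr>nnext := Ptr (pref tp') mk fg\<rparr>)\<rparr>"
  shows "same X Y"
proof -
  have an: "gm X a = Some n" using a core by simp
  have eq: "ky Y b = ky X b" "vl Y b = vl X b" "pr Y b = pr X b" "ts Y b = ts X b" "rf Y b = rf X b"
      "b \<noteq> a \<Longrightarrow> nx Y b = nx X b" for b
    using an a(5) by (auto simp: Y ky_def vl_def pr_def ts_def nx_def rf_def)
  have "nx Y a = Ptr (pref tp') mk fg" by (simp add: Y nx_def)
  then show ?thesis
    unfolding same_def using eq a alloc frozen_cm head mk
    by (auto simp: now_def Y dest: eq(6))
qed

lemma flag_step:
  assumes l: "loc s t = l" "pc l = c" and a: "cm X a" "a \<noteq> head" "mem s a = Some n" "\<not> mf (nnext n)"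
    and l': "\<And>Y. \<lbrakk>hinv Y; act Y t i; TI0 Y t i l; pflag (nx Y a)\<rbrakk> \<Longrightarrow> TI0 Y t i l'"
    and c: "c \<noteq> Idle"
  shows "Sinv (setl t l' (setn a (n\<lparr>nnext := Ptr (pref (nnext n)) (pmark (nnext n)) True\<rparr>) s))"
proof -
  have pc: "pc (loc s t) \<noteq> Idle" using l c by simp
  note l' = l'[folded l(1)]
  have an: "gm X a = Some n" using a core by simp
  then have nxa: "nx X a = nnext n" by (simp add: nx_def)
  have pm: "\<not> pmark (nnext n)" using a by (simp add: mf_def)
  define Y where "Y = X\<lparr>tm := Suc (tm X), gm := (gm X)(a \<mapsto> n\<lparr>nnext := Ptr (pref (nnext n)) False True\<rparr>)\<rparr>"
  have sm: "same X Y" by (rule freeze_same[OF a(1,2) _ a(3) refl _ Y_def]) (use a nxa in auto)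
  have "pmark (nx Y b) = pmark (nx X b)" for b using nxa pm by (auto simp: Y_def nx_def)
  then have hs: "hsame X Y" using sm by (simp add: hsame_def Y_def)
  note h = hsame_inv[OF hi hs]
  have la: "lk X a \<noteq> None" using a by (simp add: cm_def lkd_def)
  have hx: "hext t X Y" using la by (auto simp: hext_def Y_def fresh_def)
  have kf: "keepF t X Y" using la by (auto simp: keepF_def Y_def fresh_def priv_def)
  have y: "opi Y t = i" "gh Y = gh X" "gm Y = (mem s)(a \<mapsto> n\<lparr>nnext := Ptr (pref (nnext n)) False True\<rparr>)" "gG Y = gG X"
    by (simp_all add: Y_def core)
  note p = pre[OF h hx y(1,2) pc]
  have "pflag (nx Y a)" by (simp add: Y_def nx_def)
  then have "TI0 Y t i l'" using l'[OF h(1)] y p kf by auto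
  then show ?thesis by (intro finish[OF h hx]) (use y p core pm in auto)
qed

text \<open>Marking only binds the remove to the node; its point is fixed when a copy that trims the
  node is committed.\<close>

lemma mark_step:
  assumes pc: "pc (loc s t) = R_mark2" and a: "mem s (rcurr (loc s t)) = Some n" "nnext n = tp (loc s t)"
  shows "Sinv (setl t ((loc s t)\<lparr>pc := F_retry, caller := CRem2\<rparr>)
      (setn (rcurr (loc s t)) (n\<lparr>nnext := Ptr (pref (tp (loc s t))) True (pflag (tp (loc s t)))\<rparr>) s))"
proof -
  let ?l = "loc s t" and ?a = "rcurr (loc s t)"
  have T: "act X t i" "caller ?l = CRem1" "CF X i ?l" "cm X ?a" "ky X ?a = K (kk ?l)" "\<not> mf (tp ?l)"
    using TI[of t] pc by (auto simp: TI_def TI0_def)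
  have F: "op_of (gh X) i = Remove (kk ?l)" "fkey ?l = K (kk ?l)" "fresh X i" using T by (auto simp: CF_def)
  have an: "gm X ?a = Some n" using a core by simp
  then have nxa: "nx X ?a = tp ?l" using a by (simp add: nx_def)
  have pf: "\<not> pflag (tp ?l)" using T by (simp add: mf_def)
  have ah: "?a \<noteq> head" using T head by auto
  define Y where "Y = X\<lparr>tm := Suc (tm X), gm := (gm X)(?a \<mapsto> n\<lparr>nnext := Ptr (pref (tp ?l)) True False\<rparr>),
     mrk := (mrk X)(?a \<mapsto> i)\<rparr>"
  define Y1 where "Y1 = X\<lparr>tm := Suc (tm X), gm := (gm X)(?a \<mapsto> n\<lparr>nnext := Ptr (pref (tp ?l)) True False\<rparr>)\<rparr>"
  have "same X Y1" by (rule freeze_same[OF T(4) ah _ a _ Y1_def]) (use T nxa in auto)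
  then have sm: "same X Y" by (simp add: same_def Y_def Y1_def now_def ky_def vl_def pr_def ts_def nx_def rf_def)
  have ii: "is_inv (gh X) i" "mine X t i" using T by (auto simp: act_def mine_def is_inv_def)
  have mn: "mrk X ?a = None"
  proof -
    have "\<not> pmark (nx X ?a)" using nxa T by (simp add: mf_def)
    then show ?thesis using h_mrk[of ?a] by (cases "mrk X ?a") auto
  qed
  have "pmark (nx Y b) = (pmark (nx X b) \<or> mrk Y b \<noteq> mrk X b)" for b using mn by (simp add: Y_def nx_def)
  moreover have "mrk Y = (mrk X)(?a \<mapsto> i)" "lin Y = lin X" "org Y = org X" "gh Y = gh X" "ht Y = ht X" by (simp_all add: Y_def)
  ultimately have hs: "hsame X Y" unfolding hsame_def using sm cm_lkd[OF T(4)] T(5,6) nxa F ii by metis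
  note h = hsame_inv[OF hi hs]
  have la: "lk X ?a \<noteq> None" using T by (simp add: cm_def lkd_def)
  have hx: "hext t X Y" using la ii mn by (auto simp: hext_def Y_def fresh_def)
  have y: "opi Y t = i" "gh Y = gh X" "gm Y = (mem s)(?a \<mapsto> n\<lparr>nnext := Ptr (pref (tp ?l)) True False\<rparr>)" "gG Y = gG X"
    by (simp_all add: Y_def core)
  have "pc ?l \<noteq> Idle" using pc by simp
  note p = pre[OF h hx y(1,2) this]
  have "TI0 Y t i (?l\<lparr>pc := F_retry, caller := CRem2\<rparr>)"
    using F y by (simp add: TI0_def CF_def) (simp add: Y_def)
  then show ?thesis by (intro finish[OF h hx]) (use y p core pf in auto)
qed

text \<open>For operations that leave the map unchanged. Their point lies in the past and is chosen
  when the response is determined, in the last step before returning.\<close>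

lemma lin_step:
  assumes pc: "pc (loc s t) \<noteq> Idle" and f: "fresh X i" and p: "ht X i < p" "p < now X" "linok X (op_of (gh X) i) p r"
     and u: "\<And>k v. op_of (gh X) i = Insert k v \<Longrightarrow> r \<noteq> RV None" "\<And>k v. op_of (gh X) i = Remove k \<Longrightarrow> r \<noteq> RV (Some v)"
     and l': "pc l' = Ret" "retv l' = r"
  shows "Sinv (setl t l' s)"
proof -
  define Y where "Y = X\<lparr>tm := Suc (tm X), lin := (lin X)(i \<mapsto> (p, r))\<rparr>"
  have sm: "same X Y" by (rule same_core) (simp_all add: Y_def)
  have a: "act X t i" using TI[of t] pc by (auto simp: TI_def)
  then have ii: "is_inv (gh X) i" "mine X t i" by (auto simp: act_def mine_def is_inv_def)
  have "\<exists>j p r. lin Y = (lin X)(j \<mapsto> (p, r)) \<and> is_inv (gh X) j \<and> fresh X j \<and>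
      ht X j < p \<and> p < now X \<and> linok X (op_of (gh X) j) p r \<and>
      (\<forall>k v. op_of (gh X) j = Insert k v \<longrightarrow> r \<noteq> RV None) \<and>
      (\<forall>k v. op_of (gh X) j = Remove k \<longrightarrow> r \<noteq> RV (Some v))"
    by (intro exI[of _ i] exI[of _ p] exI[of _ r]) (use ii f p u in \<open>auto simp: Y_def\<close>)
  moreover have "org Y = org X" "mrk Y = mrk X" "gh Y = gh X" "ht Y = ht X" "nx Y = nx X"
    by (simp_all add: Y_def nx_def fun_eq_iff)
  ultimately have "hsame X Y" unfolding hsame_def using sm by simp
  note h = hsame_inv[OF hi this]
  have hx: "hext t X Y" using ii f by (auto simp: hext_def Y_def fresh_def)
  have y: "opi Y t = i" "gh Y = gh X" "gm Y = mem s" "gG Y = gts s" by (simp_all add: Y_def core)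
  note p = pre[OF h hx y(1,2) pc]
  have "TI0 Y t i l'" using l' by (simp add: TI0_def Y_def)
  then show ?thesis by (intro finish[OF h hx]) (use y p core in auto)
qed

lemma link_step:
  assumes pc: "pc (loc s t) \<noteq> Idle"
    and n: "cm X n" "mem s n = Some nn" "nnext nn = unm v"
    and y: "priv X t y \<lparr>nts = BOT, nkey = k, nval = w, nnext = Ptr z False False, nprior = Some v\<rparr>"
    and W: "W = C @ (case z of None \<Rightarrow> [] | Some x \<Rightarrow> [x])" "W \<noteq> []" "hd W = v"
      "successively (lnk X) W" "\<forall>a\<in>set W. cm X a"
    and C: "C \<noteq> [] \<Longrightarrow> rf X (last C) = z \<and> k = ky X (last C) \<and> w = vl X (last C) \<and>
       pflag (nx X (last C)) \<and> (\<forall>a\<in>set (butlast C). pmark (nx X a))"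
    and kn: "ky X n < k" and ks: "\<And>x. z = Some x \<Longrightarrow> k < ky X x" "z = None \<Longrightarrow> k = PInf"
    and ins: "C = [] \<Longrightarrow> (\<exists>k'. op_of (gh X) i = Insert k' w \<and> k = K k') \<and> fresh X i"
    and l': "\<And>Y. \<lbrakk>ext X Y t; hinv Y; act Y t i; C = [] \<Longrightarrow> org Y y = Some i; C \<noteq> [] \<Longrightarrow> fresh X i \<Longrightarrow> fresh Y i; lkd Y y\<rbrakk> \<Longrightarrow> TI0 Y t i l'"
  shows "Sinv (setl t l' (setn n (nn\<lparr>nnext := unm y\<rparr>) s))"
proof -
  let ?nd = "\<lparr>nts = BOT, nkey = k, nval = w, nnext = Ptr z False False, nprior = Some v\<rparr>"
  have a: "act X t i" using TI[of t] pc by (auto simp: TI_def)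
  then have ii: "mine X t i" by (auto simp: act_def)
  define Y where "Y = X\<lparr>gm := (gm X)(n \<mapsto> (the (gm X n))\<lparr>nnext := unm y\<rparr>), tm := Suc (tm X),
       lk := (lk X)(y \<mapsto> now X), par := (par X)(y := n), chn := (chn X)(y := C),
       rmv := (\<lambda>a. if a \<in> set C then Some y else rmv X a),
       org := (if C = [] then (org X)(y \<mapsto> i) else org X)\<rparr>"
  have nn: "gm X n = Some nn" using n core by simp
  have nxn: "\<not> mf (nx X n)" "rf X n = Some v" using nn n(3) by (auto simp: nx_def rf_def unm_def mf_def)
  have pv: "gm X y = Some ?nd" "lk X y = None" "own X y = t" using y by (auto simp: priv_def)
  have nd: "nts ?nd = BOT" "nnext ?nd = Ptr z False False" "nprior ?nd = Some v" by simp_all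
  have nd2: "C \<noteq> [] \<Longrightarrow> rf X (last C) = z \<and> nkey ?nd = ky X (last C) \<and> nval ?nd = vl X (last C) \<and>
       pflag (nx X (last C)) \<and> (\<forall>a\<in>set (butlast C). pmark (nx X a))" "ky X n < nkey ?nd"
      "\<And>x. z = Some x \<Longrightarrow> nkey ?nd < ky X x" "z = None \<Longrightarrow> nkey ?nd = PInf"
      "C = [] \<Longrightarrow> mine X t i \<and> (\<exists>k. op_of (gh X) i = Insert k (nval ?nd) \<and> nkey ?nd = K k) \<and> fresh X i"
    using C kn ks ins ii by auto
  note h = link_hinv[OF hi n(1) nxn pv(1,2) nd pv(3) W nd2 Y_def]
  have yy: "opi Y t = i" "gh Y = gh X" "gm Y = (mem s)(n \<mapsto> nn\<lparr>nnext := unm y\<rparr>)" "gG Y = gG X"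
    using nn core by (simp_all add: Y_def)
  note p = pre[OF h(1-3) yy(1,2) pc]
  have "C \<noteq> [] \<Longrightarrow> fresh X i \<Longrightarrow> fresh Y i" by (simp add: fresh_def Y_def)
  then have "TI0 Y t i l'" using l' p h by blast
  then show ?thesis by (intro finish[OF h(1-3)]) (use yy p core in auto)
qed

lemma inv_step:
  assumes pc: "pc (loc s t) = Idle" and e: "e = event.Inv t op"
    and l': "\<And>Y. op_of (gh Y) (opi Y t) = op \<Longrightarrow> fresh Y (opi Y t) \<Longrightarrow> TI0 Y t (opi Y t) l'"
  shows "Sinv (setl t l' (s\<lparr>hist := hist s @ [e]\<rparr>))"
proof -
  let ?n = "length (gh X)"
  define Y where "Y = X\<lparr>tm := Suc (tm X), gh := gh X @ [e], ht := (ht X)(?n := now X), opi := (opi X)(t := ?n)\<rparr>"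
  have sm: "same X Y" by (rule same_core) (simp_all add: Y_def)
  have "\<not> matches (gh X @ [e]) j ?n r" for j r by (simp add: matches_def e)
  then have hs: "hsame X Y" using sm by (auto simp: hsame_def Y_def nx_def now_def)
  note h = hsame_inv[OF hi hs]
  have hx: "hext t X Y" by (auto simp: hext_def Y_def fresh_def e)
  have "fresh X ?n"
  proof -
    have "org X a \<noteq> Some ?n" "mrk X a \<noteq> Some ?n" for a using h_org[of a ?n] h_mrk[of a ?n] is_inv_len by blast+
    moreover have "lin X ?n = None"
    proof (cases "lin X ?n")
      case (Some x) then show ?thesis using h_lin[of ?n "fst x" "snd x"] is_inv_len by fastforce
    qed simp
    ultimately show ?thesis by (simp add: fresh_def)
  qed
  then have "fresh Y (opi Y t)" by (simp add: fresh_def Y_def)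
  moreover have "op_of (gh Y) (opi Y t) = op" by (simp add: op_of_def Y_def e)
  ultimately have "TI0 Y t (opi Y t) l'" using l' by blast
  moreover have "act Y t (opi Y t)" by (simp add: act_def mine_def Y_def e)
  ultimately have "TI Y t l'" by (simp add: TI_def)
  then show ?thesis
    by (intro Sinv_step[OF core hi TI h hx]) (simp_all add: Y_def core)
qed

lemma ret_step:
  assumes pc: "pc (loc s t) = Ret"
  shows "Sinv (setl t ((loc s t)\<lparr>pc := Idle\<rparr>) (s\<lparr>hist := hist s @ [Res t (retv (loc s t))]\<rparr>))"
proof -
  let ?n = "length (gh X)" and ?e = "Res t (retv (loc s t))"
  define Y where "Y = X\<lparr>tm := Suc (tm X), gh := gh X @ [?e], ht := (ht X)(?n := now X)\<rparr>"
  have sm: "same X Y" by (rule same_core) (simp_all add: Y_def)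
  have T: "act X t i" "\<exists>p. lin X i = Some (p, retv (loc s t))" using TI[of t] pc by (auto simp: TI_def TI0_def)
  have "\<exists>p. lin X j = Some (p, r) \<and> p < now X" if m: "matches (gh X @ [?e]) j ?n r" for j r
  proof -
    have j: "j < ?n" "\<exists>op. gh X ! j = event.Inv t op" "r = retv (loc s t)"
      "\<And>k. j < k \<Longrightarrow> k < ?n \<Longrightarrow> ev_thr (gh X ! k) \<noteq> t"
      using m by (auto simp: matches_def nth_append)
    \<comment> \<open>No event of \<open>t\<close> lies between a matching invocation and its
      response, so the invocation is the last event of \<open>t\<close>.\<close>
    have "j = i"
    proof (rule ccontr)
      assume "j \<noteq> i"
      then consider "j < i" | "i < j" by linarith
      moreover have "ev_thr (gh X ! j) = t" "ev_thr (gh X ! i) = t" "i < ?n" using T(1) j(2) by (auto simp: act_def mine_def)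
      moreover have "\<And>k. i < k \<Longrightarrow> k < ?n \<Longrightarrow> ev_thr (gh X ! k) \<noteq> t" using T(1) by (simp add: act_def)
      ultimately show False using j(1,4) by cases blast+
    qed
    then show ?thesis using T j h_lin by blast
  qed
  then have hs: "hsame X Y" using sm by (auto simp: hsame_def Y_def nx_def now_def)
  note h = hsame_inv[OF hi hs]
  have hx: "hext t X Y" by (auto simp: hext_def Y_def fresh_def)
  have "TI Y t ((loc s t)\<lparr>pc := Idle\<rparr>)" by (simp add: TI_def TI0_def)
  then show ?thesis
    by (intro Sinv_step[OF core hi TI h hx]) (simp_all add: Y_def core)
qed

end

section \<open>From observed edges to responses\<close>

context hinv
begin

lemma CF_rem2: "CF X i l \<Longrightarrow> caller l = CRem2 \<Longrightarrow> cm X (rcurr l) \<and> pmark (nx X (rcurr l)) \<and> ky X (rcurr l) = K (kk l) \<and> fkey l = K (kk l)"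
  using h_mrk[of "rcurr l" i] frozen_cm[of "rcurr l"] by (auto simp: CF_def mf_def)

lemma CF_fkey: "CF X i l \<Longrightarrow> caller l \<noteq> CRQ \<Longrightarrow> fkey l = K (kk l)"
  by (cases "caller l") (auto simp: CF_def)

lemma CF_RQ: "CF X i l \<Longrightarrow> caller l = CRQ \<Longrightarrow> RQ X i l"
  by (auto simp: CF_def)

lemma not_head: "lkd X a \<Longrightarrow> rf X a = Some c \<Longrightarrow> c \<noteq> head"
  using nextL[of a c] head by auto

lemma read_VB:
  assumes "CF X i l" "obs X i r" "lkd X (pred l)" "\<not> mf (predNext l)" "predNext l = nx X (pred l)" "pref (predNext l) = Some c"
  shows "VB X i l c r" "lkd X c" "predNext l = unm c"
proof -
  have rf: "rf X (pred l) = Some c" using assms by (simp add: rf_def)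
  show lc: "lkd X c" using nextL[OF assms(3) rf] by blast
  show pn: "predNext l = unm c" using assms(4,6) by (cases "predNext l") (auto simp: mf_def unm_def)
  have "c \<noteq> head" using not_head[OF assms(3) rf] .
  moreover have "caller l = CRQ \<longrightarrow> prq l \<le> r" using assms(1,2) CF_RQ by (auto simp: obs_def RQ_def prq_def)
  moreover have "caller l = CRem2 \<longrightarrow> stp X (rcurr l) \<le> r" using assms(1,2) CF_rem2 by (auto simp: obs_def)
  moreover have "NR X r (pred l) \<and> Z X (pred l) c r" using assms rf by (simp add: obs_def)
  ultimately show "VB X i l c r" using assms(2) lc pn by (auto simp: VB_def obs_def)
qed

text \<open>The node marked by the remove stays marked, so an unmarked \<open>curr l\<close> is
  another node.\<close>

lemma NC_unmarked: "CF X i l \<Longrightarrow> \<not> mf (nx X (curr l)) \<Longrightarrow> NC l"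
  using CF_rem2[of i l] by (auto simp: NC_def mf_def)

text \<open>The skipping loop of find also ends at a frozen node without successor; such a node has
  key \<open>PInf\<close>, unlike the node marked by the remove.\<close>

lemma NC_last: "CF X i l \<Longrightarrow> lkd X (curr l) \<Longrightarrow> rf X (curr l) = None \<Longrightarrow> NC l"
  using CF_rem2[of i l] nextN[of "curr l"] by (auto simp: NC_def)

text \<open>With both ends committed, \<open>Z\<close> yields a Firm edge at some point not before
  the read. That \<open>pred l\<close> is not trimmed up to the read carries down to the earlier
  point \<open>prq l\<close>.\<close>

lemma FC_PF:
  assumes f: "FC X i l" "NC l" "fkey l \<le> ky X (curr l)" and c: "cm X (curr l)"
  shows "PF X i l"
proof -
  obtain r where v: "VB X i l (curr l) r" using f by (auto simp: FC_def)
  have cp: "cm X (pred l)" using f by (simp add: FC_def)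
  obtain p where p: "r \<le> p" "Firm X p (pred l) (curr l)" using v cp c by (auto simp: VB_def Z_def)
  have "caller l = CRQ \<longrightarrow> NR X (prq l) (pred l)" using v unfolding VB_def NR_def by (meson order_le_less_trans)
  moreover have "ht X i < p" "caller l = CRem2 \<longrightarrow> stp X (rcurr l) \<le> p" using v p(1) by (auto simp: VB_def)
  ultimately show ?thesis using f c cp p by (auto simp: FC_def PF_def)
qed

text \<open>If \<open>c\<close> is committed, no uncommitted node has parent \<open>a\<close>, since
  it would be the successor of \<open>a\<close>; so the tile found by \<open>walkP\<close> is
  Firm.\<close>

lemma read_RE:
  assumes a: "aliveF X p a" "p < now X" "rf X a = Some c"
  shows "RE X a c p"
proof (cases "cm X c")
  case True
  have ca: "cm X a" "stp X a \<le> p" "NR X p a" using a by (auto simp: aliveF_def)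
  obtain x where x: "wk X p c x" "tile X p a x" using walkP[OF ca(1,2) NR_alive[OF ca(3)] a(3)] by blast
  have "HF X p a" unfolding HF_def using ca unc_par a(3) True by fastforce
  then show ?thesis using x a True by (auto simp: RE_def Firm_def)
qed (use a in \<open>simp add: RE_def\<close>)

text \<open>Stamps other than \<open>Pt 0 0\<close> have a time of at least 1, so
  \<open>Pt (Suc (rts l)) 0\<close> separates the timestamps up to \<open>rts l\<close> from the
  larger ones. The assumption on \<open>rts l\<close> is for the sentinels, which have stamp
  \<open>Pt 0 0\<close> but timestamp 2.\<close>

lemma stp_prq: "2 \<le> rts l \<Longrightarrow> cm X a \<Longrightarrow> stp X a \<le> prq l \<longleftrightarrow> ts X a \<le> rts l"
  using stp_ts[of a] by (cases "stp X a") (auto simp: prq_def)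

lemma RQ_now: "RQ X i l \<Longrightarrow> prq l < now X"
  using tm_pos by (auto simp: RQ_def prq_def now_def)

text \<open>Either \<open>a\<close> itself trims \<open>b\<close>, and then not before its own
  stamp, or by \<open>prior\<close> the remover of \<open>b\<close> was linked after that stamp. So
  stepping back along prior pointers never leads to a node that is dead at \<open>p\<close>.\<close>

lemma prior_NR:
  assumes "cm X a" "pr X a = Some b" "p < stp X a"
  shows "NR X p b"
proof -
  note pp = prior[OF cm_lkd[OF assms(1)] assms(2)]
  have "p < sb X y" if r: "rmv X b = Some y" for y
  proof (cases "y = a")
    case True then show ?thesis using assms by (simp add: sb_def)
  next
    case False
    then have "stp X a < lkp X y" using pp r by blast
    moreover have "lkp X y \<le> sb X y" using stp_ts[of y] by (simp add: sb_def)
    ultimately show ?thesis using assms(3) by order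
  qed
  then show ?thesis by (simp add: NR_def)
qed

lemma SW_stop:
  assumes q: "QB X i l" and w: "SW X l" and n: "ts X (succ l) \<le> rts l"
  shows "Firm X (prq l) (curr l) (succ l)" "aliveF X (prq l) (succ l)" "ky X (curr l) < ky X (succ l)"
proof -
  obtain x where x: "cm X (succ l)" "wk X (prq l) (succ l) x" "Firm X (prq l) (curr l) x" using w by (auto simp: SW_def)
  have "stp X (succ l) \<le> prq l" using stp_prq[of l, OF _ x(1)] n q by (simp add: QB_def RQ_def)
  then have "x = succ l" using wk_cm[OF x(1)] x(2) by blast
  then show "Firm X (prq l) (curr l) (succ l)" using x by simp
  then show "aliveF X (prq l) (succ l)" "ky X (curr l) < ky X (succ l)" using firm_alive by (auto simp: Firm_def tile_def)
qed

lemma SW_walk: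
  assumes q: "QB X i l" and w: "SW X l" and n: "rts l < ts X (succ l)" and b: "pr X (succ l) = Some b"
  shows "cm X b \<and> (\<exists>x. wk X (prq l) b x \<and> Firm X (prq l) (curr l) x)"
proof -
  obtain x where x: "cm X (succ l)" "wk X (prq l) (succ l) x" "Firm X (prq l) (curr l) x" using w by (auto simp: SW_def)
  have "\<not> stp X (succ l) \<le> prq l" using stp_prq[of l, OF _ x(1)] n q by (simp add: QB_def RQ_def)
  then have "wk X (prq l) b x" using wk_step[of "succ l" "prq l" b x] x(2) b by blast
  then show ?thesis using x prior[OF cm_lkd[OF x(1)] b] by blast
qed

lemma SB_SW: "SB X l \<Longrightarrow> cm X (succ l) \<Longrightarrow> SW X l"
  by (auto simp: SB_def SW_def RE_def)

lemma COV_stop: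
  assumes q: "QB X i l" and w: "SW X l" and n: "ts X (succ l) \<le> rts l" and a: "arr l = []" and k: "ky X (curr l) < K (lo l)"
  shows "COV X (l\<lparr>curr := succ l\<rparr>)"
proof -
  have "know X k (prq l) None" if "lo l \<le> k" "K k < ky X (succ l)" for k
  proof -
    have "ky X (curr l) < K k" using k that(1) by (meson ekey_order(7) order_less_le_trans)
    moreover have "ky X (succ l) \<noteq> K k" "K k \<le> ky X (succ l)" using that(2) by auto
    ultimately show ?thesis using firm_know[OF SW_stop(1)[OF q w n], of k] by simp
  qed
  then show ?thesis using a by (simp add: COV_def prq_def)
qed

text \<open>The keys strictly between the two nodes are absent by the Firm edge, and
  \<open>arr l\<close> has none of them, since its keys do not exceed that of
  \<open>curr l\<close>.\<close>

lemma COV2_stop: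
  assumes q: "QB X i l" and w: "SW X l" and n: "ts X (succ l) \<le> rts l" and c: "COV2 X l"
  shows "COV X (l\<lparr>curr := succ l\<rparr>)"
proof -
  note s = SW_stop[OF q w n]
  have "know X k (prq l) (map_of (arr l) k)" if "lo l \<le> k" "K k < ky X (succ l)" for k
  proof (cases "K k \<le> ky X (curr l)")
    case True then show ?thesis using c that by (simp add: COV2_def)
  next
    case False
    then have "map_of (arr l) k = None" using c by (auto simp: COV2_def map_of_eq_None_iff)
    moreover have "ky X (succ l) \<noteq> K k" "K k \<le> ky X (succ l)" "ky X (curr l) < K k" using that(2) False by auto
    ultimately show ?thesis using firm_know[OF s(1), of k] by simp
  qed
  then show ?thesis using c s(3) by (auto simp: COV_def COV2_def prq_def)
qed

lemma COV_COV2: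
  assumes q: "QB X i l" and c: "COV X l" "K (lo l) \<le> ky X (curr l)" and k: "ky X (curr l) = K k" "k \<le> hi l" and v: "vl X (curr l) = v"
  shows "COV2 X (l\<lparr>arr := arr l @ [(k, v)]\<rparr>)"
proof -
  have "know X k (prq l) (Some v)" using q k v RQ_now by (auto simp: QB_def know_def)
  moreover have "map_of (arr l) k = None" using c k by (auto simp: COV_def map_of_eq_None_iff)
  moreover have "know X j (prq l) (map_of (arr l) j)" if "lo l \<le> j" "j < k" for j using c(1) that k by (simp add: COV_def)
  moreover have "map_of (arr l @ [(k, v)]) j = (if j = k then Some v else map_of (arr l) j)" if "j \<le> k" for j
    using calculation(2) by (auto simp: map_add_def split: option.splits)
  ultimately have "know X j (prq l) (map_of (arr l @ [(k, v)]) j)" if "lo l \<le> j" "j \<le> k" for j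
    using that by (cases "j = k") auto
  moreover have "(\<forall>(j, v)\<in>set (arr l). lo l \<le> j \<and> j \<le> hi l \<and> j < k)" "distinct (map fst (arr l))"
    using c k by (auto simp: COV_def)
  ultimately show ?thesis using c(2) k unfolding COV2_def by (auto simp: prq_def)
qed

text \<open>When the second find of a remove returns, the marked node must have been trimmed by a committed copy:
  otherwise it would own its key at a point at which find saw another node there.\<close>

lemma done_lin:
  assumes f: "PF X i l" "caller l = CRem2"
  shows "\<exists>p. lin X i = Some (p, RV (Some (vl X (rcurr l))))"
proof -
  have CF: "CF X i l" and PB: "PB X l" using f by (auto simp: PF_def)
  note r = CF_rem2[OF CF f(2)]
  have m: "mrk X (rcurr l) = Some i" using CF f by (simp add: CF_def)
  note h = h_mrk[OF m]
  show ?thesis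
  proof (cases "\<exists>y. rmv X (rcurr l) = Some y \<and> cm X y")
    case True then show ?thesis using h by blast
  next
    case False
    then have al: "alive X p (rcurr l)" for p by (auto simp: alive_def)
    obtain p where p: "stp X (rcurr l) \<le> p" "Firm X p (pred l) (curr l)" using f by (auto simp: PF_def)
    have "rcurr l \<noteq> head" using r head by auto
    then obtain n where n: "gT X (ky X (rcurr l)) p = (n, rcurr l)" using tileN r p(1) al by blast
    have "ky X (pred l) < K (kk l)" "K (kk l) \<le> ky X (curr l)" using f r PB by (auto simp: PF_def PB_def)
    then have "gT X (K (kk l)) p = (pred l, curr l)" using p(2) by (auto simp: Firm_def tile_def)
    then show ?thesis using n r f by (auto simp: PF_def NC_def)
  qed
qed

end

context st
begin

lemma lookup_step:
  assumes T: "PF X i (loc s t)" "caller (loc s t) \<noteq> CRQ" "fresh X i" and pc: "pc (loc s t) \<noteq> Idle"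
    and n: "mem s (curr (loc s t)) = Some n"
    and r: "r = RV (if nkey n = K (kk (loc s t)) then Some (nval n) else None)"
    and op: "\<And>p. (\<exists>w. r = RV w \<and> know X (kk (loc s t)) p w) \<Longrightarrow> linok X (op_of (gh X) i) p r"
    and u: "\<And>k v. op_of (gh X) i = Insert k v \<Longrightarrow> r \<noteq> RV None" "\<And>k v. op_of (gh X) i = Remove k \<Longrightarrow> r \<noteq> RV (Some v)"
    and l': "pc l' = Ret" "retv l' = r"
  shows "Sinv (setl t l' s)"
proof -
  let ?l = "loc s t"
  obtain p where p: "ht X i < p" "Firm X p (pred ?l) (curr ?l)" using T by (auto simp: PF_def)
  have "ky X (pred ?l) < K (kk ?l)" "K (kk ?l) \<le> ky X (curr ?l)"
    using T CF_fkey[of i ?l] by (auto simp: PF_def PB_def)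
  note k = firm_know[OF p(2) this]
  have "gm X (curr ?l) = Some n" using n core by simp
  note a = acc[OF this]
  have "linok X (op_of (gh X) i) p r" using k a r op by auto
  then show ?thesis using lin_step[OF pc T(3) p(1) _ _ u l'] p(2) by (simp add: Firm_def)
qed

text \<open>The nodes from the victim to \<open>tcurr l\<close> are marked or flagged, hence frozen,
  so the chain seen by trim is still the one in memory when the compare-and-swap on
  \<open>pred l\<close> succeeds.\<close>

lemma trim_step:
  assumes pc: "pc (loc s t) = T_cas" and n: "mem s (pred (loc s t)) = Some n" "nnext n = unm (tvictim (loc s t))"
  shows "Sinv (setl t ((loc s t)\<lparr>pc := T_nts1\<rparr>) (setn (pred (loc s t)) (n\<lparr>nnext := unm (tnew (loc s t))\<rparr>) s))"
proof -
  let ?l = "loc s t"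
  have T: "act X t i" "TB X i ?l" "pflag (nx X (tcurr ?l))" "tsucc ?l = rf X (tcurr ?l)" "\<forall>a. tsucc ?l = Some a \<longrightarrow> cm X a"
      and pv: "priv X t (tnew ?l) \<lparr>nts = BOT, nkey = ky X (tcurr ?l), nval = vl X (tcurr ?l), nnext = Ptr (tsucc ?l) False False,
                nprior = Some (tvictim ?l)\<rparr>"
    using TI[of t] pc by (auto simp: TI_def TI0_def)
  obtain ms where tp: "TP X ?l ms" and B: "CF X i ?l" "PB X ?l" "cm X (pred ?l)" "lkd X (tcurr ?l)"
    using T(2) by (auto simp: TB_def)
  let ?C = "ms @ [tcurr ?l]"
  have ct: "cm X (tcurr ?l)" using frozen_cm[OF B(4)] T(3) by (simp add: mf_def)
  have cms: "\<forall>a\<in>set ms. cm X a" using tp frozen_cm by (auto simp: TP_def mf_def)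
  have acp: "rf X (pred ?l) = Some (tvictim ?l)" using acc[of X "pred ?l" n] n core by (simp add: unm_def)
  have inc: "ky X (hd xs) \<le> ky X (last xs)" if "successively (lnk X) xs" "\<forall>a\<in>set xs. lkd X a" "xs \<noteq> []" for xs
    using that
  proof (induction xs)
    case (Cons a xs)
    show ?case
    proof (cases xs)
      case (Cons b ys)
      then have "ky X a < ky X b" using Cons.prems nextL[of a b] by (auto simp: lnk_def)
      moreover have "ky X b \<le> ky X (last xs)" using Cons.IH Cons.prems Cons by auto
      ultimately show ?thesis using Cons by auto
    qed simp
  qed simp
  have "ky X (tvictim ?l) \<le> ky X (tcurr ?l)" using inc[of ?C] tp cms cm_lkd B(4) by (auto simp: TP_def)
  then have kn: "ky X (pred ?l) < ky X (tcurr ?l)" using nextL[OF cm_lkd[OF B(3)] acp] by auto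
  have W: "successively (lnk X) (?C @ (case tsucc ?l of None \<Rightarrow> [] | Some x \<Rightarrow> [x]))"
    using tp T(4)[symmetric] by (cases "tsucc ?l") (auto simp: TP_def successively_append_iff lnk_def)
  show ?thesis
  proof (rule link_step[OF _ B(3) n pv refl _ _ W])
    show "hd (?C @ (case tsucc ?l of None \<Rightarrow> [] | Some x \<Rightarrow> [x])) = tvictim ?l" using tp by (auto simp: TP_def hd_append split: if_splits)
    show "ky X (tcurr ?l) < ky X x" if "tsucc ?l = Some x" for x using that nextL[OF B(4)] T(4) by simp
    show "ky X (tcurr ?l) = PInf" if "tsucc ?l = None" using that nextN[OF B(4)] T(4) by simp
    fix Y assume y: "ext X Y t" "hinv Y" "act Y t i" "?C \<noteq> [] \<Longrightarrow> fresh X i \<Longrightarrow> fresh Y i" "lkd Y (tnew ?l)"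
    interpret e: ext X Y t by (rule y)
    show "TI0 Y t i (?l\<lparr>pc := T_nts1\<rparr>)"
      using e.CF'[OF T(1) _ B(1)] e.PB'[OF B(2)] e.sD(9)[OF B(3)] y by (auto simp: TI0_def PB_def)
  qed (use pc kn T ct cms tp in \<open>auto simp: TP_def split: option.splits\<close>)
qed

lemma ins_step:
  assumes pc: "pc (loc s t) = I_cas" and n: "mem s (pred (loc s t)) = Some n" "nnext n = unm (curr (loc s t))"
  shows "Sinv (setl t ((loc s t)\<lparr>pc := I_ts1\<rparr>) (setn (pred (loc s t)) (n\<lparr>nnext := unm (newN (loc s t))\<rparr>) s))"
proof -
  let ?l = "loc s t"
  have T: "act X t i" "caller ?l = CIns" "CF X i ?l" "cm X (pred ?l)" "cm X (curr ?l)" "ky X (pred ?l) < K (kk ?l)" "K (kk ?l) < ky X (curr ?l)"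
    and pv: "priv X t (newN ?l) \<lparr>nts = BOT, nkey = K (kk ?l), nval = vv ?l, nnext = Ptr (Some (curr ?l)) False False, nprior = Some (curr ?l)\<rparr>"
    using TI[of t] pc by (auto simp: TI_def TI0_def unm_def)
  show ?thesis
  proof (rule link_step[OF _ T(4) n pv, of "[curr ?l]" "[]"])
    fix Y :: "('k, 'v) gx" assume y: "([] :: addr list) = [] \<Longrightarrow> org Y (newN ?l) = Some i" "lkd Y (newN ?l)"
    show "TI0 Y t i (?l\<lparr>pc := I_ts1\<rparr>)" using y by (simp add: TI0_def)
  qed (use pc T in \<open>auto simp: CF_def\<close>)
qed

end

lemma find_CF: "FL X i l \<Longrightarrow> CF X i l" "FC X i l \<Longrightarrow> CF X i l" "TB X i l \<Longrightarrow> CF X i l" "PF X i l \<Longrightarrow> CF X i l"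
  by (simp_all add: FL_def FC_def TB_def PF_def)

lemma VB_unm: "VB X i l v r \<Longrightarrow> predNext l = unm w \<Longrightarrow> v = w"
  by (simp add: VB_def unm_def)

context st
begin

lemmas T0 = TI[of t, unfolded TI_def]

lemma tstep_Sinv:
  assumes "tstep t s s'"
  shows "Sinv s'"
  using assms
proof cases
  case (inv_ins l k v)
  show ?thesis unfolding inv_ins(1)
    by (rule inv_step) (use inv_ins in \<open>auto simp: TI0_def CF_def\<close>)
next
  case (inv_rem l k)
  show ?thesis unfolding inv_rem(1)
    by (rule inv_step) (use inv_rem in \<open>auto simp: TI0_def CF_def\<close>)
next
  case (inv_con l k)
  show ?thesis unfolding inv_con(1)
    by (rule inv_step) (use inv_con in \<open>auto simp: TI0_def CF_def\<close>)
next
  case (inv_rq l a b)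
  show ?thesis unfolding inv_rq(1)
    by (rule inv_step) (use inv_rq in \<open>auto simp: TI0_def\<close>)
next
  case (ret l)
  show ?thesis using ret_step ret by auto
next
  case (f_retry l n c)
  show ?thesis unfolding f_retry(1)
  proof (rule local_step[OF f_retry(2,3)])
    fix Y :: "('k, 'v) gx" and r
    assume Y: "hinv Y" "gm Y = mem s" "act Y t i" "TI0 Y t i l" "obs Y i r"
    interpret Y: hinv Y by fact
    let ?l = "l\<lparr>pc := F_loop1, pred := head, predNext := nnext n, curr := c\<rparr>"
    have a: "nx Y head = nnext n" using acc[of Y head n] f_retry Y by simp
    have CF: "CF Y i l" using Y f_retry by (simp add: TI0_def)
    have "VB Y i ?l c r" "lkd Y c"
      using Y.read_VB[of i ?l r c] CF Y a Y.head Y.cm_lkd f_retry by auto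
    moreover have "caller l \<noteq> CRQ \<longrightarrow> NInf < fkey l" using Y.CF_fkey[OF CF] by auto
    ultimately show "TI0 Y t i ?l" using CF Y.head Y.cm_lkd by (auto simp: TI0_def FL_def PB_def)
  qed simp
next
  case (f_loop1 l n)
  show ?thesis unfolding f_loop1(1)
  proof (rule local_step[OF f_loop1(2,3)])
    fix Y :: "('k, 'v) gx" and r
    assume Y: "hinv Y" "gm Y = mem s" "act Y t i" "TI0 Y t i l"
    interpret Y: hinv Y by fact
    have a: "nx Y (curr l) = nnext n" using acc[of Y "curr l" n] f_loop1 Y by simp
    have FL: "FL Y i l" using Y f_loop1 by (simp add: TI0_def)
    then have "\<not> mf (nnext n) \<Longrightarrow> NC l" using Y.NC_unmarked[of i l] a by (simp add: FL_def)
    then show "TI0 Y t i (l\<lparr>pc := (if mf (nnext n) then F_loop2 else F_cmp)\<rparr>)" using FL by (auto simp: TI0_def)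
  qed simp
next
  case (f_loop2 l n)
  show ?thesis unfolding f_loop2(1)
  proof (rule local_step[OF f_loop2(2,3)])
    fix Y :: "('k, 'v) gx" and r
    assume Y: "hinv Y" "gm Y = mem s" "act Y t i" "TI0 Y t i l"
    interpret Y: hinv Y by fact
    have a: "rf Y (curr l) = pref (nnext n)" using acc[of Y "curr l" n] f_loop2 Y by simp
    have FL: "FL Y i l" using Y f_loop2 by (simp add: TI0_def)
    then have "pref (nnext n) = None \<Longrightarrow> NC l" using Y.NC_last[of i l] a by (simp add: FL_def)
    then show "TI0 Y t i (l\<lparr>pc := (if pref (nnext n) = None then F_cmp else F_loop3)\<rparr>)" using FL by (auto simp: TI0_def)
  qed simp
next
  case (f_loop3 l n c)
  show ?thesis unfolding f_loop3(1)
  proof (rule local_step[OF f_loop3(2,3)])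
    fix Y :: "('k, 'v) gx" and r
    assume Y: "hinv Y" "gm Y = mem s" "act Y t i" "TI0 Y t i l"
    interpret Y: hinv Y by fact
    have a: "rf Y (curr l) = Some c" using acc[of Y "curr l" n] f_loop3 Y by simp
    have FL: "FL Y i l" using Y f_loop3 by (simp add: TI0_def)
    then have "lkd Y c" using Y.nextL[OF _ a] by (simp add: FL_def)
    then show "TI0 Y t i (l\<lparr>pc := F_loop1, curr := c\<rparr>)" using FL by (auto simp: TI0_def FL_def)
  qed simp
next
  case (f_cmp l n)
  show ?thesis unfolding f_cmp(1)
  proof (rule local_step[OF f_cmp(2,3)])
    fix Y :: "('k, 'v) gx" and r
    assume Y: "gm Y = mem s" "TI0 Y t i l"
    have a: "ky Y (curr l) = nkey n" using acc[of Y "curr l" n] f_cmp Y by simp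
    have FL: "FL Y i l \<and> NC l" using Y f_cmp by (simp add: TI0_def)
    then show "TI0 Y t i (if ek_le (fkey l) (nkey n) then l\<lparr>pc := F_ts1\<rparr> else l\<lparr>pc := F_adv, pred := curr l\<rparr>)"
      using a by (auto simp: TI0_def FL_def PB_def)
  qed simp
next
  case (f_adv l n c)
  show ?thesis unfolding f_adv(1)
  proof (rule local_step[OF f_adv(2,3)])
    fix Y :: "('k, 'v) gx" and r
    assume Y: "hinv Y" "gm Y = mem s" "act Y t i" "TI0 Y t i l" "obs Y i r"
    interpret Y: hinv Y by fact
    let ?l = "l\<lparr>pc := F_loop1, predNext := nnext n, curr := c\<rparr>"
    have a: "nx Y (pred l) = nnext n" using acc[of Y "pred l" n] f_adv Y by simp
    have CF: "CF Y i l" "PB Y l" using Y f_adv by (simp_all add: TI0_def)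
    have "\<not> mf (nnext n) \<Longrightarrow> VB Y i ?l c r \<and> lkd Y c"
      using Y.read_VB[of i ?l r c] CF Y a f_adv by (auto simp: PB_def)
    then show "TI0 Y t i (if mf (nnext n) then l\<lparr>pc := F_retry, predNext := nnext n\<rparr> else ?l)"
      using CF by (auto simp: TI0_def FL_def PB_def)
  qed simp
next
  case (f_ts1 l)
  show ?thesis unfolding f_ts1(1)
    by (rule tsv_step[OF f_ts1(2,3), of "pred l"]) (use f_ts1 in \<open>auto simp: TI0_def FL_def PB_def\<close>)
next
  case (f_ts2 l n)
  show ?thesis unfolding f_ts2(1)
    by (rule cas_step[OF f_ts2(2,3)]) (use f_ts2 T0 in \<open>auto simp: TI0_def\<close>)
next
  case (f_chk_eq l)
  show ?thesis unfolding f_chk_eq(1)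
  proof (rule local_step[OF f_chk_eq(2,3)])
    fix Y :: "('k, 'v) gx" and r
    assume Y: "TI0 Y t i l"
    have T: "FL Y i l" "NC l" "fkey l \<le> ky Y (curr l)" "cm Y (pred l)" using Y f_chk_eq by (auto simp: TI0_def)
    obtain v r where v: "VB Y i l v r" using T by (auto simp: FL_def)
    then have "v = curr l" using VB_unm f_chk_eq by blast
    then show "TI0 Y t i (l\<lparr>pc := F_cts1\<rparr>)" using T v by (auto simp: TI0_def FC_def FL_def)
  qed simp
next
  case (f_chk_ne l v)
  show ?thesis unfolding f_chk_ne(1)
  proof (rule local_step[OF f_chk_ne(2,3)])
    fix Y :: "('k, 'v) gx" and r
    assume Y: "TI0 Y t i l"
    have T: "FL Y i l" "cm Y (pred l)" using Y f_chk_ne by (auto simp: TI0_def)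
    obtain w r where w: "VB Y i l w r" using T by (auto simp: FL_def)
    then have "lkd Y v" "v \<noteq> head" using f_chk_ne(5) by (auto simp: VB_def unm_def)
    moreover have "TP Y (l\<lparr>pc := T_loop, tvictim := v, tcurr := v\<rparr>) []" by (simp add: TP_def)
    then have "\<exists>ms. TP Y (l\<lparr>pc := T_loop, tvictim := v, tcurr := v\<rparr>) ms" by blast
    ultimately show "TI0 Y t i (l\<lparr>pc := T_loop, tvictim := v, tcurr := v\<rparr>)" using T
      unfolding TI0_def TB_def by (simp add: FL_def)
  qed simp
next
  case (f_aftertrim l n c)
  show ?thesis unfolding f_aftertrim(1)
  proof (rule local_step[OF f_aftertrim(2,3)])
    fix Y :: "('k, 'v) gx" and r
    assume Y: "hinv Y" "gm Y = mem s" "act Y t i" "TI0 Y t i l" "obs Y i r"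
    interpret Y: hinv Y by fact
    let ?l = "l\<lparr>pc := F_recheck, predNext := nnext n, curr := c\<rparr>"
    have a: "nx Y (pred l) = nnext n" using acc[of Y "pred l" n] f_aftertrim Y by simp
    have CF: "CF Y i l" "PB Y l" "cm Y (pred l)" using Y f_aftertrim by (simp_all add: TI0_def)
    have "\<not> mf (nnext n) \<Longrightarrow> VB Y i ?l c r \<and> lkd Y c"
      using Y.read_VB[of i ?l r c] CF Y a f_aftertrim by (auto simp: PB_def)
    then show "TI0 Y t i (if mf (nnext n) then l\<lparr>pc := F_retry, predNext := nnext n\<rparr> else ?l)"
      using CF by (auto simp: TI0_def FC_def PB_def)
  qed simp
next
  case (f_recheck l n)
  show ?thesis unfolding f_recheck(1)
  proof (rule local_step[OF f_recheck(2,3)])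
    fix Y :: "('k, 'v) gx" and r
    assume Y: "hinv Y" "gm Y = mem s" "act Y t i" "TI0 Y t i l"
    interpret Y: hinv Y by fact
    have a: "nx Y (curr l) = nnext n" "ky Y (curr l) = nkey n" using acc[of Y "curr l" n] f_recheck Y by simp_all
    have FC: "FC Y i l" using Y f_recheck by (simp add: TI0_def)
    then have "\<not> mf (nnext n) \<Longrightarrow> NC l" using Y.NC_unmarked[of i l] a by (simp add: FC_def)
    then show "TI0 Y t i (l\<lparr>pc := (if mf (nnext n) \<or> ek_lt (nkey n) (fkey l) then F_retry else F_cts1)\<rparr>)"
      using FC a find_CF(2)[OF FC] by (auto simp: TI0_def)
  qed simp
next
  case (f_cts1 l)
  show ?thesis unfolding f_cts1(1)
    by (rule tsv_step[OF f_cts1(2,3), of "curr l"]) (use f_cts1 in \<open>auto simp: TI0_def FC_def\<close>)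
next
  case (f_cts2 l n)
  show ?thesis unfolding f_cts2(1)
  proof (rule cas_step[OF f_cts2(2,3)])
    show "mem s (curr l) = Some n" "tsok X (curr l) (tsv l)" using f_cts2 T0 by (auto simp: TI0_def)
    fix Y :: "('k, 'v) gx"
    assume Y: "hinv Y" "TI0 Y t i l" "cm Y (curr l)"
    interpret Y: hinv Y by fact
    have "PF Y i l" using Y.FC_PF[of i l] Y f_cts2 by (simp add: TI0_def)
    then have "PF Y i (l\<lparr>pc := find_ret (caller l)\<rparr>)" by simp
    then show "TI0 Y t i (l\<lparr>pc := find_ret (caller l)\<rparr>)" by (cases "caller l") (simp_all add: TI0_def)
  qed simp
next
  case (t_loop l n)
  show ?thesis unfolding t_loop(1)
  proof (rule local_step[OF t_loop(2,3)])
    fix Y :: "('k, 'v) gx" and r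
    assume Y: "gm Y = mem s" "TI0 Y t i l"
    have a: "nx Y (tcurr l) = nnext n" using acc[of Y "tcurr l" n] t_loop Y by simp_all
    show "TI0 Y t i (l\<lparr>pc := (if pmark (nnext n) then T_loop2 else T_ts1)\<rparr>)" using Y t_loop a  by (auto simp: TI0_def)
  qed simp
next
  case (t_loop2 l n c)
  show ?thesis unfolding t_loop2(1)
  proof (rule local_step[OF t_loop2(2,3)])
    fix Y :: "('k, 'v) gx" and r
    assume Y: "hinv Y" "gm Y = mem s" "TI0 Y t i l"
    interpret Y: hinv Y by fact
    have T: "TB Y i l" "pmark (nx Y (tcurr l))" using Y t_loop2 by (simp_all add: TI0_def)
    have a: "rf Y (tcurr l) = Some c" using acc[of Y "tcurr l" n] t_loop2 Y by simp
    obtain ms where ms: "TP Y l ms" using T by (auto simp: TB_def)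
    have lt: "lkd Y (tcurr l)" using T by (simp add: TB_def)
    have "TP Y (l\<lparr>pc := T_loop, tcurr := c\<rparr>) (ms @ [tcurr l])"
      using ms T a lt by (auto simp: TP_def successively_append_iff lnk_def hd_append)
    then show "TI0 Y t i (l\<lparr>pc := T_loop, tcurr := c\<rparr>)" using T Y.nextL[OF lt a] Y.not_head[OF lt a]
      by (auto simp: TI0_def TB_def PB_def)
  qed simp
next
  case (t_ts1 l)
  show ?thesis unfolding t_ts1(1)
    by (rule tsv_step[OF t_ts1(2,3), of "tcurr l"]) (use t_ts1 in \<open>auto simp: TI0_def TB_def\<close>)
next
  case (t_ts2 l n)
  show ?thesis unfolding t_ts2(1)
    by (rule cas_step[OF t_ts2(2,3)]) (use t_ts2 T0 in \<open>auto simp: TI0_def\<close>)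
next
  case (t_flag1 l n)
  show ?thesis unfolding t_flag1(1)
    by (rule local_step[OF t_flag1(2,3)]) (use t_flag1 in \<open>auto simp: TI0_def\<close>)
next
  case (t_flag2 l n)
  show ?thesis
  proof (cases "nnext n = tp l")
    case True
    have T: "TB X i l" "cm X (tcurr l)" "\<not> mf (tp l)" using T0 t_flag2 by (auto simp: TI0_def)
    then have "tcurr l \<noteq> head" by (simp add: TB_def)
    have "Sinv (setl t (l\<lparr>pc := T_succ\<rparr>) (setn (tcurr l) (n\<lparr>nnext := Ptr (pref (nnext n)) (pmark (nnext n)) True\<rparr>) s))"
      by (rule flag_step[OF t_flag2(2,3)]) (use t_flag2 T True \<open>tcurr l \<noteq> head\<close> in \<open>auto simp: TI0_def\<close>)
    then show ?thesis using t_flag2 True by simp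
  next
    case False
    have "Sinv (setl t (l\<lparr>pc := T_chkflag\<rparr>) s)"
      by (rule local_step[OF t_flag2(2,3)]) (use t_flag2 in \<open>auto simp: TI0_def\<close>)
    then show ?thesis using t_flag2 False by simp
  qed
next
  case (t_chkflag l n)
  show ?thesis unfolding t_chkflag(1)
  proof (rule local_step[OF t_chkflag(2,3)])
    fix Y :: "('k, 'v) gx" and r
    assume Y: "gm Y = mem s" "TI0 Y t i l"
    have a: "nx Y (tcurr l) = nnext n" using acc[of Y "tcurr l" n] t_chkflag Y by simp_all
    show "TI0 Y t i (l\<lparr>pc := (if pflag (nnext n) then T_succ else F_retry)\<rparr>)" using Y t_chkflag a find_CF(3)[of Y i l] by (auto simp: TI0_def)
  qed simp
next
  case (t_succ l n)
  show ?thesis unfolding t_succ(1)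
  proof (rule local_step[OF t_succ(2,3)])
    fix Y :: "('k, 'v) gx" and r
    assume Y: "gm Y = mem s" "TI0 Y t i l"
    have a: "rf Y (tcurr l) = pref (nnext n)" using acc[of Y "tcurr l" n] t_succ Y by simp_all
    show "TI0 Y t i (l\<lparr>pc := (if pref (nnext n) = None then T_alloc else T_sts1), tsucc := pref (nnext n)\<rparr>)" using Y t_succ a  by (auto simp: TI0_def)
  qed simp
next
  case (t_sts1 l)
  show ?thesis unfolding t_sts1(1)
  proof (rule local_step[OF t_sts1(2,3)])
    fix Y :: "('k, 'v) gx" and r
    assume Y: "hinv Y" "gG Y = gts s" "TI0 Y t i l"
    interpret Y: hinv Y by fact
    have T: "TB Y i l" "pflag (nx Y (tcurr l))" "tsucc l = rf Y (tcurr l)" "rf Y (tcurr l) \<noteq> None"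
      using Y t_sts1 by (auto simp: TI0_def)
    then have "lkd Y (the (tsucc l))" using Y.nextL[of "tcurr l"] by (auto simp: TB_def)
    then have "tsok Y (the (tsucc l)) (gts s)" using Y.tsok_now Y by metis
    then show "TI0 Y t i (l\<lparr>pc := T_sts2, tsv := gts s\<rparr>)" using T by (auto simp: TI0_def TB_def TP_def PB_def)
  qed simp
next
  case (t_sts2 l a n)
  show ?thesis unfolding t_sts2(1)
    by (rule cas_step[OF t_sts2(2,3)]) (use t_sts2 T0 in \<open>auto simp: TI0_def\<close>)
next
  case (t_alloc l n a)
  show ?thesis unfolding t_alloc(1)
  proof (rule alloc_step[OF t_alloc(2,3)])
    show "mem s a = None" using t_alloc by auto
    fix Y :: "('k, 'v) gx"
    assume Y: "TI0 Y t i l" "\<And>b. mem s b \<noteq> None \<Longrightarrow> gm Y b = mem s b"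
      "priv Y t a \<lparr>nts = BOT, nkey = nkey n, nval = nval n, nnext = Ptr (tsucc l) False False, nprior = Some (tvictim l)\<rparr>"
    have "gm Y (tcurr l) = Some n" using Y(2) t_alloc by simp
    then have "ky Y (tcurr l) = nkey n" "vl Y (tcurr l) = nval n" using acc[of Y "tcurr l" n] by simp_all
    then show "TI0 Y t i (l\<lparr>pc := T_cas, tnew := a\<rparr>)" using Y t_alloc by (auto simp: TI0_def)
  qed simp
next
  case (t_cas l n)
  show ?thesis
  proof (cases "nnext n = unm (tvictim l)")
    case True then show ?thesis using trim_step t_cas by auto
  next
    case False
    have "Sinv (setl t (l\<lparr>pc := F_retry\<rparr>) s)"
      by (rule local_step[OF t_cas(2,3)]) (use t_cas in \<open>auto simp: TI0_def TB_def\<close>)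
    then show ?thesis using t_cas False by simp
  qed
next
  case (t_nts1 l)
  show ?thesis unfolding t_nts1(1)
    by (rule tsv_step[OF t_nts1(2,3), of "tnew l"]) (use t_nts1 in \<open>auto simp: TI0_def PB_def\<close>)
next
  case (t_nts2 l n)
  show ?thesis unfolding t_nts2(1)
    by (rule cas_step[OF t_nts2(2,3)]) (use t_nts2 T0 in \<open>auto simp: TI0_def PB_def\<close>)
next
  case (i_found l n)
  have T: "PF X i l" "caller l = CIns" using T0 i_found by (auto simp: TI0_def)
  then have "op_of (gh X) i = Insert (kk l) (vv l)" "fresh X i" by (auto simp: PF_def CF_def)
  then show ?thesis unfolding i_found(1)
    by (intro lookup_step[of n "RV (Some (nval n))"]) (use T i_found in \<open>auto simp: linok_def\<close>)
next
  case (i_alloc l n a)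
  show ?thesis unfolding i_alloc(1)
  proof (rule alloc_step[OF i_alloc(2,3)])
    show "mem s a = None" using i_alloc by auto
    fix Y :: "('k, 'v) gx"
    assume Y: "hinv Y" "TI0 Y t i l" "\<And>b. mem s b \<noteq> None \<Longrightarrow> gm Y b = mem s b"
      "priv Y t a \<lparr>nts = BOT, nkey = K (kk l), nval = vv l, nnext = unm (curr l), nprior = Some (curr l)\<rparr>"
    have T: "PF Y i l" "caller l = CIns" using Y i_alloc by (auto simp: TI0_def)
    have "gm Y (curr l) = Some n" using Y(3) i_alloc by simp
    then have "ky Y (curr l) \<noteq> K (kk l)" using acc[of Y "curr l" n] i_alloc by simp
    then show "TI0 Y t i (l\<lparr>pc := I_cas, newN := a\<rparr>)"
      using T Y by (auto simp: TI0_def PF_def PB_def CF_def)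
  qed simp
next
  case (i_cas l n)
  show ?thesis
  proof (cases "nnext n = unm (curr l)")
    case True then show ?thesis using ins_step i_cas by auto
  next
    case False
    have "Sinv (setl t (l\<lparr>pc := F_retry\<rparr>) s)"
      by (rule local_step[OF i_cas(2,3)]) (use i_cas in \<open>auto simp: TI0_def\<close>)
    then show ?thesis using i_cas False by simp
  qed
next
  case (i_ts1 l)
  show ?thesis unfolding i_ts1(1)
    by (rule tsv_step[OF i_ts1(2,3), of "newN l"]) (use i_ts1 in \<open>auto simp: TI0_def\<close>)
next
  case (i_ts2 l n)
  show ?thesis unfolding i_ts2(1)
  proof (rule cas_step[OF i_ts2(2,3)])
    show "mem s (newN l) = Some n" "tsok X (newN l) (tsv l)" using i_ts2 T0 by (auto simp: TI0_def)
    fix Y :: "('k, 'v) gx"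
    assume Y: "hinv Y" "TI0 Y t i l" "cm Y (newN l)"
    interpret Y: hinv Y by fact
    have "org Y (newN l) = Some i" using Y i_ts2 by (simp add: TI0_def)
    then show "TI0 Y t i (l\<lparr>pc := Ret, retv := RV None\<rparr>)" using Y.h_org[of "newN l" i] Y(3) by (auto simp: TI0_def)
  qed simp
next
  case (r_after l n)
  show ?thesis
  proof (cases "nkey n = K (kk l)")
    case True
    have "Sinv (setl t (l\<lparr>pc := R_mark1, rcurr := curr l\<rparr>) s)"
    proof (rule local_step[OF r_after(2,3)])
      fix Y :: "('k, 'v) gx" and r
      assume Y: "gm Y = mem s" "TI0 Y t i l"
      have a: "ky Y (curr l) = K (kk l)" using acc[of Y "curr l" n] r_after Y True by simp
      have "PF Y i l" "caller l = CRem1" using Y r_after by (auto simp: TI0_def)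
      then show "TI0 Y t i (l\<lparr>pc := R_mark1, rcurr := curr l\<rparr>)" using a by (simp add: TI0_def PF_def CF_def)
    qed simp
    then show ?thesis using r_after True by simp
  next
    case False
    have T: "PF X i l" "caller l = CRem1" using T0 r_after by (auto simp: TI0_def)
    then have "op_of (gh X) i = Remove (kk l)" "fresh X i" by (auto simp: PF_def CF_def)
    then have "Sinv (setl t (l\<lparr>pc := Ret, retv := RV None\<rparr>) s)"
      by (intro lookup_step[of n "RV None"]) (use T r_after False in \<open>auto simp: linok_def\<close>)
    then show ?thesis using r_after False by simp
  qed
next
  case (r_mark1 l n)
  show ?thesis unfolding r_mark1(1)
    by (rule local_step[OF r_mark1(2,3)]) (use r_mark1 in \<open>auto simp: TI0_def\<close>)
next
  case (r_mark2 l n)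
  show ?thesis
  proof (cases "nnext n = tp l")
    case True then show ?thesis using mark_step r_mark2 by auto
  next
    case False
    have "Sinv (setl t (l\<lparr>pc := F_retry\<rparr>) s)"
      by (rule local_step[OF r_mark2(2,3)]) (use r_mark2 in \<open>auto simp: TI0_def\<close>)
    then show ?thesis using r_mark2 False by simp
  qed
next
  case (r_done l n)
  show ?thesis unfolding r_done(1)
  proof (rule local_step[OF r_done(2,3)])
    fix Y :: "('k, 'v) gx" and r
    assume Y: "hinv Y" "gm Y = mem s" "TI0 Y t i l"
    interpret Y: hinv Y by fact
    have "vl Y (rcurr l) = nval n" using acc[of Y "rcurr l" n] r_done Y by simp
    then show "TI0 Y t i (l\<lparr>pc := Ret, retv := RV (Some (nval n))\<rparr>)"
      using Y.done_lin[of i l] Y r_done by (auto simp: TI0_def)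
  qed simp
next
  case (c_after l n)
  have T: "PF X i l" "caller l = CCon" using T0 c_after by (auto simp: TI0_def)
  then have "op_of (gh X) i = Contains (kk l)" "fresh X i" by (auto simp: PF_def CF_def)
  then show ?thesis unfolding c_after(1)
    by (intro lookup_step[of n "if nkey n \<noteq> K (kk l) then RV None else RV (Some (nval n))"])
      (use T c_after in \<open>auto simp: linok_def\<close>)
next
  case (q_start l)
  show ?thesis unfolding q_start(1)
  proof (rule gts_step[OF q_start(2,3)])
    fix Y :: "('k, 'v) gx"
    assume Y: "hinv Y" "gG Y = Suc (gts s)" "TI0 Y t i l" "ht Y i < Pt (Suc (gts s)) 0"
    have "2 \<le> gts s" using G_ge core by simp
    then show "TI0 Y t i (l\<lparr>pc := F_retry, caller := CRQ, rts := gts s, currKey := K (lo l), fkey := K (lo l)\<rparr>)"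
      using Y q_start by (auto simp: TI0_def CF_def RQ_def prq_def)
  qed simp
next
  case (q_after l n)
  show ?thesis unfolding q_after(1)
    by (rule local_step[OF q_after(2,3)]) (use q_after in \<open>auto simp: TI0_def PF_def prq_def\<close>)
next
  case (q_w1 l n p)
  show ?thesis unfolding q_w1(1)
  proof (rule local_step[OF q_w1(2,3)])
    fix Y :: "('k, 'v) gx" and r
    assume Y: "hinv Y" "gm Y = mem s" "TI0 Y t i l"
    interpret Y: hinv Y by fact
    have a: "ts Y (pred l) = nts n" "pr Y (pred l) = nprior n" using acc[of Y "pred l" n] q_w1 Y by simp_all
    have T: "caller l = CRQ" "CF Y i l" "cm Y (pred l)" "NR Y (prq l) (pred l)" using Y q_w1 by (auto simp: TI0_def)
    have r2: "2 \<le> rts l" using Y.CF_RQ T by (auto simp: RQ_def)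
    note sp = Y.stp_prq[OF r2 T(3)]
    show "TI0 Y t i (if rts l < nts n then l\<lparr>pc := Q_w1, pred := p\<rparr> else l\<lparr>pc := Q_chk\<rparr>)"
    proof (cases "rts l < nts n")
      case True
      then have p: "pr Y (pred l) = Some p" "prq l < stp Y (pred l)" using q_w1 a sp by auto
      then have "cm Y p" "NR Y (prq l) p" using Y.prior_NR[OF T(3) p] Y.prior[OF Y.cm_lkd[OF T(3)] p(1)] by auto
      then show ?thesis using T True by (simp add: TI0_def prq_def)
    next
      case False
      then show ?thesis using T sp a by (simp add: TI0_def aliveF_def prq_def)
    qed
  qed simp
next
  case (q_chk l n)
  show ?thesis unfolding q_chk(1)
  proof (rule local_step[OF q_chk(2,3)])
    fix Y :: "('k, 'v) gx" and r
    assume Y: "hinv Y" "gm Y = mem s" "TI0 Y t i l"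
    have a: "ky Y (pred l) = nkey n" using acc[of Y "pred l" n] q_chk Y by simp
    have T: "caller l = CRQ" "CF Y i l" "aliveF Y (prq l) (pred l)" using Y q_chk by (auto simp: TI0_def)
    \<comment> \<open>Vacuous coverage: no key from \<open>lo l\<close> on lies below the starting
      node.\<close>
    have C: "nkey n \<le> K (lo l) \<Longrightarrow> COV Y (l\<lparr>pc := Q_s1, curr := pred l\<rparr>)"
      using a T by (auto simp: COV_def CF_def dest: order_less_le_trans)
    show "TI0 Y t i (if ek_le (nkey n) (K (lo l)) then l\<lparr>pc := Q_s1, curr := pred l\<rparr> else l\<lparr>pc := Q_rts\<rparr>)"
    proof (cases "nkey n \<le> K (lo l)")
      case True then show ?thesis using T C by (auto simp: TI0_def QB_def CF_def RQ_def prq_def)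
    next
      case False then show ?thesis using T by (auto simp: TI0_def)
    qed
  qed simp
next
  case (q_rts l)
  show ?thesis unfolding q_rts(1)
  proof (rule local_step[OF q_rts(2,3)])
    fix Y :: "('k, 'v) gx" and r
    assume Y: "gG Y = gts s" "TI0 Y t i l"
    have T: "caller l = CRQ" "CF Y i l" using Y q_rts by (auto simp: TI0_def)
    \<comment> \<open>The retry takes the clock value minus one without incrementing the clock. As
      \<open>Suc (rts l)\<close> does not exceed the clock, the new point is not before the old one,
      which comes after the invocation.\<close>
    have "ht Y i < Pt (Suc (gts s - Suc 0)) 0"
    proof -
      have "ht Y i < Pt (Suc (rts l)) 0" "Suc (rts l) \<le> gts s" using T Y by (auto simp: CF_def RQ_def prq_def)
      moreover then have "Pt (Suc (rts l)) 0 \<le> Pt (Suc (gts s - Suc 0)) 0" by auto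
      ultimately show ?thesis by order
    qed
    then show "TI0 Y t i (l\<lparr>pc := F_retry, caller := CRQ, rts := gts s - 1, fkey := currKey l\<rparr>)"
      using T Y by (auto simp: TI0_def CF_def RQ_def prq_def)
  qed simp
next
  case (q_s1 l n c)
  show ?thesis unfolding q_s1(1)
  proof (rule local_step[OF q_s1(2,3)])
    fix Y :: "('k, 'v) gx" and r
    assume Y: "hinv Y" "gm Y = mem s" "TI0 Y t i l"
    interpret Y: hinv Y by fact
    have a: "ky Y (curr l) = nkey n" "rf Y (curr l) = pref (nnext n)" using acc[of Y "curr l" n] q_s1 Y by simp_all
    have T: "QB Y i l" "COV Y l" "arr l = []" using Y q_s1 by (auto simp: TI0_def)
    show "TI0 Y t i (if ek_lt (nkey n) (K (lo l)) then l\<lparr>pc := Q_sts1, succ := c\<rparr> else l\<lparr>pc := Q_c1\<rparr>)"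
    proof (cases "nkey n < K (lo l)")
      case True
      then have c: "rf Y (curr l) = Some c" using a q_s1 by simp
      have al: "aliveF Y (prq l) (curr l)" "prq l < now Y" using T Y.RQ_now by (auto simp: QB_def)
      have "RE Y (curr l) c (prq l)" using Y.read_RE[OF al c] .
      moreover have "lkd Y c" using Y.nextL[OF Y.cm_lkd c] al by (simp add: aliveF_def)
      ultimately show ?thesis using True T a by (auto simp: TI0_def SB_def QB_def RQ_def prq_def)
    next
      case False then show ?thesis using T a by (auto simp: TI0_def COV_def QB_def RQ_def prq_def)
    qed
  qed simp
next
  case (q_sts1 l)
  show ?thesis unfolding q_sts1(1)
    by (rule tsv_step[OF q_sts1(2,3), of "succ l"]) (use q_sts1 in \<open>auto simp: TI0_def SB_def\<close>)
next
  case (q_sts2 l n)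
  show ?thesis unfolding q_sts2(1)
  proof (rule cas_step[OF q_sts2(2,3)])
    show "mem s (succ l) = Some n" "tsok X (succ l) (tsv l)" using q_sts2 T0 by (auto simp: TI0_def)
    fix Y :: "('k, 'v) gx"
    assume Y: "hinv Y" "TI0 Y t i l" "cm Y (succ l)"
    interpret Y: hinv Y by fact
    have "SW Y l" using Y.SB_SW Y q_sts2 by (auto simp: TI0_def)
    then show "TI0 Y t i (l\<lparr>pc := Q_s3\<rparr>)" using Y q_sts2 by (auto simp: TI0_def SW_def QB_def RQ_def prq_def)
  qed simp
next
  case (q_s3 l n p)
  show ?thesis unfolding q_s3(1)
  proof (rule local_step[OF q_s3(2,3)])
    fix Y :: "('k, 'v) gx" and r
    assume Y: "hinv Y" "gm Y = mem s" "TI0 Y t i l"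
    interpret Y: hinv Y by fact
    have a: "ts Y (succ l) = nts n" "pr Y (succ l) = nprior n" using acc[of Y "succ l" n] q_s3 Y by simp_all
    have T: "QB Y i l" "arr l = []" "ky Y (curr l) < K (lo l)" "SW Y l" using Y q_s3 by (auto simp: TI0_def)
    show "TI0 Y t i (if rts l < nts n then l\<lparr>pc := Q_s3, succ := p\<rparr> else l\<lparr>pc := Q_s1, curr := succ l\<rparr>)"
    proof (cases "rts l < nts n")
      case True
      then have "pr Y (succ l) = Some p" "rts l < ts Y (succ l)" using q_s3 a by auto
      from Y.SW_walk[OF T(1,4) this(2,1)] show ?thesis using T True by (auto simp: TI0_def SW_def QB_def RQ_def prq_def)
    next
      case False
      then have n: "ts Y (succ l) \<le> rts l" using a by simp
      show ?thesis using Y.COV_stop[OF T(1,4) n T(2,3)] Y.SW_stop[OF T(1,4) n] T False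
        by (auto simp: TI0_def COV_def QB_def RQ_def prq_def)
    qed
  qed simp
next
  case (q_c1_out l n)
  have T: "QB X i l" "COV X l" using T0 q_c1_out by (auto simp: TI0_def)
  have k: "ky X (curr l) = nkey n" using acc[of X "curr l" n] q_c1_out core by simp
  have hk: "K (hi l) < ky X (curr l)" using q_c1_out k by simp
  have kn: "know X k (prq l) (map_of (arr l) k)" if "lo l \<le> k" "k \<le> hi l" for k
  proof -
    have "K k < ky X (curr l)" using that(2) hk by (meson ekey_order(7) order_le_less_trans)
    then show ?thesis using T that by (simp add: COV_def)
  qed
  have o: "op_of (gh X) i = RangeQuery (lo l) (hi l)" "fresh X i" "ht X i < prq l" using T by (auto simp: QB_def RQ_def)
  have "linok X (op_of (gh X) i) (prq l) (RR (arr l))" using T kn o by (auto simp: linok_def COV_def)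
  moreover have "prq l < now X" using RQ_now T by (auto simp: QB_def)
  ultimately show ?thesis unfolding q_c1_out(1)
    by (intro lin_step[of "prq l" "RR (arr l)"]) (use q_c1_out o in auto)
next
  case (q_c1_in l n k c)
  show ?thesis unfolding q_c1_in(1)
  proof (rule local_step[OF q_c1_in(2,3)])
    fix Y :: "('k, 'v) gx" and r
    assume Y: "hinv Y" "gm Y = mem s" "TI0 Y t i l"
    interpret Y: hinv Y by fact
    have a: "ky Y (curr l) = K k" "vl Y (curr l) = nval n" "rf Y (curr l) = Some c" using acc[of Y "curr l" n] q_c1_in Y by simp_all
    have T: "QB Y i l" "COV Y l" "K (lo l) \<le> ky Y (curr l)" using Y q_c1_in by (auto simp: TI0_def)
    have al: "aliveF Y (prq l) (curr l)" "prq l < now Y" using T Y.RQ_now by (auto simp: QB_def)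
    have "RE Y (curr l) c (prq l)" using Y.read_RE[OF al a(3)] .
    moreover have "lkd Y c" using Y.nextL[OF Y.cm_lkd a(3)] al by (simp add: aliveF_def)
    ultimately show "TI0 Y t i (l\<lparr>pc := Q_cts1, arr := arr l @ [(k, nval n)], succ := c\<rparr>)"
      using Y.COV_COV2[OF T a(1) q_c1_in(6) a(2)] T a by (auto simp: TI0_def SB_def QB_def RQ_def prq_def COV2_def)
  qed simp
next
  case (q_cts1 l)
  show ?thesis unfolding q_cts1(1)
    by (rule tsv_step[OF q_cts1(2,3), of "succ l"]) (use q_cts1 in \<open>auto simp: TI0_def SB_def\<close>)
next
  case (q_cts2 l n)
  show ?thesis unfolding q_cts2(1)
  proof (rule cas_step[OF q_cts2(2,3)])
    show "mem s (succ l) = Some n" "tsok X (succ l) (tsv l)" using q_cts2 T0 by (auto simp: TI0_def)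
    fix Y :: "('k, 'v) gx"
    assume Y: "hinv Y" "TI0 Y t i l" "cm Y (succ l)"
    interpret Y: hinv Y by fact
    have "SW Y l" using Y.SB_SW Y q_cts2 by (auto simp: TI0_def)
    then show "TI0 Y t i (l\<lparr>pc := Q_c3\<rparr>)" using Y q_cts2 by (simp add: TI0_def SW_def QB_def RQ_def prq_def COV2_def)
  qed simp
next
  case (q_c3 l n p)
  show ?thesis unfolding q_c3(1)
  proof (rule local_step[OF q_c3(2,3)])
    fix Y :: "('k, 'v) gx" and r
    assume Y: "hinv Y" "gm Y = mem s" "TI0 Y t i l"
    interpret Y: hinv Y by fact
    have a: "ts Y (succ l) = nts n" "pr Y (succ l) = nprior n" using acc[of Y "succ l" n] q_c3 Y by simp_all
    have T: "QB Y i l" "COV2 Y l" "K (lo l) \<le> ky Y (curr l)" "SW Y l" using Y q_c3 by (auto simp: TI0_def)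
    show "TI0 Y t i (if rts l < nts n then l\<lparr>pc := Q_c3, succ := p\<rparr> else l\<lparr>pc := Q_c1, curr := succ l\<rparr>)"
    proof (cases "rts l < nts n")
      case True
      then have "pr Y (succ l) = Some p" "rts l < ts Y (succ l)" using q_c3 a by auto
      from Y.SW_walk[OF T(1,4) this(2,1)] show ?thesis using T True by (simp add: TI0_def SW_def QB_def RQ_def prq_def COV2_def)
    next
      case False
      then have n: "ts Y (succ l) \<le> rts l" using a by simp
      have "COV Y (l\<lparr>pc := Q_c1, curr := succ l\<rparr>)" using Y.COV2_stop[OF T(1,4) n T(2)] by (simp add: COV_def prq_def)
      moreover have "QB Y i (l\<lparr>pc := Q_c1, curr := succ l\<rparr>)" using T(1) Y.SW_stop[OF T(1,4) n] by (simp add: QB_def RQ_def prq_def)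
      ultimately show ?thesis using Y.SW_stop(3)[OF T(1,4) n] T(3) False by (auto simp: TI0_def)
    qed
  qed simp
qed

end

lemma tstep_Sinv':
  assumes "Sinv s" "tstep t s s'"
  shows "Sinv s'"
proof -
  obtain X where "st s X" using assms(1) by (auto simp: Sinv_def st_def)
  then interpret st s X t .
  show ?thesis using tstep_Sinv assms(2) .
qed

text \<open>Time starts at 1 to keep \<open>Pt c 0\<close> free of stamps for positive
  \<open>c\<close>; the stamps \<open>Pt 0 0\<close> put both sentinels in effect at every
  point.\<close>

definition init_gx :: "('k::linorder, 'v) gx" where
  "init_gx = \<lparr>gm = mem (init_state :: ('k, 'v) gstate), gG = 2, gh = [], tm = 1, gT = (\<lambda>k p. (head, tail)),
     stp = (\<lambda>a. Pt 0 0), lk = (\<lambda>a. if a = head \<or> a = tail then Some (Pt 0 0) else None), par = (\<lambda>a. 0),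
     chn = (\<lambda>a. []), rmv = (\<lambda>a. None), org = (\<lambda>a. None), mrk = (\<lambda>a. None), opi = (\<lambda>t. 0), ht = (\<lambda>j. Pt 0 0),
     lin = (\<lambda>i. None), own = (\<lambda>a. 0)\<rparr>"

lemma init_flds:
  "lkd init_gx a \<longleftrightarrow> a = head \<or> a = tail" "lkd init_gx a \<Longrightarrow> lkp init_gx a = Pt 0 0"
  "ky init_gx head = NInf" "ky init_gx tail = PInf" "ts init_gx head = 2" "ts init_gx tail = 2"
  "nx init_gx head = unm tail" "nx init_gx tail = NULL" "pr init_gx head = None" "pr init_gx tail = None"
  "stp init_gx a = Pt 0 0" "gT init_gx k p = (head, tail)" "rmv init_gx a = None" "now init_gx = Pt 2 1"
  "\<exists>y. gm init_gx head = Some y" "\<exists>y. gm init_gx tail = Some y" "head \<noteq> tail"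
  by (auto simp: init_gx_def init_state_def lkd_def lkp_def ky_def ts_def nx_def pr_def now_def head_def tail_def)

lemma init_cm: "cm init_gx a \<longleftrightarrow> a = head \<or> a = tail"
  by (auto simp: cm_def BOT_def init_flds)

lemma init_rf: "rf init_gx head = Some tail" "rf init_gx tail = None"
  by (simp_all add: rf_def init_flds unm_def NULL_def)

lemma le0: "Pt 0 0 \<le> p" by (cases p) auto

lemma init_ginv: "ginv (init_gx :: ('k::linorder, 'v) gx)"
proof -
  have T: "tile (init_gx :: ('k::linorder, 'v) gx) p head tail" for p
    by (simp add: tile_def init_flds(1-12))
  have W: "wk (init_gx :: ('k::linorder, 'v) gx) p tail tail" for p
    by (rule wk.base) (simp_all add: init_cm init_flds(11) le0)
  have WT: "\<exists>x. wk (init_gx :: ('k::linorder, 'v) gx) p tail x \<and> tile (init_gx :: ('k, 'v) gx) p head x" for p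
    by (intro exI[of _ tail] conjI T W)
  show ?thesis
  proof (rule ginv.intro, goal_cases)
    case (3 a) then show ?case using init_flds(15,16) by (auto simp: init_flds(1))
  next
    case (20 n p c) then show ?case using WT by (auto simp: init_cm init_rf)
  qed (auto simp: init_flds(1-14) T init_cm init_rf alive_def le0 mf_def unm_def NULL_def
        init_gx_def[THEN arg_cong, of tm] init_gx_def[THEN arg_cong, of gG])
qed

lemma Sinv_init: "Sinv (init_state :: ('k::linorder, 'v) gstate)"
proof -
  interpret ginv "init_gx :: ('k::linorder, 'v) gx" by (rule init_ginv)
  have A: "Aval init_gx k p = None" for k :: 'k and p by (simp add: Aval_def Let_def init_flds)
  have U: "upds init_gx k = {}" for k :: 'k by (simp add: upds_def init_gx_def)
  have "hinv (init_gx :: ('k, 'v) gx)"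
  proof (unfold_locales, goal_cases)
    case (3 y) then show ?case by (simp add: init_flds init_cm)
  next
    case (6 a) then show ?case by (auto simp: init_flds unm_def NULL_def)
  next
    case (10 k) show ?case by (simp add: A U logk_def)
  next
    case (11 k) show ?case by (rule A)
  qed (auto simp: init_gx_def matches_def)
  moreover have "TI (init_gx :: ('k, 'v) gx) u (loc init_state u)" for u
    by (simp add: TI_def TI0_def init_state_def)
  moreover have "gm (init_gx :: ('k, 'v) gx) = mem init_state" "gG (init_gx :: ('k, 'v) gx) = gts (init_state :: ('k, 'v) gstate)"
     "gh (init_gx :: ('k, 'v) gx) = hist init_state"
    by (simp_all add: init_gx_def init_state_def)
  ultimately show ?thesis unfolding Sinv_def by blast
qed

section \<open>The linearization order\<close>

context hinv
begin

abbreviation (input) "ptf i \<equiv> fst (the (lin X i))"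

definition "isupd i \<longleftrightarrow> (\<exists>k q a b. (i, q, a, b) \<in> upds X k)"

text \<open>Doubling the second component makes room for placing, among the operations with equal
  linearization points, the updates before the lookups.\<close>
definition "skey i = Pt (pfst (ptf i)) (2 * psnd (ptf i) + (if isupd i then 0 else 1))"

lemma skey_le: "skey i \<le> skey j \<Longrightarrow> ptf i \<le> ptf j"
  by (auto simp: skey_def less_eq_pt_def split: if_splits)

lemma skey_less: "skey i \<le> skey j \<Longrightarrow> \<not> isupd i \<Longrightarrow> isupd j \<Longrightarrow> ptf i < ptf j"
  by (auto simp: skey_def less_eq_pt_def less_pt_def)

lemma lin_dom: "lin X i \<noteq> None \<Longrightarrow> is_inv (gh X) i"
  using h_lin[of i] by fastforce

definition "L = sort_key skey (sorted_list_of_set {i. lin X i \<noteq> None})"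

lemma fin: "finite {i. lin X i \<noteq> None}"
  by (rule finite_subset[of _ "{..<length (gh X)}"]) (use lin_dom is_inv_len in auto)

lemma set_L: "set L = {i. lin X i \<noteq> None}" using fin by (simp add: L_def)
lemma dist_L: "distinct L" using fin by (simp add: L_def)
lemma sorted_L: "i \<le> j \<Longrightarrow> j < length L \<Longrightarrow> skey (L ! i) \<le> skey (L ! j)"
  using sorted_sort_key[of skey "sorted_list_of_set {i. lin X i \<noteq> None}"] sorted_nth_mono[of "map skey L" i j]
  by (simp add: L_def)

abbreviation "Q j \<equiv> ptf (L ! j)"
definition "kupd k j \<longleftrightarrow> (\<exists>a b. (L ! j, Q j, a, b) \<in> upds X k)"
text \<open>Defined key by key: removes settled by one commit share a point, so the map between two
  of them in \<open>L\<close> need not be the map at any point.\<close>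

definition "ms j k = (if \<exists>m<j. kupd k m then Aval X k (Q (Max {m. m < j \<and> kupd k m})) else None)"

lemma upds_lin: "(i, q, a, b) \<in> upds X k \<Longrightarrow> lin X i \<noteq> None \<and> ptf i = q"
  by (auto simp: upds_def)

lemma Q_mono: "i \<le> j \<Longrightarrow> j < length L \<Longrightarrow> Q i \<le> Q j"
  using sorted_L skey_le by blast

lemma L_lin: "j < length L \<Longrightarrow> lin X (L ! j) \<noteq> None"
  using nth_mem[of j L] set_L by auto

text \<open>Between the last update of \<open>k\<close> placed before \<open>j\<close> and the point
  \<open>p\<close> there is no update of \<open>k\<close>, so by \<open>logk\<close> the value does
  not change.\<close>

lemma ms_Aval:
  assumes j: "j \<le> length L" and lo: "\<And>m. m < j \<Longrightarrow> kupd k m \<Longrightarrow> Q m \<le> p"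
    and hi: "\<And>m. j \<le> m \<Longrightarrow> m < length L \<Longrightarrow> kupd k m \<Longrightarrow> p < Q m"
  shows "ms j k = Aval X k p"
proof -
  define p1 where "p1 = (if \<exists>m<j. kupd k m then Q (Max {m. m < j \<and> kupd k m}) else Pt 0 0)"
  have mx: "Max {m. m < j \<and> kupd k m} \<in> {m. m < j \<and> kupd k m}" if "\<exists>m<j. kupd k m"
    using that by (intro Max_in) auto
  have ms: "ms j k = Aval X k p1" using h_zero by (auto simp: ms_def p1_def)
  have le: "p1 \<le> p" using mx lo by (auto simp: p1_def less_eq_pt_def[of "Pt 0 0"])
  show ?thesis
  proof (rule ccontr)
    assume "ms j k \<noteq> Aval X k p"
    then have "Aval X k p1 \<noteq> Aval X k p" using ms by simp
    then obtain i q a b where u: "(i, q, a, b) \<in> upds X k" "p1 < q" "q \<le> p"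
      using h_log[of k] le unfolding logk_def by blast
    have "i \<in> set L" using upds_lin[OF u(1)] set_L by blast
    then obtain m where m: "m < length L" "L ! m = i" by (auto simp: in_set_conv_nth)
    then have k: "kupd k m" "Q m = q" using u upds_lin[OF u(1)] by (auto simp: kupd_def)
    then have mj: "m < j" using hi[of m] m u(3) by (meson leD le_less_linear)
    then have "m \<le> Max {m. m < j \<and> kupd k m}" using k by (intro Max_ge) auto
    moreover have "Max {m. m < j \<and> kupd k m} < length L" using mx mj k j order_less_le_trans by blast
    ultimately have "q \<le> p1" using Q_mono[of m] k mj unfolding p1_def by auto
    then show False using u by simp
  qed
qed

lemma ms_Suc: "\<not> kupd k j \<Longrightarrow> ms (Suc j) k = ms j k"
proof -
  assume "\<not> kupd k j"
  then have "{m. m < Suc j \<and> kupd k m} = {m. m < j \<and> kupd k m}" by (auto simp: less_Suc_eq)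
  moreover have "(\<exists>m<Suc j. kupd k m) \<longleftrightarrow> (\<exists>m<j. kupd k m)" using \<open>\<not> kupd k j\<close> by (auto simp: less_Suc_eq)
  ultimately show ?thesis unfolding ms_def by presburger
qed

lemma ms_Suc_upd: "kupd k j \<Longrightarrow> ms (Suc j) k = Aval X k (Q j)"
proof -
  assume k: "kupd k j"
  have "Max {m. m < Suc j \<and> kupd k m} = j" using k by (intro Max_eqI) auto
  then show ?thesis using k by (auto simp: ms_def)
qed

text \<open>Uses the tie-breaking in \<open>skey\<close>: an update placed after a lookup has a
  strictly larger point.\<close>

lemma ms_lookup:
  assumes j: "j < length L" and n: "\<not> isupd (L ! j)"
  shows "ms j k = Aval X k (Q j)" "ms (Suc j) = ms j"
proof -
  have nk: "\<not> kupd k j" for k using n by (auto simp: kupd_def isupd_def)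
  show "ms (Suc j) = ms j" using ms_Suc nk by auto
  show "ms j k = Aval X k (Q j)"
  proof (rule ms_Aval)
    show "Q m \<le> Q j" if "m < j" for m using Q_mono[of m j] that j by simp
    show "Q j < Q m" if m: "j \<le> m" "m < length L" "kupd k m" for m
    proof -
      have "isupd (L ! m)" using m by (auto simp: kupd_def isupd_def)
      then show ?thesis using skey_less[OF sorted_L[OF m(1,2)] n] by simp
    qed
  qed (use j in simp)
qed

text \<open>By the last clause of \<open>logk\<close> no other update of \<open>k\<close> has the
  point \<open>q\<close>, so all earlier ones lie strictly before it.\<close>

lemma ms_update:
  assumes j: "j < length L" and u: "(L ! j, q, a, b) \<in> upds X k"
  shows "ms j k = a" "ms (Suc j) k = b" "k' \<noteq> k \<Longrightarrow> ms (Suc j) k' = ms j k'"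
proof -
  have q: "Q j = q" using upds_lin[OF u] by simp
  have kj: "kupd k j" using u q by (auto simp: kupd_def)
  obtain p0 where p0: "p0 < q" "\<And>p. p0 \<le> p \<Longrightarrow> p < q \<Longrightarrow> Aval X k p = a" and b: "Aval X k q = b"
    using h_log[of k] u unfolding logk_def by blast
  show "ms (Suc j) k = b" using ms_Suc_upd[OF kj] q b by simp
  have "\<not> kupd k' j" if "k' \<noteq> k" using u that by (auto simp: kupd_def upds_def)
  then show "k' \<noteq> k \<Longrightarrow> ms (Suc j) k' = ms j k'" using ms_Suc by blast
  have lt: "Q m < q" if m: "m < j" "kupd k m" for m
  proof -
    have "Q m \<noteq> q"
    proof
      assume "Q m = q"
      then obtain a' b' where "(L ! m, q, a', b') \<in> upds X k" using m by (auto simp: kupd_def)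
      then have "L ! m = L ! j" using h_log[of k] u unfolding logk_def by blast
      then show False using dist_L m j nth_eq_iff_index_eq[of L m j] by simp
    qed
    then show ?thesis using Q_mono[of m j] m j q by simp
  qed
  \<comment> \<open>A point before \<open>q\<close> that is not before \<open>p0\<close>, where the
    old value \<open>a\<close> holds, and not before the last earlier update of \<open>k\<close>,
    whose value \<open>ms j\<close> records.\<close>
  define p where "p = (if \<exists>m<j. kupd k m then max p0 (Q (Max {m. m < j \<and> kupd k m})) else p0)"
  have mx: "Max {m. m < j \<and> kupd k m} \<in> {m. m < j \<and> kupd k m}" if "\<exists>m<j. kupd k m"
    using that by (intro Max_in) auto
  have "p < q" using p0(1) mx lt by (auto simp: p_def)
  moreover have "p0 \<le> p" by (simp add: p_def)
  moreover have "ms j k = Aval X k p"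
  proof (rule ms_Aval)
    show "Q m \<le> p" if m: "m < j" "kupd k m" for m
    proof -
      have "m \<le> Max {m. m < j \<and> kupd k m}" using m by (intro Max_ge) auto
      moreover have "Max {m. m < j \<and> kupd k m} < length L" using mx m j order_less_trans by blast
      ultimately have "Q m \<le> Q (Max {m. m < j \<and> kupd k m})" by (rule Q_mono)
      then show ?thesis using m by (auto simp: p_def le_max_iff_disj)
    qed
    show "p < Q m" if m: "j \<le> m" "m < length L" for m
      using Q_mono[OF m] q \<open>p < q\<close> by simp
  qed (use j in simp)
  ultimately show "ms j k = a" using p0(2) by simp
qed

lemma spec_step:
  assumes j: "j < length L"
  shows "seq_spec (ms j) (op_of (gh X) (L ! j)) (snd (the (lin X (L ! j)))) (ms (Suc j))"
proof -
  obtain p r where l: "lin X (L ! j) = Some (p, r)" using L_lin[OF j] by auto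
  have ok: "linok X (op_of (gh X) (L ! j)) p r" and len: "L ! j < length (gh X)"
    using h_lin[OF l] is_inv_len by auto
  have look: "ms j k = Aval X k p" "ms (Suc j) = ms j" if "\<not> isupd (L ! j)" for k
    using ms_lookup[OF j that] l by auto
  show ?thesis
  proof (cases "op_of (gh X) (L ! j)")
    case (Insert k v)
    show ?thesis
    proof (cases "r = RV None")
      case True
      then have u: "(L ! j, p, None, Some v) \<in> upds X k" using Insert l len by (auto simp: upds_def)
      note m = ms_update[OF j u]
      have "ms (Suc j) = (ms j)(k \<mapsto> v)" using m by (auto simp: fun_eq_iff)
      then show ?thesis using Insert True l m by simp
    next
      case False
      then have "\<not> isupd (L ! j)" using Insert l by (auto simp: isupd_def upds_def)
      moreover obtain w where "r = RV (Some w)" "know X k p (Some w)" using ok False Insert by (auto simp: linok_def)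
      ultimately show ?thesis using Insert l look know_Aval by auto
    qed
  next
    case (Remove k)
    show ?thesis
    proof (cases "r = RV None")
      case False
      then obtain w where w: "r = RV (Some w)" using ok Remove by (auto simp: linok_def)
      then have u: "(L ! j, p, Some w, None) \<in> upds X k" using Remove l len by (auto simp: upds_def)
      note m = ms_update[OF j u]
      have "ms (Suc j) = (ms j)(k := None)" using m by (auto simp: fun_eq_iff)
      then show ?thesis using Remove w l m by simp
    next
      case True
      then have n: "\<not> isupd (L ! j)" using Remove l by (auto simp: isupd_def upds_def)
      have "know X k p None" using ok True Remove by (auto simp: linok_def)
      then have "ms j k = None" using look(1)[OF n] know_Aval by simp
      then have "(ms j)(k := None) = ms j" by auto
      then show ?thesis using Remove l True look(2)[OF n] \<open>ms j k = None\<close> by simp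
    qed
  next
    case (Contains k)
    then have n: "\<not> isupd (L ! j)" using l by (auto simp: isupd_def upds_def)
    obtain w where "r = RV w" "know X k p w" using ok Contains by (auto simp: linok_def)
    then show ?thesis using Contains l look[OF n] know_Aval by auto
  next
    case (RangeQuery a b)
    then have n: "\<not> isupd (L ! j)" using l by (auto simp: isupd_def upds_def)
    obtain xs where xs: "r = RR xs" "distinct (map fst xs)" "\<forall>(k, v)\<in>set xs. a \<le> k \<and> k \<le> b"
      and kn: "\<And>k. a \<le> k \<Longrightarrow> k \<le> b \<Longrightarrow> know X k p (map_of xs k)" using ok RangeQuery by (auto simp: linok_def)
    have "(k, v) \<in> set xs \<longleftrightarrow> a \<le> k \<and> k \<le> b \<and> ms j k = Some v" for k v
    proof (cases "a \<le> k \<and> k \<le> b")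
      case True
      then have "ms j k = map_of xs k" using kn look(1)[OF n, of k] know_Aval by simp
      then show ?thesis using True xs(2) by simp
    next
      case False then show ?thesis using xs(3) by auto
    qed
    then have "set xs = {(k, v). a \<le> k \<and> k \<le> b \<and> ms j k = Some v}" by auto
    moreover have "distinct xs" using xs(2) distinct_map by blast
    ultimately show ?thesis using RangeQuery l xs(1) look(2)[OF n] by auto
  qed
qed

theorem linearizable_hist: "linearizable (gh X)"
  unfolding linearizable_def
proof (intro exI conjI allI impI ballI)
  show "distinct L" by (rule dist_L)
  show "is_inv (gh X) i" if "i \<in> set L" for i using that set_L lin_dom by auto
  show "i \<in> set L" if "is_inv (gh X) i \<and> completed (gh X) i" for i
    using that h_match set_L by (fastforce simp: completed_def)
  show "p < q" if pq: "p < length L \<and> q < length L \<and> (\<exists>j r. matches (gh X) (L ! p) j r \<and> j < L ! q)" for p q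
  proof (rule ccontr)
    assume "\<not> p < q"
    then have "Q q \<le> Q p" using Q_mono pq by simp
    obtain j r where m: "matches (gh X) (L ! p) j r" "j < L ! q" using pq by blast
    then have "Q p < ht X j" using h_match by fastforce
    moreover obtain x where x: "lin X (L ! q) = Some x" using L_lin pq by blast
    then have "ht X (L ! q) < Q q" "L ! q < length (gh X)" using h_lin[of _ "fst x" "snd x"] is_inv_len by auto
    moreover have "ht X j < ht X (L ! q)" using h_mono[OF m(2)] calculation by simp
    ultimately show False using \<open>Q q \<le> Q p\<close> by simp
  qed
  show "ms 0 = Map.empty" by (auto simp: ms_def)
  show "seq_spec (ms p) (op_of (gh X) (L ! p)) (snd (the (lin X (L ! p)))) (ms (Suc p))" if "p < length L" for p
    using spec_step[OF that] .
  show "snd (the (lin X (L ! p))) = r" if "matches (gh X) (L ! p) j r" for p j r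
    using h_match[OF that] by auto
qed

end

lemma reachable_Sinv: "reachable s \<Longrightarrow> Sinv s"
  by (induction rule: reachable.induct) (auto intro: Sinv_init tstep_Sinv')

theorem theorem48:
  fixes s :: "('k::linorder, 'v) gstate"
  assumes "reachable s"
  shows "linearizable (hist s)"
proof -
  obtain X :: "('k, 'v) gx" where "hinv X" "gh X = hist s"
    using reachable_Sinv[OF assms] unfolding Sinv_def by blast
  then show ?thesis using hinv.linearizable_hist by metis
qed

end
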